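(* Consider the following problem: given a bipartite graph $G=(A\cup B,E)$ in which every node has a strict preference order over its neighbours, together with sets $E_0,E_1\subseteq E$ and $U_0,U_1\subseteq A\cup B$, decide whether there is a popular matching $M$ of $G$ with $E_1\subseteq M$, $E_0\cap M=\emptyset$, every node of $U_1$ matched in $M$, and every node of $U_0$ unmatched in $M$. This problem is NP-hard when restricted to instances satisfying any one of the following: (i) $|E_0|=2$; (ii) $|E_1|=2$; (iii) $|E_0|=|E_1|=1$; (iv) $|U_0|=|U_1|=1$; (v) $|U_0|=1$ and $|E_0\cup E_1|=1$; (vi) $|U_1|=1$ and $|E_0\cup E_1|=1$.
   Context: A matching is a set of pairwise disjoint edges; $M(u)$ denotes the partner of $u$ in $M$. An unmatched node prefers any neighbour to being unmatched. A node $u$ prefers matching $M$ to matching $N$ if either $u$ is matched in $M$ and unmatched in $N$, or $u$ is matched in both and prefers $M(u)$ to $N(u)$. Let $\phi(M,N)$ be the number of nodes preferring $M$ to $N$. A matching $M$ is popular if $\phi(M,N)\ge\phi(N,M)$ for every matching $N$. *)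

theory Defs
  imports Main "HOL-Computational_Algebra.Polynomial"
begin

section \<open>Polynomial time, NP and NP-hardness\<close>

text \<open>
  Deterministic Turing machines with finitely many two-way infinite tapes. Symbols and states are
  natural numbers: 0 is the blank, 1 and 2 are the two input bits; state 0 is the initial state,
  the states below \<open>num_states\<close> are the working states and \<open>num_states\<close> itself is the only halting
  state. Only the values of \<open>delta\<close> on working states and in-alphabet symbols matter, so
  \<open>turing_machine\<close> makes the control finite.
\<close>

datatype direction = Left | Stay | Right

record machine =
  num_tapes :: nat
  num_symbols :: nat
  num_states :: nat
  delta :: "nat \<Rightarrow> nat list \<Rightarrow> nat \<times> (nat \<times> direction) list"

definition turing_machine :: "machine \<Rightarrow> bool" where
  "turing_machine M \<longleftrightarrow> 3 \<le> num_symbols M \<and>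
     (\<forall>q < num_states M. \<forall>rs. length rs = num_tapes M \<and> set rs \<subseteq> {..<num_symbols M} \<longrightarrow>
        fst (delta M q rs) \<le> num_states M \<and>
        length (snd (delta M q rs)) = num_tapes M \<and>
        fst ` set (snd (delta M q rs)) \<subseteq> {..<num_symbols M})"

text \<open>A tape is its contents together with the position of the head.\<close>

type_synonym tape = "(int \<Rightarrow> nat) \<times> int"
type_synonym config = "nat \<times> tape list"

fun offset :: "direction \<Rightarrow> int" where
  "offset Left = -1"
| "offset Stay = 0"
| "offset Right = 1"

fun read_tape :: "tape \<Rightarrow> nat" where
  "read_tape (c, i) = c i"

fun act :: "nat \<times> direction \<Rightarrow> tape \<Rightarrow> tape" where
  "act (s, d) (c, i) = (c(i := s), i + offset d)"

definition step :: "machine \<Rightarrow> config \<Rightarrow> config" where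
  "step M cf = (case cf of (q, ts) \<Rightarrow>
     if q < num_states M
     then (case delta M q (map read_tape ts) of (q', as) \<Rightarrow> (q', map2 act as ts))
     else (q, ts))"

definition written :: "bool list \<Rightarrow> int \<Rightarrow> nat" where
  "written w i =
     (if 0 \<le> i \<and> i < int (length w) then (if w ! nat i then 2 else 1) else 0)"

text \<open>The input strings are on the first tapes; all the other tapes are blank.\<close>

definition init :: "machine \<Rightarrow> bool list list \<Rightarrow> config" where
  "init M ws =
     (0, map (\<lambda>j. (written (if j < length ws then ws ! j else []), 0)) [0..<num_tapes M])"

text \<open>
  The last tape is the output tape; it is never an input tape. As a halted configuration does not
  change any more, being halted after \<^term>\<open>t\<close> steps means halting within \<^term>\<open>t\<close> steps.
\<close>

definition computes_within :: "machine \<Rightarrow> bool list list \<Rightarrow> bool list \<Rightarrow> nat \<Rightarrow> bool" where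
  "computes_within M ws out t \<longleftrightarrow> length ws < num_tapes M \<and>
     (case (step M ^^ t) (init M ws) of (q, ts) \<Rightarrow>
        q = num_states M \<and> fst (last ts) = written out)"

definition poly_time :: "(bool list \<Rightarrow> bool list) \<Rightarrow> bool" where
  "poly_time f \<longleftrightarrow> (\<exists>M (p :: nat poly). turing_machine M \<and>
     (\<forall>x. computes_within M [x] (f x) (poly p (length x))))"

definition poly_time_rel :: "(bool list \<Rightarrow> bool list \<Rightarrow> bool) \<Rightarrow> bool" where
  "poly_time_rel R \<longleftrightarrow> (\<exists>M (p :: nat poly). turing_machine M \<and>
     (\<forall>x y. computes_within M [x, y] [R x y] (poly p (length x + length y))))"

definition NP :: "bool list set set" where
  "NP = {L. \<exists>R (p :: nat poly). poly_time_rel R \<and>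
     (\<forall>x. x \<in> L \<longleftrightarrow> (\<exists>y. length y \<le> poly p (length x) \<and> R x y))}"

text \<open>
  NP-hardness (polynomial-time many-one reductions) of the problem of recognising the strings in
  \<^term>\<open>Y\<close> among those in \<^term>\<open>X\<close>: every reduction has to produce strings in \<^term>\<open>X\<close>. For
  \<^prop>\<open>X = UNIV\<close> this is the NP-hardness of the language \<^term>\<open>Y\<close>.
\<close>

definition NP_hard :: "bool list set \<Rightarrow> bool list set \<Rightarrow> bool" where
  "NP_hard X Y \<longleftrightarrow>
     (\<forall>L\<in>NP. \<exists>f. poly_time f \<and> (\<forall>x. f x \<in> X \<and> (x \<in> L \<longleftrightarrow> f x \<in> Y)))"


section \<open>Popular matchings\<close>

text \<open>
  Edges are two-element sets of nodes; \<^term>\<open>P u v w\<close> means that the node \<^term>\<open>u\<close> prefers its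
  neighbour \<^term>\<open>v\<close> to its neighbour \<^term>\<open>w\<close>.
\<close>

definition matching :: "'v set set \<Rightarrow> 'v set set \<Rightarrow> bool" where
  "matching E M \<longleftrightarrow> M \<subseteq> E \<and> pairwise disjnt M"

definition matched :: "'v set set \<Rightarrow> 'v \<Rightarrow> bool" where
  "matched M u \<longleftrightarrow> u \<in> \<Union>M"

definition partner :: "'v set set \<Rightarrow> 'v \<Rightarrow> 'v" where
  "partner M u = (THE v. {u, v} \<in> M)"

definition prefers ::
  "('v \<Rightarrow> 'v \<Rightarrow> 'v \<Rightarrow> bool) \<Rightarrow> 'v \<Rightarrow> 'v set set \<Rightarrow> 'v set set \<Rightarrow> bool" where
  "prefers P u M N \<longleftrightarrow>
     (matched M u \<and> \<not> matched N u) \<or>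
     (matched M u \<and> matched N u \<and> P u (partner M u) (partner N u))"

definition votes ::
  "'v set \<Rightarrow> ('v \<Rightarrow> 'v \<Rightarrow> 'v \<Rightarrow> bool) \<Rightarrow> 'v set set \<Rightarrow> 'v set set \<Rightarrow> nat" where
  "votes V P M N = card {u \<in> V. prefers P u M N}"

definition popular ::
  "'v set \<Rightarrow> 'v set set \<Rightarrow> ('v \<Rightarrow> 'v \<Rightarrow> 'v \<Rightarrow> bool) \<Rightarrow> 'v set set \<Rightarrow> bool" where
  "popular V E P M \<longleftrightarrow>
     matching E M \<and> (\<forall>N. matching E N \<longrightarrow> votes V P M N \<ge> votes V P N M)"


section \<open>Popular matchings with forced and forbidden elements\<close>

text \<open>
  The nodes of an instance are \<open>0, \<dots>, length prefs - 1\<close>, the first \<open>left_size\<close> of them forming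
  the side \<open>A\<close>. The list \<open>prefs ! u\<close> enumerates the neighbours of \<open>u\<close>, most preferred first.
\<close>

record popm =
  left_size :: nat
  prefs :: "nat list list"
  E0_list :: "(nat \<times> nat) list"
  E1_list :: "(nat \<times> nat) list"
  U0_list :: "nat list"
  U1_list :: "nat list"

definition side_A :: "popm \<Rightarrow> nat set" where
  "side_A I = {..<left_size I}"

definition side_B :: "popm \<Rightarrow> nat set" where
  "side_B I = {left_size I..<length (prefs I)}"

definition nodes :: "popm \<Rightarrow> nat set" where
  "nodes I = side_A I \<union> side_B I"

definition edges :: "popm \<Rightarrow> nat set set" where
  "edges I = {{u, v} | u v. u \<in> nodes I \<and> v \<in> set (prefs I ! u)}"

definition pref :: "popm \<Rightarrow> nat \<Rightarrow> nat \<Rightarrow> nat \<Rightarrow> bool" where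
  "pref I u v w \<longleftrightarrow>
     (\<exists>i j. i < j \<and> j < length (prefs I ! u) \<and> prefs I ! u ! i = v \<and> prefs I ! u ! j = w)"

definition E0 :: "popm \<Rightarrow> nat set set" where
  "E0 I = (\<lambda>(u, v). {u, v}) ` set (E0_list I)"

definition E1 :: "popm \<Rightarrow> nat set set" where
  "E1 I = (\<lambda>(u, v). {u, v}) ` set (E1_list I)"

definition U0 :: "popm \<Rightarrow> nat set" where
  "U0 I = set (U0_list I)"

definition U1 :: "popm \<Rightarrow> nat set" where
  "U1 I = set (U1_list I)"

definition wf_popm :: "popm \<Rightarrow> bool" where
  "wf_popm I \<longleftrightarrow>
     left_size I \<le> length (prefs I) \<and>
     (\<forall>u\<in>nodes I. distinct (prefs I ! u)) \<and>
     (\<forall>a\<in>side_A I. set (prefs I ! a) \<subseteq> side_B I) \<and>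
     (\<forall>b\<in>side_B I. set (prefs I ! b) \<subseteq> side_A I) \<and>
     (\<forall>a\<in>side_A I. \<forall>b\<in>side_B I. b \<in> set (prefs I ! a) \<longleftrightarrow> a \<in> set (prefs I ! b)) \<and>
     E0 I \<subseteq> edges I \<and> E1 I \<subseteq> edges I \<and> U0 I \<subseteq> nodes I \<and> U1 I \<subseteq> nodes I"

definition solvable :: "popm \<Rightarrow> bool" where
  "solvable I \<longleftrightarrow> (\<exists>M. popular (nodes I) (edges I) (pref I) M \<and>
     E1 I \<subseteq> M \<and> E0 I \<inter> M = {} \<and>
     (\<forall>u\<in>U1 I. matched M u) \<and> (\<forall>u\<in>U0 I. \<not> matched M u))"

text \<open>
  Encoding of instances as bit strings. Node numbers are written in unary; as the nodes are
  numbered consecutively and each of them has an entry in \<open>prefs\<close>, the length is polynomial in the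
  size of the graph.
\<close>

definition enc_nat :: "nat \<Rightarrow> bool list" where
  "enc_nat n = replicate n True @ [False]"

definition enc_pair :: "nat \<times> nat \<Rightarrow> bool list" where
  "enc_pair e = enc_nat (fst e) @ enc_nat (snd e)"

definition enc_list :: "('a \<Rightarrow> bool list) \<Rightarrow> 'a list \<Rightarrow> bool list" where
  "enc_list g xs = concat (map (\<lambda>x. True # g x) xs) @ [False]"

definition enc :: "popm \<Rightarrow> bool list" where
  "enc I = enc_nat (left_size I) @ enc_list (enc_list enc_nat) (prefs I) @
     enc_list enc_pair (E0_list I) @ enc_list enc_pair (E1_list I) @
     enc_list enc_nat (U0_list I) @ enc_list enc_nat (U1_list I)"

lemma enc_nat_append_inject: "enc_nat m @ r = enc_nat n @ s \<longleftrightarrow> m = n \<and> r = s"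
proof (induction m arbitrary: n)
  case 0
  show ?case by (cases n) (simp_all add: enc_nat_def)
next
  case (Suc m)
  then show ?case by (cases n) (simp_all add: enc_nat_def)
qed

lemma enc_pair_append_inject: "enc_pair d @ r = enc_pair e @ s \<longleftrightarrow> d = e \<and> r = s"
  by (simp add: enc_pair_def enc_nat_append_inject prod_eq_iff)

lemma enc_list_append_inject:
  assumes g: "\<And>x y r s. g x @ r = g y @ s \<longleftrightarrow> x = y \<and> r = s"
  shows "enc_list g xs @ r = enc_list g ys @ s \<longleftrightarrow> xs = ys \<and> r = s"
proof (induction xs arbitrary: ys)
  case Nil
  show ?case by (cases ys) (simp_all add: enc_list_def)
next
  case (Cons x xs)
  have Cons_eq: "enc_list g (z # zs) = True # g z @ enc_list g zs" for z zs
    by (simp add: enc_list_def)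
  show ?case
  proof (cases ys)
    assume "ys = []"
    then show ?thesis by (simp add: enc_list_def)
  next
    fix y ys' assume "ys = y # ys'"
    then show ?thesis by (simp add: Cons_eq g Cons.IH)
  qed
qed

lemma enc_inject: "enc I = enc J \<longleftrightarrow> I = J"
proof -
  have nats: "enc_list enc_nat xs @ r = enc_list enc_nat ys @ s \<longleftrightarrow> xs = ys \<and> r = s" for xs ys r s
    by (rule enc_list_append_inject) (rule enc_nat_append_inject)
  have pairs: "enc_list enc_pair xs @ r = enc_list enc_pair ys @ s \<longleftrightarrow> xs = ys \<and> r = s" for xs ys r s
    by (rule enc_list_append_inject) (rule enc_pair_append_inject)
  have lists: "enc_list (enc_list enc_nat) xs @ r = enc_list (enc_list enc_nat) ys @ s
      \<longleftrightarrow> xs = ys \<and> r = s" for xs ys r s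
    by (rule enc_list_append_inject) (rule nats)
  have last: "enc_list enc_nat xs = enc_list enc_nat ys \<longleftrightarrow> xs = ys" for xs ys
    using nats[of xs "[]" ys "[]"] by simp
  show ?thesis
    unfolding enc_def enc_nat_append_inject lists pairs nats last by (cases I, cases J) simp
qed

text \<open>The problem restricted to the instances satisfying \<^term>\<open>C\<close>.\<close>

definition NP_hard_for :: "(popm \<Rightarrow> bool) \<Rightarrow> bool" where
  "NP_hard_for C \<longleftrightarrow>
     NP_hard (enc ` {I. wf_popm I \<and> C I}) (enc ` {I. wf_popm I \<and> C I \<and> solvable I})"

lemma NP_hard_for_mono:
  assumes C: "NP_hard_for C" and CD: "\<And>I. C I \<Longrightarrow> D I"
  shows "NP_hard_for D"
  unfolding NP_hard_for_def NP_hard_def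
proof
  fix L assume "L \<in> NP"
  from bspec[OF C[unfolded NP_hard_for_def NP_hard_def] this]
  obtain f where f: "poly_time f" "\<forall>x. f x \<in> enc ` {I. wf_popm I \<and> C I} \<and>
      (x \<in> L \<longleftrightarrow> f x \<in> enc ` {I. wf_popm I \<and> C I \<and> solvable I})"
    by (elim exE conjE)
  have mem: "enc I \<in> enc ` S \<longleftrightarrow> I \<in> S" for I S
    by (simp add: image_iff enc_inject)
  have "f x \<in> enc ` {I. wf_popm I \<and> D I} \<and>
      (x \<in> L \<longleftrightarrow> f x \<in> enc ` {I. wf_popm I \<and> D I \<and> solvable I})" for x
  proof -
    have fx: "f x \<in> enc ` {I. wf_popm I \<and> C I}"
        "x \<in> L \<longleftrightarrow> f x \<in> enc ` {I. wf_popm I \<and> C I \<and> solvable I}"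
      using f(2) by simp_all
    from fx(1) obtain I where I: "f x = enc I" "I \<in> {I. wf_popm I \<and> C I}"
      by (rule imageE)
    show ?thesis
      using fx(2) I(2) CD[of I] unfolding I(1) mem by simp
  qed
  then show "\<exists>f. poly_time f \<and> (\<forall>x. f x \<in> enc ` {I. wf_popm I \<and> D I} \<and>
      (x \<in> L \<longleftrightarrow> f x \<in> enc ` {I. wf_popm I \<and> D I \<and> solvable I}))"
    using f(1) by (intro exI[of _ f] conjI allI) simp_all
qed

end

theory Submission
  imports Defs
begin

text \<open>
  A matching \<open>M\<close> of a bipartite graph is popular iff it has a witness: an integral dual solution
  \<open>\<alpha>\<close> whose sum over every edge is at least the number of votes that the edge wins against \<open>M\<close>,
  and which sums to 0 over the edges of \<open>M\<close>. Two popular matchings satisfy complementary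
  slackness with respect to each other's witnesses, so no edge that loses both votes against some
  stable matching is in a popular matching.

  The computations of a nondeterministic machine are the solutions of a binary constraint
  satisfaction problem, which is reduced to popular matchings as follows. A 4-cycle
  whose two perfect matchings are its states represents each assignment \<open>c = t\<close> of a value to a
  variable, and \<open>\<alpha>\<close> is constant on one side of each cycle. The links between the cycles have
  weight 0 or \<open>-2\<close>, depending on the states, and propagate the value of \<open>\<alpha>\<close> exactly if
  the weight is 0; further links, which have the impossible weight 2 in some states, make all copies
  of \<open>c = t\<close> agree. One restriction on the matching forces \<open>\<alpha> = 1\<close> at the start of the resulting paths,
  the other one forces \<open>\<alpha> = 0\<close> at their ends. So the states must interrupt all paths; the path
  through all values \<open>t\<close> of a variable \<open>c\<close> is interrupted iff some \<open>c = t\<close> holds, and a path for each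
  conflict is interrupted iff one of the two conflicting assignments fails.

  The reduction is written in a small language of bounded loops which is compiled to Turing machines.
\<close>

section \<open>Witnesses of popularity\<close>

text \<open>A witness takes values between -1 and 1, so an edge of weight 2 forces the value 1 at
  both ends, while an unmatched node has the value 0. If \<open>PP\<close> and \<open>QQ\<close> are
  not matched to each other, \<open>PP\<close>-\<open>QQ\<close> is such an edge; if
  \<open>RR\<close> and \<open>TT\<close> are matched to each other, \<open>AA\<close> and
  \<open>ZZ\<close> are unmatched and put the value 0 on \<open>TT\<close> and \<open>RR\<close>.
  Each of these two situations can be enforced by a forbidden edge, by a forced edge or by a
  condition on one node, so a single graph serves all six cases.

  One cycle per assignment is not enough: the values on the chain of a variable depend on the chosen
  assignment, but the path of a conflict needs a cycle with the value 1 in both states and another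
  one whose value is at most 0 whenever its assignment holds. The copies \<open>KU\<close> and
  \<open>KV\<close> have these properties, and it suffices that the state of \<open>KG\<close> is
  passed on to them in one direction.

  Hardness is a statement about all of NP, so the source is the tableau of an arbitrary verifier.
  The number of options of a cell depends on the verifier only; hence the program unrolls the
  iteration over values and loops over the cells.\<close>

fun walk_weight :: "('a \<Rightarrow> 'a \<Rightarrow> int) \<Rightarrow> 'a list \<Rightarrow> int" where
  "walk_weight w (x # y # xs) = w x y + walk_weight w (y # xs)"
| "walk_weight w _ = 0"

lemma walk_weight_append:
  "walk_weight w (xs @ y # ys) = walk_weight w (xs @ [y]) + walk_weight w (y # ys)"
proof (induction xs)
  case (Cons x xs)
  then show ?case by (cases xs) auto
qed simp

lemma walk_weight_map2:
  "walk_weight w (x # xs @ [z]) = sum_list (map2 w (x # xs) (xs @ [z]))"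
  by (induction xs arbitrary: x) auto

text \<open>Rotating the list and fixing all other points is a permutation, and \<open>refl\<close>
  removes the fixed points from its sum. So a bound for all permutations bounds all simple
  cycles.\<close>

lemma sum_cyclic_permutation:
  assumes "finite X" "distinct xs" "xs \<noteq> []" "set xs \<subseteq> X" and refl: "\<And>x. x \<in> X \<Longrightarrow> w x x = 0"
  shows "\<exists>\<sigma>. bij_betw \<sigma> X X \<and> (\<Sum>x\<in>X. w x (\<sigma> x)) = walk_weight w (xs @ [hd xs])"
proof -
  define \<sigma> where "\<sigma> x = (case map_of (zip xs (rotate1 xs)) x of None \<Rightarrow> x | Some y \<Rightarrow> y)" for x
  have nth: "\<sigma> (xs ! i) = rotate1 xs ! i" if "i < length xs" for i
    using that assms(2) by (simp add: \<sigma>_def map_of_zip_nth)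
  have img: "\<sigma> ` set xs = set xs"
  proof -
    have "\<sigma> ` set xs = set (map \<sigma> xs)" by simp
    also have "map \<sigma> xs = rotate1 xs" by (rule nth_equalityI) (auto simp: nth)
    finally show ?thesis by simp
  qed
  have bij1: "bij_betw \<sigma> (set xs) (set xs)"
    using img by (simp add: bij_betw_def eq_card_imp_inj_on)
  have out: "\<sigma> x = x" if "x \<notin> set xs" for x
  proof -
    have "map_of (zip xs (rotate1 xs)) x = None"
      using that by (simp add: map_of_zip_is_None)
    then show ?thesis unfolding \<sigma>_def by (simp only: option.case)
  qed
  have bij2: "bij_betw \<sigma> (X - set xs) (X - set xs)"
    by (rule bij_betw_cong[THEN iffD1, OF _ bij_betw_id]) (simp add: out)
  have "bij_betw \<sigma> (set xs \<union> (X - set xs)) (set xs \<union> (X - set xs))"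
    by (rule bij_betw_combine[OF bij1 bij2]) auto
  moreover have "set xs \<union> (X - set xs) = X" using assms(4) by auto
  ultimately have bij: "bij_betw \<sigma> X X" by simp
  have "(\<Sum>x\<in>X. w x (\<sigma> x)) = (\<Sum>x\<in>set xs. w x (\<sigma> x))"
    by (rule sum.mono_neutral_right) (use assms out in auto)
  also have "\<dots> = sum_list (map (\<lambda>x. w x (\<sigma> x)) xs)"
    using assms(2) by (simp add: sum_list_distinct_conv_sum_set)
  also have "map (\<lambda>x. w x (\<sigma> x)) xs = map2 w xs (rotate1 xs)"
    by (rule nth_equalityI) (auto simp: nth)
  also have "sum_list (map2 w xs (rotate1 xs)) = walk_weight w (xs @ [hd xs])"
    using assms(3) walk_weight_map2[of w "hd xs" "tl xs" "hd xs"]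
    by (cases xs) auto
  finally show ?thesis using bij by blast
qed

text \<open>A repeated vertex splits a closed walk into two shorter closed walks, so the bound for
  simple cycles extends by induction on the length.\<close>

lemma closed_walk_nonpos:
  assumes cycle: "\<And>xs. distinct xs \<Longrightarrow> xs \<noteq> [] \<Longrightarrow> set xs \<subseteq> X \<Longrightarrow> walk_weight w (xs @ [hd xs]) \<le> 0"
  shows "xs \<noteq> [] \<Longrightarrow> set xs \<subseteq> X \<Longrightarrow> walk_weight w (xs @ [hd xs]) \<le> 0"
proof (induction xs rule: length_induct)
  case (1 ws)
  show ?case
  proof (cases "distinct ws")
    case True
    then show ?thesis using cycle 1 by blast
  next
    case False
    then obtain xs y ys zs where ws: "ws = xs @ [y] @ ys @ [y] @ zs"
      using not_distinct_decomp by blast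
    define h where "h = hd ws"
    have h: "hd (xs @ [y] @ zs) = h" by (cases xs) (auto simp: h_def ws)
    have len: "length (y # ys) < length ws" "length (xs @ [y] @ zs) < length ws"
      and sub: "set (y # ys) \<subseteq> X" "set (xs @ [y] @ zs) \<subseteq> X"
      using 1(3) by (auto simp: ws)
    have "walk_weight w ((y # ys) @ [hd (y # ys)]) \<le> 0"
      using 1(1)[rule_format, OF len(1)] sub(1) by blast
    moreover have "walk_weight w ((xs @ [y] @ zs) @ [hd (xs @ [y] @ zs)]) \<le> 0"
      using 1(1)[rule_format, OF len(2)] sub(2) by blast
    ultimately have le: "walk_weight w (y # ys @ [y]) \<le> 0" "walk_weight w (xs @ y # zs @ [h]) \<le> 0"
      by (simp_all only: h) simp_all
    have "walk_weight w (ws @ [h]) = walk_weight w (xs @ [y]) + walk_weight w (y # ys @ y # zs @ [h])"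
      using walk_weight_append[of w xs y "ys @ y # zs @ [h]"] by (simp add: ws)
    also have "\<dots> = walk_weight w (xs @ [y]) + walk_weight w (y # ys @ [y]) + walk_weight w (y # zs @ [h])"
      using walk_weight_append[of w "y # ys" y "zs @ [h]"] by simp
    also have "\<dots> = walk_weight w (y # ys @ [y]) + walk_weight w (xs @ y # zs @ [h])"
      using walk_weight_append[of w xs y "zs @ [h]"] by simp
    finally show ?thesis using le by (simp add: h_def)
  qed
qed

text \<open>Duality for the assignment problem in which the identity is optimal: the dual solution is a
  potential, obtained from the weights of the walks to a base point.\<close>

lemma potential_exists:
  assumes fin: "finite X" and z: "z \<in> X" and refl: "\<And>x. x \<in> X \<Longrightarrow> w x x = 0"
    and perm: "\<And>\<sigma>. bij_betw \<sigma> X X \<Longrightarrow> (\<Sum>x\<in>X. w x (\<sigma> x)) \<le> 0"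
  obtains y :: "'a \<Rightarrow> int" where "y z = 0" "\<And>u v. u \<in> X \<Longrightarrow> v \<in> X \<Longrightarrow> w u v \<le> y u - y v"
proof -
  have closed: "walk_weight w (xs @ [hd xs]) \<le> 0" if "xs \<noteq> []" "set xs \<subseteq> X" for xs
  proof (rule closed_walk_nonpos[OF _ that])
    fix xs assume "distinct xs" "xs \<noteq> []" "set xs \<subseteq> X"
    then have "\<exists>\<sigma>. bij_betw \<sigma> X X \<and> (\<Sum>x\<in>X. w x (\<sigma> x)) = walk_weight w (xs @ [hd xs])"
      by (intro sum_cyclic_permutation fin refl)
    then obtain \<sigma>
      where "bij_betw \<sigma> X X" "(\<Sum>x\<in>X. w x (\<sigma> x)) = walk_weight w (xs @ [hd xs])"
      by (elim exE conjE)
    then show "walk_weight w (xs @ [hd xs]) \<le> 0" using perm[of \<sigma>] by simp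
  qed
  define S where "S x = {walk_weight w (x # xs @ [z]) | xs. set xs \<subseteq> X}" for x
  define y where "y x = Sup (S x)" for x
  have S_I: "walk_weight w (x # xs @ [z]) \<in> S x" if "set xs \<subseteq> X" for x xs
    unfolding S_def using that by blast
  have ne: "S x \<noteq> {}" for x using S_I[of "[]" x] by auto
  \<comment> \<open>Prepending \<open>z\<close> closes the walk, so \<open>- w z x\<close> bounds
    the weights although there are infinitely many walks; the supremum in \<open>y\<close> needs
    this.\<close>
  have bound: "s \<le> - w z x" if "x \<in> X" "s \<in> S x" for x s
  proof -
    from that(2) obtain xs where xs: "s = walk_weight w (x # xs @ [z])" "set xs \<subseteq> X"
      by (auto simp: S_def)
    have "walk_weight w ((z # x # xs) @ [hd (z # x # xs)]) \<le> 0"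
      by (rule closed) (use xs that(1) z in simp_all)
    then show ?thesis by (simp add: xs(1))
  qed
  then have bdd: "bdd_above (S x)" if "x \<in> X" for x by (rule bdd_aboveI[of _ "- w z x"]) (use that in blast)
  have diff: "w u v \<le> y u - y v" if "u \<in> X" "v \<in> X" for u v
  proof -
    have "Sup (S v) \<le> y u - w u v"
    proof (rule cSup_least[OF ne])
      fix s assume "s \<in> S v"
      then obtain xs where xs: "s = walk_weight w (v # xs @ [z])" "set xs \<subseteq> X"
        by (auto simp: S_def)
      then have "w u v + s \<in> S u" using that(2) S_I[of "v # xs" u] by simp
      then have "w u v + s \<le> y u" unfolding y_def by (intro cSup_upper bdd that(1))
      then show "s \<le> y u - w u v" by simp
    qed
    then show ?thesis by (simp add: y_def)
  qed
  have "0 \<in> S z" using S_I[of "[]" z] refl[OF z] by simp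
  then have "0 \<le> y z" unfolding y_def by (intro cSup_upper bdd z)
  moreover have "y z \<le> 0" unfolding y_def
    by (rule cSup_least[OF ne]) (use bound[OF z] refl[OF z] in simp)
  ultimately have "y z = 0" by simp
  from that[OF this diff] show ?thesis .
qed

section \<open>Votes, witnesses and complementary slackness\<close>

definition ranks :: "('v \<Rightarrow> 'v \<Rightarrow> 'v \<Rightarrow> bool) \<Rightarrow> 'v \<Rightarrow> 'v \<Rightarrow> 'v \<Rightarrow> bool" where
  "ranks P u x y \<longleftrightarrow> x \<noteq> u \<and> (y = u \<or> P u x y)"

text \<open>A node in the role of its own partner stands for being unmatched; \<open>ranks\<close>
  puts it below all neighbours, so votes need no case distinction on being matched.\<close>

definition vote :: "('v \<Rightarrow> 'v \<Rightarrow> 'v \<Rightarrow> bool) \<Rightarrow> 'v \<Rightarrow> 'v \<Rightarrow> 'v \<Rightarrow> int" where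
  "vote P u x y = of_bool (ranks P u x y) - of_bool (ranks P u y x)"

text \<open>Matchings as involutions: the unmatched nodes are the fixed points.\<close>

definition assignment :: "'v set \<Rightarrow> ('v \<Rightarrow> 'v \<Rightarrow> bool) \<Rightarrow> ('v \<Rightarrow> 'v) \<Rightarrow> bool" where
  "assignment V adj \<mu> \<longleftrightarrow> (\<forall>u\<in>V. \<mu> u \<in> V \<and> \<mu> (\<mu> u) = u \<and> (\<mu> u \<noteq> u \<longrightarrow> adj u (\<mu> u)))"

text \<open>The condition \<open>vote P u u (\<mu> u) \<le> \<alpha> u\<close> is the edge condition
  for a loop at \<open>u\<close>, the option of leaving \<open>u\<close> unmatched. At a fixed point
  of \<mu> the first equation says that \<alpha> vanishes.\<close>

definition witness ::
  "'v set \<Rightarrow> ('v \<Rightarrow> 'v \<Rightarrow> bool) \<Rightarrow> ('v \<Rightarrow> 'v \<Rightarrow> 'v \<Rightarrow> bool) \<Rightarrow> ('v \<Rightarrow> 'v) \<Rightarrow> ('v \<Rightarrow> int) \<Rightarrow> bool" where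
  "witness V adj P \<mu> \<alpha> \<longleftrightarrow> assignment V adj \<mu> \<and>
     (\<forall>u\<in>V. \<alpha> u + \<alpha> (\<mu> u) = 0 \<and> vote P u u (\<mu> u) \<le> \<alpha> u) \<and>
     (\<forall>u\<in>V. \<forall>v\<in>V. adj u v \<longrightarrow> vote P u v (\<mu> u) + vote P v u (\<mu> v) \<le> \<alpha> u + \<alpha> v)"

lemma vote_antisym: "vote P u x y = - vote P u y x"
  by (simp add: vote_def)

lemma sum_assignment: "assignment V adj \<mu> \<Longrightarrow> (\<Sum>u\<in>V. f (\<mu> u)) = (\<Sum>u\<in>V. f u)"
  by (rule sum.reindex_bij_witness[of _ \<mu> \<mu>]) (auto simp: assignment_def)

text \<open>At a fixed point of \<nu> this is twice the loop condition; elsewhere it is the edge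
  condition.\<close>

lemma witness_slack:
  assumes w: "witness V adj P \<mu> \<alpha>" and \<nu>: "assignment V adj \<nu>" and u: "u \<in> V"
  shows "vote P u (\<nu> u) (\<mu> u) + vote P (\<nu> u) u (\<mu> (\<nu> u)) \<le> \<alpha> u + \<alpha> (\<nu> u)"
proof (cases "\<nu> u = u")
  case True
  then show ?thesis using w u by (force simp: witness_def)
next
  case False
  then show ?thesis using w u \<nu> by (auto simp: witness_def assignment_def)
qed

lemma witness_sum_zero:
  fixes \<alpha> :: "'v \<Rightarrow> int"
  assumes "witness V adj P \<mu> \<alpha>"
  shows "(\<Sum>u\<in>V. \<alpha> u) = 0"
proof -
  have "(\<Sum>u\<in>V. \<alpha> u + \<alpha> (\<mu> u)) = 0" using assms by (simp add: witness_def)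
  moreover have "(\<Sum>u\<in>V. \<alpha> (\<mu> u)) = (\<Sum>u\<in>V. \<alpha> u)"
    using assms sum_assignment[of V adj \<mu> \<alpha>] by (simp add: witness_def)
  ultimately show ?thesis by (simp add: sum.distrib)
qed

text \<open>Reindexing by the involution \<nu> turns the second sum of votes into the first, and the
  values of \<alpha> cancel along \<mu>.\<close>

lemma slack_sum:
  assumes w: "witness V adj P \<mu> \<alpha>" and \<nu>: "assignment V adj \<nu>"
  shows "(\<Sum>u\<in>V. \<alpha> u + \<alpha> (\<nu> u) - vote P u (\<nu> u) (\<mu> u) - vote P (\<nu> u) u (\<mu> (\<nu> u)))
    = - 2 * (\<Sum>u\<in>V. vote P u (\<nu> u) (\<mu> u))"
proof -
  have "(\<Sum>u\<in>V. vote P (\<nu> u) u (\<mu> (\<nu> u))) = (\<Sum>u\<in>V. vote P (\<nu> u) (\<nu> (\<nu> u)) (\<mu> (\<nu> u)))"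
    using \<nu> by (intro sum.cong) (auto simp: assignment_def)
  also have "\<dots> = (\<Sum>u\<in>V. vote P u (\<nu> u) (\<mu> u))"
    by (rule sum_assignment[OF \<nu>, of "\<lambda>v. vote P v (\<nu> v) (\<mu> v)"])
  finally show ?thesis
    using witness_sum_zero[OF w] sum_assignment[OF \<nu>, of \<alpha>] by (simp add: sum.distrib sum_subtractf)
qed

lemma witness_sum_vote_le:
  assumes w: "witness V adj P \<mu> \<alpha>" and \<nu>: "assignment V adj \<nu>"
  shows "(\<Sum>u\<in>V. vote P u (\<nu> u) (\<mu> u)) \<le> 0"
proof -
  have "0 \<le> (\<Sum>u\<in>V. \<alpha> u + \<alpha> (\<nu> u) - vote P u (\<nu> u) (\<mu> u) - vote P (\<nu> u) u (\<mu> (\<nu> u)))"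
    by (intro sum_nonneg) (use witness_slack[OF w \<nu>] in force)
  then show ?thesis unfolding slack_sum[OF w \<nu>] by simp
qed

text \<open>Weak duality for both witnesses makes the total vote between \<mu> and \<nu> equal to 0.
  So the slacks, which are nonnegative, sum to 0 and vanish one by one.\<close>

lemma witness_tight:
  assumes fin: "finite V" and w: "witness V adj P \<mu> \<alpha>" and w': "witness V adj P \<nu> \<beta>" and u: "u \<in> V"
  shows "vote P u (\<nu> u) (\<mu> u) + vote P (\<nu> u) u (\<mu> (\<nu> u)) = \<alpha> u + \<alpha> (\<nu> u)"
proof -
  have a: "assignment V adj \<mu>" "assignment V adj \<nu>" using w w' by (simp_all add: witness_def)
  have "(\<Sum>u\<in>V. vote P u (\<mu> u) (\<nu> u)) = - (\<Sum>u\<in>V. vote P u (\<nu> u) (\<mu> u))"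
    by (subst vote_antisym) (simp add: sum_negf)
  then have "(\<Sum>u\<in>V. vote P u (\<nu> u) (\<mu> u)) = 0"
    using witness_sum_vote_le[OF w a(2)] witness_sum_vote_le[OF w' a(1)] by simp
  then have "(\<Sum>u\<in>V. \<alpha> u + \<alpha> (\<nu> u) - vote P u (\<nu> u) (\<mu> u) - vote P (\<nu> u) u (\<mu> (\<nu> u))) = 0"
    unfolding slack_sum[OF w a(2)] by simp
  then have "\<forall>u\<in>V. \<alpha> u + \<alpha> (\<nu> u) - vote P u (\<nu> u) (\<mu> u) - vote P (\<nu> u) u (\<mu> (\<nu> u)) = 0"
    by (subst (asm) sum_nonneg_eq_0_iff[OF fin]) (use witness_slack[OF w a(2)] in force)+
  then show ?thesis using u by force
qed

section \<open>Matchings of a graph as involutions\<close>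

definition mate :: "'v set set \<Rightarrow> 'v \<Rightarrow> 'v" where
  "mate M u = (if matched M u then partner M u else u)"

locale finite_graph =
  fixes V :: "'v set" and E :: "'v set set"
  assumes finite_V: "finite V"
    and edgeE: "e \<in> E \<Longrightarrow> \<exists>u v. e = {u, v} \<and> u \<noteq> v \<and> u \<in> V \<and> v \<in> V"
begin

definition adj :: "'v \<Rightarrow> 'v \<Rightarrow> bool" where "adj u v \<longleftrightarrow> {u, v} \<in> E"

lemma adjD: "adj u v \<Longrightarrow> u \<noteq> v \<and> u \<in> V \<and> v \<in> V"
  unfolding adj_def by (auto dest!: edgeE simp: doubleton_eq_iff)

lemma matching_edge_iff:
  assumes M: "matching E M"
  shows "{u, v} \<in> M \<longleftrightarrow> u \<noteq> v \<and> mate M u = v"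
proof
  have part: "partner M u = v" if "{u, v} \<in> M" for u v
    unfolding partner_def
  proof (rule the_equality)
    fix w assume w: "{u, w} \<in> M"
    have "e = f" if "e \<in> M" "f \<in> M" "u \<in> e" "u \<in> f" for e f
      using M that by (auto simp: matching_def pairwise_def disjnt_def)
    from this[OF w that] have "{u, w} = {u, v}" by simp
    then show "w = v" by (auto simp: doubleton_eq_iff)
  qed fact
  have edge: "{u, v} \<in> M \<Longrightarrow> u \<noteq> v" for u v
    using M edgeE[of "{u, v}"] by (auto simp: matching_def doubleton_eq_iff)
  show "{u, v} \<in> M \<Longrightarrow> u \<noteq> v \<and> mate M u = v"
    using part[of u v] edge[of u v] by (auto simp: mate_def matched_def)
  show "{u, v} \<in> M" if "u \<noteq> v \<and> mate M u = v"
  proof -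
    from that have "matched M u" by (auto simp: mate_def split: if_splits)
    then obtain e where e: "e \<in> M" "u \<in> e" by (auto simp: matched_def)
    then obtain w where "e = {u, w}"
      using M edgeE[of e] by (auto simp: matching_def)
    then show ?thesis using e that part[of u w] by (auto simp: mate_def matched_def)
  qed
qed

lemma matched_iff_mate: "matching E M \<Longrightarrow> matched M u \<longleftrightarrow> mate M u \<noteq> u"
proof -
  assume M: "matching E M"
  show ?thesis
  proof
    assume "matched M u"
    then obtain e where e: "e \<in> M" "u \<in> e" by (auto simp: matched_def)
    then obtain w where "e = {u, w}"
      using M edgeE[of e] by (auto simp: matching_def)
    then show "mate M u \<noteq> u" using e(1) matching_edge_iff[OF M, of u w] by auto
  qed (auto simp: mate_def split: if_splits)
qed

lemma assignment_mate:
  assumes M: "matching E M"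
  shows "assignment V adj (mate M)"
  unfolding assignment_def
proof
  fix u assume u: "u \<in> V"
  show "mate M u \<in> V \<and> mate M (mate M u) = u \<and> (mate M u \<noteq> u \<longrightarrow> adj u (mate M u))"
  proof (cases "mate M u = u")
    case False
    then have e: "{u, mate M u} \<in> M" using matching_edge_iff[OF M, of u "mate M u"] by metis
    then have "{mate M u, u} \<in> M" by (simp only: insert_commute)
    then have "mate M (mate M u) = u" using matching_edge_iff[OF M, of "mate M u" u] by metis
    moreover have a: "adj u (mate M u)"
      using e M unfolding adj_def matching_def by blast
    ultimately show ?thesis using adjD[OF a] by simp
  qed (simp add: u)
qed

lemma matching_of_assignment:
  assumes \<mu>: "assignment V adj \<mu>"
  obtains M where "matching E M" "\<And>u. u \<in> V \<Longrightarrow> mate M u = \<mu> u"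
proof
  define M where "M = {{u, \<mu> u} | u. u \<in> V \<and> \<mu> u \<noteq> u}"
  have in_M: "e = {v, \<mu> v}" if "e \<in> M" "v \<in> e" for e v
    using that \<mu> by (auto simp: M_def assignment_def)
  have "M \<subseteq> E" using \<mu> by (auto simp: M_def assignment_def adj_def)
  moreover have "pairwise disjnt M"
    unfolding pairwise_def disjnt_def using in_M by blast
  ultimately show M: "matching E M" by (simp add: matching_def)
  fix u assume u: "u \<in> V"
  show "mate M u = \<mu> u"
  proof (cases "\<mu> u = u")
    case True
    then have "\<not> matched M u" using in_M[of _ u] \<mu>
      by (auto simp: matched_def M_def assignment_def)
    then show ?thesis by (simp add: mate_def True)
  next
    case False
    then have "{u, \<mu> u} \<in> M" using u by (auto simp: M_def)
    then show ?thesis using matching_edge_iff[OF M] by blast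
  qed
qed

text \<open>The sum counts the nodes that prefer the competitor minus those that prefer
  \<open>M\<close>, and every assignment comes from a matching.\<close>

lemma popular_iff_sum_vote:
  assumes M: "matching E M"
  shows "popular V E P M \<longleftrightarrow>
    (\<forall>\<nu>. assignment V adj \<nu> \<longrightarrow> (\<Sum>u\<in>V. vote P u (\<nu> u) (mate M u)) \<le> 0)"
proof -
  have prefers: "prefers P u M1 M2 \<longleftrightarrow> ranks P u (mate M1 u) (mate M2 u)"
    if "matching E M1" "matching E M2" for M1 M2 u
    using matched_iff_mate[OF that(1), of u] matched_iff_mate[OF that(2), of u]
    by (auto simp: prefers_def ranks_def mate_def)
  have diff: "(\<Sum>u\<in>V. vote P u (mate N u) (mate M u)) = int (votes V P N M) - int (votes V P M N)"
    if "matching E N" for N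
    using prefers[OF that M] prefers[OF M that] finite_V
    by (simp add: vote_def votes_def sum_subtractf flip: of_nat_diff sum.inter_filter)
      (simp add: Int_def of_bool_def sum.If_cases)
  show ?thesis
  proof
    assume pop: "popular V E P M"
    show "\<forall>\<nu>. assignment V adj \<nu> \<longrightarrow> (\<Sum>u\<in>V. vote P u (\<nu> u) (mate M u)) \<le> 0"
    proof (intro allI impI)
      fix \<nu> assume "assignment V adj \<nu>"
      then obtain N where N: "matching E N" "\<And>u. u \<in> V \<Longrightarrow> mate N u = \<nu> u"
        using matching_of_assignment by blast
      then have "(\<Sum>u\<in>V. vote P u (\<nu> u) (mate M u)) = (\<Sum>u\<in>V. vote P u (mate N u) (mate M u))"
        by simp
      also have "\<dots> \<le> 0" unfolding diff[OF N(1)] using pop N(1) by (simp add: popular_def)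
      finally show "(\<Sum>u\<in>V. vote P u (\<nu> u) (mate M u)) \<le> 0" .
    qed
  next
    assume le: "\<forall>\<nu>. assignment V adj \<nu> \<longrightarrow> (\<Sum>u\<in>V. vote P u (\<nu> u) (mate M u)) \<le> 0"
    have "votes V P N M \<le> votes V P M N" if "matching E N" for N
      using le assignment_mate[OF that] diff[OF that] by force
    then show "popular V E P M" using M by (simp add: popular_def)
  qed
qed

lemma popular_if_witness:
  assumes "matching E M" "witness V adj P (mate M) \<alpha>"
  shows "popular V E P M"
  using assms witness_sum_vote_le popular_iff_sum_vote by blast

end

section \<open>Strong duality in bipartite graphs\<close>

locale bipartite_graph = finite_graph V E for V :: "'v set" and E +
  fixes A B :: "'v set"
  assumes V_eq: "V = A \<union> B" and A_B_disjoint: "A \<inter> B = {}"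
    and bipartite: "e \<in> E \<Longrightarrow> \<exists>a\<in>A. \<exists>b\<in>B. e = {a, b}"
begin

lemma adj_sides: "adj u v \<Longrightarrow> u \<in> A \<longleftrightarrow> v \<in> B"
  using A_B_disjoint unfolding adj_def by (auto dest!: bipartite simp: doubleton_eq_iff)

lemma adj_commute: "adj u v \<longleftrightarrow> adj v u"
  by (simp add: adj_def insert_commute)

text \<open>The units are the matched edges, named after their ends in \<^term>\<open>A\<close>, the unmatched nodes and
  an additional element \<^term>\<open>None\<close>. A permutation \<open>\<sigma>\<close> of the units proposes the
  assignment that joins the end of \<open>x\<close> in \<^term>\<open>A\<close> to the end of \<open>\<sigma> x\<close> in \<^term>\<open>B\<close>, if these
  ends exist and are adjacent.\<close>

lemma witness_if_popular:
  assumes M: "matching E M" and pop: "popular V E P M"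
  obtains \<alpha> where "witness V adj P (mate M) \<alpha>"
proof -
  define m where "m = mate M"
  have m: "assignment V adj m" unfolding m_def by (rule assignment_mate[OF M])
  then have m_in: "m u \<in> V" and m_m: "m (m u) = u" and m_adj: "m u \<noteq> u \<Longrightarrow> adj u (m u)"
    if "u \<in> V" for u using that by (auto simp: assignment_def)
  have m_sides: "m u \<in> B \<longleftrightarrow> m u \<noteq> u" if "u \<in> A" for u
    using that m_adj[of u] adj_sides A_B_disjoint V_eq by auto
  have m_sides': "m u \<in> A \<longleftrightarrow> m u \<noteq> u" if "u \<in> B" for u
    using that m_adj[of u] adj_sides[of "m u" u] A_B_disjoint V_eq
    unfolding adj_commute[of u "m u"] by auto
  define X where "X = insert None (Some ` (A \<union> {b \<in> B. m b = b}))"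
  have finX: "finite X" using finite_V by (simp add: X_def V_eq)
  define endA where "endA x = (case x of Some u \<Rightarrow> if u \<in> A then Some u else None | None \<Rightarrow> None)" for x
  define endB where "endB x = (case x of Some u \<Rightarrow> if m u \<in> B then Some (m u) else None | None \<Rightarrow> None)" for x
  define loss where "loss e = (case e of Some u \<Rightarrow> vote P u u (m u) | None \<Rightarrow> 0)" for e
  \<comment> \<open>An arc whose two ends exist and are adjacent proposes an edge; every other arc
    leaves its ends unmatched, and these cast their loop votes.\<close>
  define w where "w x x' = (case (endA x, endB x') of
      (Some a, Some b) \<Rightarrow> if adj a b then vote P a b (m a) + vote P b a (m b) else loss (Some a) + loss (Some b)
    | (e, f) \<Rightarrow> loss e + loss f)" for x x'
  have w_refl: "w x x = 0" if x: "x \<in> X" for x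
  proof (cases x)
    case None
    then show ?thesis by (simp add: w_def endA_def endB_def loss_def)
  next
    case (Some u)
    then consider "u \<in> A" "m u \<in> B" | "u \<in> A" "m u = u" "u \<notin> B" | "u \<in> B" "m u = u" "u \<notin> A"
      using x m_sides[of u] A_B_disjoint by (auto simp: X_def)
    then show ?thesis
    proof cases
      case 1
      then have "m u \<noteq> u" "u \<in> V" using A_B_disjoint V_eq by auto
      then show ?thesis using 1 Some m_adj m_m
        by (simp add: w_def endA_def endB_def vote_def)
    qed (simp_all add: Some w_def endA_def endB_def loss_def vote_def)
  qed
  have None_X: "None \<in> X" by (simp add: X_def)
  have X_A: "Some a \<in> X" if "a \<in> A" for a using that by (simp add: X_def)
  have X_B: "Some (m b) \<in> X" if "b \<in> B" for b
    using that m_sides'[of b] by (cases "m b = b") (auto simp: X_def)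
  have perm: "(\<Sum>x\<in>X. w x (\<sigma> x)) \<le> 0" if \<sigma>: "bij_betw \<sigma> X X" for \<sigma>
  proof -
    \<comment> \<open>\<open>J\<close> collects the edges proposed by \<sigma>. They form a matching
      because \<sigma> is injective and \<open>m\<close> is an involution.\<close>
    define J where "J a b \<longleftrightarrow> a \<in> A \<and> b \<in> B \<and> adj a b \<and> \<sigma> (Some a) = Some (m b)" for a b
    define \<nu> where "\<nu> u = (if \<exists>v. J u v then SOME v. J u v else if \<exists>v. J v u then SOME v. J v u else u)" for u
    have J_right: "b = b'" if "J a b" "J a b'" for a b b'
    proof -
      have "m b = m b'" "b \<in> V" "b' \<in> V" using that V_eq by (auto simp: J_def)
      then show ?thesis using m_m by metis
    qed
    have J_left: "a = a'" if "J a b" "J a' b" for a a' b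
      using inj_onD[OF bij_betw_imp_inj_on[OF \<sigma>], of "Some a" "Some a'"] that X_A by (simp add: J_def)
    have J_sides: "\<not> J b a" if "J a b'" "J a'' b" for a b a'' b'
      using that A_B_disjoint by (auto simp: J_def)
    have J_nu: "\<nu> a = b" "\<nu> b = a" if "J a b" for a b
    proof -
      have "(SOME v. J a v) = b" by (rule some_equality) (use that J_right in blast)+
      then show "\<nu> a = b" using that by (auto simp: \<nu>_def)
      have "(SOME v. J v b) = a" by (rule some_equality) (use that J_left in blast)+
      moreover have "\<not> J b v" for v using that A_B_disjoint by (auto simp: J_def)
      ultimately show "\<nu> b = a" using that by (auto simp: \<nu>_def)
    qed
    have nu_fix: "\<nu> u = u" if "\<And>v. \<not> J u v" "\<And>v. \<not> J v u" for u
      using that by (simp add: \<nu>_def)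
    have \<nu>: "assignment V adj \<nu>"
      unfolding assignment_def
    proof
      fix u assume u: "u \<in> V"
      consider v where "J u v" | v where "J v u" | "\<nu> u = u" using nu_fix by blast
      then show "\<nu> u \<in> V \<and> \<nu> (\<nu> u) = u \<and> (\<nu> u \<noteq> u \<longrightarrow> adj u (\<nu> u))"
      proof cases
        case 1
        then show ?thesis using J_nu[OF 1] by (auto simp: J_def V_eq)
      next
        case 2
        then show ?thesis using J_nu[OF 2] adj_commute by (auto simp: J_def V_eq)
      qed (use u in simp)
    qed
    define gain where "gain e = (case e of Some u \<Rightarrow> vote P u (\<nu> u) (m u) | None \<Rightarrow> 0)" for e
    \<comment> \<open>Each arc accounts for its end in \<open>A\<close> and its end in
      \<open>B\<close>. As \<sigma> permutes the units, all arcs together count every node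
      once.\<close>
    have split: "w x (\<sigma> x) = gain (endA x) + gain (endB (\<sigma> x))" if x: "x \<in> X" for x
    proof -
      have \<sigma>x: "\<sigma> x \<in> X" using \<sigma> x by (auto simp: bij_betw_def)
      have endA: "x = Some a" "a \<in> A" if "endA x = Some a" for a
        using that by (auto simp: endA_def split: option.splits if_splits)
      have endB: "\<sigma> x = Some (m b)" "b \<in> B" if b: "endB (\<sigma> x) = Some b" for b
      proof -
        from b obtain z where z: "\<sigma> x = Some z" "b = m z" "b \<in> B"
          by (auto simp: endB_def split: option.splits if_splits)
        then have "z \<in> V" using \<sigma>x V_eq by (auto simp: X_def)
        then show "\<sigma> x = Some (m b)" "b \<in> B" using z m_m by auto
      qed
      have endB': "endB (Some (m b)) = Some b" if "b \<in> B" for b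
        using that m_m[of b] V_eq by (simp add: endB_def)
      have A_no_J: "\<not> J v a" if "endA x = Some a" for a v
        using endA[OF that] A_B_disjoint by (auto simp: J_def)
      have B_no_J: "\<not> J b v" if "endB (\<sigma> x) = Some b" for b v
        using endB[OF that] A_B_disjoint by (auto simp: J_def)
      have J_A: "endB (\<sigma> x) = Some b" if "endA x = Some a" "J a b" for a b
        using endA[OF that(1)] that(2) endB' by (auto simp: J_def)
      have J_B: "endA x = Some a" if "endB (\<sigma> x) = Some b" "J a b" for a b
      proof -
        have "\<sigma> x = \<sigma> (Some a)" using endB[OF that(1)] that(2) by (simp add: J_def)
        then have "x = Some a"
          using inj_onD[OF bij_betw_imp_inj_on[OF \<sigma>], of x "Some a"] x X_A[of a] that(2)
          by (simp add: J_def)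
        then show ?thesis using that(2) by (simp add: endA_def J_def)
      qed
      show ?thesis
      proof (cases "endA x")
        case None
        then have "endB (\<sigma> x) = Some b \<Longrightarrow> \<nu> b = b" for b
          using nu_fix[of b] B_no_J J_B by fastforce
        then show ?thesis using None by (auto simp: w_def gain_def loss_def split: option.splits)
      next
        case (Some a)
        note a = Some
        show ?thesis
        proof (cases "endB (\<sigma> x)")
          case None
          then have "\<nu> a = a" using nu_fix[of a] A_no_J[OF a] J_A[OF a] by fastforce
          then show ?thesis using a None by (auto simp: w_def gain_def loss_def)
        next
          case (Some b)
          show ?thesis
          proof (cases "adj a b")
            case True
            then have "J a b" using endA[OF a] endB[OF Some] by (simp add: J_def)
            then show ?thesis using J_nu True a Some by (simp add: w_def gain_def)
          next
            case False
            then have "\<not> J a b" by (simp add: J_def)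
            then have "\<nu> a = a" "\<nu> b = b"
              using nu_fix[of a] nu_fix[of b] A_no_J[OF a] B_no_J[OF Some] J_A[OF a] J_B[OF Some] a Some
              by (metis option.inject)+
            then show ?thesis using False a Some by (simp add: w_def gain_def loss_def)
          qed
        qed
      qed
    qed
    have sum_A: "(\<Sum>x\<in>X. gain (endA x)) = (\<Sum>u\<in>A. vote P u (\<nu> u) (m u))"
    proof -
      have "(\<Sum>x\<in>X. gain (endA x)) = (\<Sum>x\<in>Some ` A. gain (endA x))"
        by (rule sum.mono_neutral_right) (use finX in \<open>auto simp: X_def endA_def gain_def\<close>)
      also have "\<dots> = (\<Sum>u\<in>A. vote P u (\<nu> u) (m u))"
        by (subst sum.reindex) (auto simp: endA_def gain_def)
      finally show ?thesis .
    qed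
    have sum_B: "(\<Sum>x\<in>X. gain (endB x)) = (\<Sum>u\<in>B. vote P u (\<nu> u) (m u))"
    proof -
      have "x \<in> (\<lambda>b. Some (m b)) ` B" if "x \<in> X" "endB x \<noteq> None" for x
      proof -
        from that obtain z where "x = Some z" "m z \<in> B" "z \<in> V"
          using V_eq by (auto simp: endB_def X_def split: if_splits)
        then show ?thesis using m_m by (auto intro!: image_eqI[of _ _ "m z"])
      qed
      then have "(\<Sum>x\<in>X. gain (endB x)) = (\<Sum>x\<in>(\<lambda>b. Some (m b)) ` B. gain (endB x))"
        by (intro sum.mono_neutral_right) (use finX X_B in \<open>force simp: gain_def\<close>)+
      also have "\<dots> = (\<Sum>u\<in>B. gain (endB (Some (m u))))"
      proof (subst sum.reindex)
        show "inj_on (\<lambda>b. Some (m b)) B"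
          by (rule inj_on_inverseI[of _ "\<lambda>x. m (the x)"]) (simp add: m_m V_eq)
      qed simp
      also have "\<dots> = (\<Sum>u\<in>B. vote P u (\<nu> u) (m u))"
        by (rule sum.cong) (auto simp: endB_def gain_def m_m V_eq)
      finally show ?thesis .
    qed
    have "(\<Sum>x\<in>X. w x (\<sigma> x)) = (\<Sum>x\<in>X. gain (endA x)) + (\<Sum>x\<in>X. gain (endB (\<sigma> x)))"
      by (simp add: split sum.distrib)
    also have "(\<Sum>x\<in>X. gain (endB (\<sigma> x))) = (\<Sum>x\<in>X. gain (endB x))"
      by (rule sum.reindex_bij_betw[OF \<sigma>])
    also have "(\<Sum>x\<in>X. gain (endA x)) + (\<Sum>x\<in>X. gain (endB x)) = (\<Sum>u\<in>V. vote P u (\<nu> u) (m u))"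
      unfolding sum_A sum_B using finite_V A_B_disjoint by (simp add: V_eq sum.union_disjoint)
    also have "\<dots> \<le> 0"
      using pop \<nu> popular_iff_sum_vote[OF M] by (simp add: m_def)
    finally show ?thesis .
  qed
  obtain y :: "'v option \<Rightarrow> int" where y: "y None = 0" "\<And>x x'. x \<in> X \<Longrightarrow> x' \<in> X \<Longrightarrow> w x x' \<le> y x - y x'"
    using potential_exists[of X None w, OF finX None_X w_refl perm] by blast
  \<comment> \<open>Arcs run from \<open>A\<close> to \<open>B\<close>, so the sign is reversed on
    \<open>B\<close>: differences of the potential become sums of \<alpha>. The unit of a node in
    \<open>B\<close> is named after its mate \<open>m u\<close>.\<close>
  define \<alpha> where "\<alpha> u = (if u \<in> A then y (Some u) else - y (Some (m u)))" for u
  have B_not_A: "b \<notin> A" if "b \<in> B" for b using that A_B_disjoint by auto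
  \<comment> \<open>\<open>None\<close> has no ends, so the arc from the unit of \<open>u\<close> to
    \<open>None\<close>, or back if \<open>u\<close> is in \<open>B\<close>, leaves \<open>u\<close>
    unmatched; its inequality is the loop condition.\<close>
  have loops: "vote P u u (m u) \<le> \<alpha> u" if "u \<in> V" for u
  proof (cases "u \<in> A")
    case True
    then show ?thesis using y(2)[OF X_A None_X, of u] y(1)
      by (simp add: \<alpha>_def w_def endA_def endB_def loss_def)
  next
    case False
    then have u: "u \<in> B" using that V_eq by auto
    then show ?thesis using False y(2)[OF None_X X_B, of u] y(1) that
      by (simp add: \<alpha>_def w_def endA_def endB_def loss_def m_m)
  qed
  have zero: "\<alpha> u + \<alpha> (m u) = 0" if u: "u \<in> V" for u
  proof (cases "m u = u")
    case True
    have "0 \<le> \<alpha> u" using loops[OF u] by (simp add: True vote_def)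
    \<comment> \<open>The opposite arc has weight 0, since an unmatched unit has an end on one side
      only.\<close>
    moreover have "\<alpha> u \<le> 0"
    proof (cases "u \<in> A")
      case A: True
      then show ?thesis using y(2)[OF None_X X_A[OF A]] y(1) True m_sides[OF A]
        by (simp add: \<alpha>_def w_def endA_def endB_def loss_def)
    next
      case A: False
      then have b: "u \<in> B" using u V_eq by auto
      show ?thesis using y(2)[OF X_B[OF b] None_X] y(1) True A
        by (simp add: \<alpha>_def w_def endA_def endB_def loss_def)
    qed
    ultimately show ?thesis using True by simp
  next
    case False
    then show ?thesis using m_sides[of u] m_sides'[of u] m_m[OF u] u V_eq B_not_A
      by (auto simp: \<alpha>_def)
  qed
  have edge: "vote P a b (m a) + vote P b a (m b) \<le> \<alpha> a + \<alpha> b" if "adj a b" "a \<in> A" for a b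
  proof -
    have b: "b \<in> B" using that adj_sides by auto
    then have "b \<in> V" by (simp add: V_eq)
    then show ?thesis using y(2)[OF X_A[OF that(2)] X_B[OF b]] that b B_not_A[OF b]
      by (simp add: \<alpha>_def w_def endA_def endB_def m_m)
  qed
  have edge': "vote P u v (m u) + vote P v u (m v) \<le> \<alpha> u + \<alpha> v" if "adj u v" for u v
  proof (cases "u \<in> A")
    case True
    then show ?thesis using edge that by blast
  next
    case False
    then have "v \<in> A" using that adjD[OF that] adj_sides[of v u] adj_commute V_eq by auto
    then show ?thesis using edge[of v u] that adj_commute by (simp add: add.commute)
  qed
  have "witness V adj P m \<alpha>"
    using m zero loops edge' by (simp add: witness_def)
  then show ?thesis using that by (simp add: m_def)
qed

end

section \<open>Constraint satisfaction by popular matchings\<close>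

text \<open>\<open>pref I u\<close> is this order on \<open>prefs I ! u\<close>. Separated from
  instances, it can be evaluated by the simplifier on explicit lists.\<close>

definition before :: "'a list \<Rightarrow> 'a \<Rightarrow> 'a \<Rightarrow> bool" where
  "before xs v w \<longleftrightarrow> (\<exists>i j. i < j \<and> j < length xs \<and> xs ! i = v \<and> xs ! j = w)"

lemma before_Nil [simp]: "\<not> before [] v w"
  by (simp add: before_def)

lemma before_Cons [simp]: "before (x # xs) v w \<longleftrightarrow> v = x \<and> w \<in> set xs \<or> before xs v w"
proof
  assume "before (x # xs) v w"
  then obtain i j where ij: "i < j" "j < Suc (length xs)" "(x # xs) ! i = v" "(x # xs) ! j = w"
    by (auto simp: before_def)
  then obtain j' where j: "j = Suc j'" "j' < length xs" by (cases j) auto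
  show "v = x \<and> w \<in> set xs \<or> before xs v w"
  proof (cases i)
    case 0
    then show ?thesis using ij j by auto
  next
    case (Suc i')
    then have "before xs v w" unfolding before_def using ij j by (intro exI[of _ i'] exI[of _ j']) auto
    then show ?thesis ..
  qed
next
  assume "v = x \<and> w \<in> set xs \<or> before xs v w"
  then show "before (x # xs) v w"
  proof
    assume "v = x \<and> w \<in> set xs"
    then obtain j where "j < length xs" "xs ! j = w" "v = x" by (auto simp: in_set_conv_nth)
    then show ?thesis unfolding before_def by (intro exI[of _ 0] exI[of _ "Suc j"]) auto
  next
    assume "before xs v w"
    then obtain i j where "i < j" "j < length xs" "xs ! i = v" "xs ! j = w"
      by (auto simp: before_def)
    then show ?thesis unfolding before_def by (intro exI[of _ "Suc i"] exI[of _ "Suc j"]) auto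
  qed
qed

lemma before_append [simp]:
  "before (xs @ ys) v w \<longleftrightarrow> before xs v w \<or> before ys v w \<or> v \<in> set xs \<and> w \<in> set ys"
  by (induction xs) auto

lemma before_in_set: "before xs v w \<Longrightarrow> v \<in> set xs \<and> w \<in> set xs"
  by (auto simp: before_def)

lemma before_notin [simp]: "v \<notin> set xs \<Longrightarrow> \<not> before xs v w" "w \<notin> set xs \<Longrightarrow> \<not> before xs v w"
  using before_in_set by fast+

section \<open>The graph of the reduction\<close>

datatype kind = KG | KU | KV

text \<open>The path \<open>SS\<close>-\<open>PP\<close>-\<open>QQ\<close>-\<open>BB\<close> is the
  source of the value 1, the path
  \<open>AA\<close>-\<open>TT\<close>-\<open>RR\<close>-\<open>ZZ\<close> the sink of value 0. The
  gadgets hang between \<open>SS\<close> and \<open>RR\<close>.\<close>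

datatype 'c node = PP | BB | AA | RR | SS | QQ | TT | ZZ
  | A1 kind 'c nat | A2 kind 'c nat | B1 kind 'c nat | B2 kind 'c nat

text \<open>
  \<^term>\<open>Cs\<close> lists the variables of a binary constraint satisfaction problem, \<^term>\<open>{1..K}\<close> is their
  domain, \<open>conf c t c' t'\<close> forbids \<open>c = t \<and> c' = t'\<close>. Each of the gadgets \<^term>\<open>KG\<close>, \<^term>\<open>KU\<close>, \<^term>\<open>KV\<close>
  for \<open>c\<close>, \<open>t\<close> is a 4-cycle; its state \<open>A1\<close>-\<open>B1\<close>, \<open>A2\<close>-\<open>B2\<close> means \<open>c = t\<close>. The gadgets
  for \<open>t = 0\<close> are dummies that start the chains of the gadgets \<^term>\<open>KG\<close>.
\<close>

locale csp =
  fixes Cs :: "'c list" and K :: nat and conf :: "'c \<Rightarrow> nat \<Rightarrow> 'c \<Rightarrow> nat \<Rightarrow> bool"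
  assumes distinct_Cs: "distinct Cs"
begin

definition opts :: "('c \<times> nat) list" where
  "opts = List.product Cs [0..<Suc K]"

text \<open>Preferences run round each 4-cycle: \<open>A1\<close> prefers \<open>B1\<close>, which
  prefers \<open>A2\<close>, which prefers \<open>B2\<close>, which prefers \<open>A1\<close>. So in
  both states an edge of the cycle outside the matching wins one vote and loses one. A link listed
  between the two partners in the cycle gets a vote that depends on the state; a link listed before
  or after both of them gets a fixed vote.\<close>

fun pref_list :: "'c node \<Rightarrow> 'c node list" where
  "pref_list PP = [QQ, SS]"
| "pref_list BB = [QQ]"
| "pref_list AA = [TT]"
| "pref_list RR = [TT, ZZ] @ map (\<lambda>c. B1 KG c K) Cs @ map (\<lambda>x. B1 KV (fst x) (snd x)) opts"
| "pref_list SS = map (\<lambda>x. A1 KU (fst x) (snd x)) opts @ map (\<lambda>c. A1 KG c 0) Cs @ [PP]"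
| "pref_list QQ = [PP, BB]"
| "pref_list TT = [RR, AA] @ map (\<lambda>x. A1 KG (fst x) (snd x)) opts"
| "pref_list ZZ = [RR]"
| "pref_list (A1 KG c t) = [TT, B1 KG c t] @ (if 0 < t then [B2 KG c (t - 1)] else []) @
     [B2 KG c t] @ (if t = 0 then [SS] else [])"
| "pref_list (A1 KU c t) = [B1 KU c t, B1 KG c t, B2 KU c t, SS]"
| "pref_list (A1 KV c t) = [B1 KV c t, B1 KG c t, B2 KV c t] @
     map (\<lambda>x. B1 KU (fst x) (snd x)) (filter (\<lambda>x. conf (fst x) (snd x) c t) opts)"
| "pref_list (A2 k c t) = [B2 k c t, B1 k c t]"
| "pref_list (B1 KG c t) = (if t = K then [RR] else []) @ [A2 KG c t, A1 KU c t, A1 KV c t, A1 KG c t]"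
| "pref_list (B1 KU c t) = [A2 KU c t] @
     map (\<lambda>x. A1 KV (fst x) (snd x)) (filter (\<lambda>x. conf c t (fst x) (snd x)) opts) @ [A1 KU c t]"
| "pref_list (B1 KV c t) = [A2 KV c t, RR, A1 KV c t]"
| "pref_list (B2 k c t) = [A1 k c t, A2 k c t] @ (if k = KG \<and> t < K then [A1 KG c (t + 1)] else [])"

definition V_A :: "'c node set" where
  "V_A = {PP, BB, AA, RR} \<union> (\<Union>k. \<Union>c\<in>set Cs. \<Union>t\<in>{..K}. {A1 k c t, A2 k c t})"

definition V_B :: "'c node set" where
  "V_B = {SS, QQ, TT, ZZ} \<union> (\<Union>k. \<Union>c\<in>set Cs. \<Union>t\<in>{..K}. {B1 k c t, B2 k c t})"

definition Vs :: "'c node set" where "Vs = V_A \<union> V_B"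

definition nbr :: "'c node \<Rightarrow> 'c node \<Rightarrow> bool" where "nbr u v \<longleftrightarrow> v \<in> set (pref_list u)"

abbreviation "P u \<equiv> before (pref_list u)"

lemma set_opts: "x \<in> set opts \<longleftrightarrow> fst x \<in> set Cs \<and> snd x \<le> K"
  by (cases x) (auto simp: opts_def)

lemma ex_opts [simp]:
  "(\<exists>x\<in>set opts. c = fst x \<and> t = snd x) \<longleftrightarrow> c \<in> set Cs \<and> t \<le> K"
  by (auto simp: set_opts intro!: bexI[of _ "(c, t)"])

lemma V_simps [simp]:
  "PP \<in> V_A" "BB \<in> V_A" "AA \<in> V_A" "RR \<in> V_A" "SS \<in> V_B" "QQ \<in> V_B" "TT \<in> V_B" "ZZ \<in> V_B"
  "A1 k c t \<in> V_A \<longleftrightarrow> c \<in> set Cs \<and> t \<le> K" "A2 k c t \<in> V_A \<longleftrightarrow> c \<in> set Cs \<and> t \<le> K"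
  "B1 k c t \<in> V_B \<longleftrightarrow> c \<in> set Cs \<and> t \<le> K" "B2 k c t \<in> V_B \<longleftrightarrow> c \<in> set Cs \<and> t \<le> K"
  "PP \<notin> V_B" "BB \<notin> V_B" "AA \<notin> V_B" "RR \<notin> V_B" "SS \<notin> V_A" "QQ \<notin> V_A" "TT \<notin> V_A" "ZZ \<notin> V_A"
  "A1 k c t \<notin> V_B" "A2 k c t \<notin> V_B" "B1 k c t \<notin> V_A" "B2 k c t \<notin> V_A"
  by (auto simp: V_A_def V_B_def)

lemma V_A_cases:
  assumes "u \<in> V_A"
  obtains "u = PP" | "u = BB" | "u = AA" | "u = RR"
  | c t where "u = A1 KG c t" "c \<in> set Cs" "t \<le> K" | c t where "u = A1 KU c t" "c \<in> set Cs" "t \<le> K"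
  | c t where "u = A1 KV c t" "c \<in> set Cs" "t \<le> K" | k c t where "u = A2 k c t" "c \<in> set Cs" "t \<le> K"
  using assms by (auto simp: V_A_def intro: kind.exhaust) (metis kind.exhaust)

lemma V_B_cases:
  assumes "u \<in> V_B"
  obtains "u = SS" | "u = QQ" | "u = TT" | "u = ZZ"
  | c t where "u = B1 KG c t" "c \<in> set Cs" "t \<le> K" | c t where "u = B1 KU c t" "c \<in> set Cs" "t \<le> K"
  | c t where "u = B1 KV c t" "c \<in> set Cs" "t \<le> K" | k c t where "u = B2 k c t" "c \<in> set Cs" "t \<le> K"
  using assms by (auto simp: V_B_def intro: kind.exhaust) (metis kind.exhaust)

lemma finite_Vs: "finite Vs"
proof -
  have "finite (UNIV :: kind set)"
    by (rule finite_subset[of _ "{KG, KU, KV}"]) (auto intro: kind.exhaust)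
  then show ?thesis by (auto simp: Vs_def V_A_def V_B_def)
qed

lemma pref_list_A: "u \<in> V_A \<Longrightarrow> set (pref_list u) \<subseteq> V_B"
  by (erule V_A_cases) (auto simp: set_opts)

lemma pref_list_B: "u \<in> V_B \<Longrightarrow> set (pref_list u) \<subseteq> V_A"
  by (erule V_B_cases) (auto simp: set_opts)

lemma nbr_sym_A: "u \<in> V_A \<Longrightarrow> v \<in> V_B \<Longrightarrow> nbr u v \<longleftrightarrow> nbr v u"
  unfolding nbr_def
  by (erule V_A_cases; erule V_B_cases) (auto simp: set_opts image_iff)

lemma nbr_sym:
  assumes "u \<in> Vs" "v \<in> Vs"
  shows "nbr u v \<longleftrightarrow> nbr v u"
proof -
  have disj: "x \<notin> V_B" if "x \<in> V_A" for x using that by (rule V_A_cases) auto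
  show ?thesis using assms nbr_sym_A pref_list_A pref_list_B disj unfolding Vs_def nbr_def by blast
qed

lemma distinct_opts: "distinct opts"
  using distinct_Cs by (simp add: opts_def distinct_product)

lemma distinct_map_opts:
  "distinct (map (\<lambda>x. f (fst x) (snd x)) (filter p opts))" if "\<And>c t c' t'. f c t = f c' t' \<Longrightarrow> c = c' \<and> t = t'" for f p
  using distinct_opts that by (auto simp: distinct_map inj_on_def prod_eq_iff)

lemma distinct_pref_list:
  assumes "u \<in> Vs"
  shows "distinct (pref_list u)"
proof -
  have o: "distinct (map (\<lambda>x. f (fst x) (snd x)) opts)"
    if "\<And>c t c' t'. f c t = f c' t' \<Longrightarrow> c = c' \<and> t = t'" for f :: "'c \<Rightarrow> nat \<Rightarrow> 'c node"
    using distinct_map_opts[of f "\<lambda>_. True", OF that] by simp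
  have c: "distinct (map (\<lambda>c. f c) Cs)" if "\<And>c c'. f c = f c' \<Longrightarrow> c = c'" for f :: "'c \<Rightarrow> 'c node"
    using that distinct_Cs by (auto simp: distinct_map inj_on_def)
  have distinct: "distinct (map (\<lambda>x. B1 KV (fst x) (snd x)) opts)"
    "distinct (map (\<lambda>x. A1 KU (fst x) (snd x)) opts)" "distinct (map (\<lambda>x. A1 KG (fst x) (snd x)) opts)"
    "distinct (map (\<lambda>x. B1 KU (fst x) (snd x)) (filter p opts))"
    "distinct (map (\<lambda>x. A1 KV (fst x) (snd x)) (filter p opts))" for p
    by (rule o distinct_map_opts; simp)+
  have distinct': "distinct (map (\<lambda>c. B1 KG c K) Cs)" "distinct (map (\<lambda>c. A1 KG c 0) Cs)"
    by (rule c; simp)+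
  from assms have "u \<in> V_A \<or> u \<in> V_B" by (simp add: Vs_def)
  then show ?thesis
  proof
    assume "u \<in> V_A"
    then show ?thesis
      by (rule V_A_cases) (auto simp: distinct distinct')
  next
    assume "u \<in> V_B"
    then show ?thesis
      by (rule V_B_cases) (auto simp: distinct distinct')
  qed
qed


section \<open>Candidate matchings and the weights of the edges\<close>

fun mu :: "bool \<Rightarrow> (kind \<Rightarrow> 'c \<Rightarrow> nat \<Rightarrow> bool) \<Rightarrow> 'c node \<Rightarrow> 'c node" where
  "mu b \<sigma> PP = (if b then SS else QQ)"
| "mu b \<sigma> SS = (if b then PP else SS)"
| "mu b \<sigma> QQ = (if b then BB else PP)"
| "mu b \<sigma> BB = (if b then QQ else BB)"
| "mu b \<sigma> AA = AA"
| "mu b \<sigma> ZZ = ZZ"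
| "mu b \<sigma> RR = TT"
| "mu b \<sigma> TT = RR"
| "mu b \<sigma> (A1 k c t) = (if \<sigma> k c t then B1 k c t else B2 k c t)"
| "mu b \<sigma> (A2 k c t) = (if \<sigma> k c t then B2 k c t else B1 k c t)"
| "mu b \<sigma> (B1 k c t) = (if \<sigma> k c t then A1 k c t else A2 k c t)"
| "mu b \<sigma> (B2 k c t) = (if \<sigma> k c t then A2 k c t else A1 k c t)"

definition wt :: "('c node \<Rightarrow> 'c node) \<Rightarrow> 'c node \<Rightarrow> 'c node \<Rightarrow> int" where
  "wt \<mu> u v = vote P u v (\<mu> u) + vote P v u (\<mu> v)"

lemma wt_commute: "wt \<mu> u v = wt \<mu> v u"
  by (simp add: wt_def)

definition sg :: "bool \<Rightarrow> int" where "sg b = (if b then 1 else -1)"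

text \<open>The flag \<open>b\<close> re-matches \<open>PP\<close> and \<open>QQ\<close> to
  \<open>SS\<close> and \<open>BB\<close>. Then the edge \<open>PP\<close>-\<open>QQ\<close> gains
  both votes, and as witnesses are bounded by 1, its weight 2 pins the values at both ends.\<close>

lemma wt_special:
  "wt (mu b \<sigma>) PP SS = 0"
  "wt (mu b \<sigma>) PP QQ = (if b then 2 else 0)"
  "wt (mu b \<sigma>) BB QQ = 0"
  "wt (mu b \<sigma>) AA TT = 0"
  "wt (mu b \<sigma>) RR TT = 0"
  "wt (mu b \<sigma>) RR ZZ = 0"
  by (auto simp: wt_def vote_def ranks_def image_iff)

lemma wt_gadget:
  assumes "c \<in> set Cs" "t \<le> K"
  shows "wt (mu b \<sigma>) (A1 k c t) (B1 k c t) = 0" "wt (mu b \<sigma>) (A1 k c t) (B2 k c t) = 0"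
    "wt (mu b \<sigma>) (A2 k c t) (B1 k c t) = 0" "wt (mu b \<sigma>) (A2 k c t) (B2 k c t) = 0"
  using assms by (cases k; auto simp: wt_def vote_def ranks_def image_iff set_opts)+

text \<open>In \<open>sg _ - 1\<close> the -1 is the fixed vote of one end and \<open>sg\<close> the
  vote of the other end, which depends on the state. At a link between copies both votes depend on
  the state: the weight is 2 exactly if \<open>KG\<close> is on and the copy is off.\<close>

lemma wt_links:
  assumes "c \<in> set Cs" "t \<le> K"
  shows "wt (mu b \<sigma>) RR (B1 KG c K) = 0"
    "wt (mu b \<sigma>) RR (B1 KV c t) = sg (\<sigma> KV c t) - 1"
    "wt (mu b \<sigma>) (A1 KG c t) TT = 0"
    "wt (mu b \<sigma>) (A1 KG c 0) SS = 0"
    "wt (mu b \<sigma>) (A1 KU c t) SS = 0"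
    "0 < t \<Longrightarrow> wt (mu b \<sigma>) (A1 KG c t) (B2 KG c (t - 1)) = sg (\<not> \<sigma> KG c t) - 1"
    "wt (mu b \<sigma>) (A1 KU c t) (B1 KG c t) = sg (\<not> \<sigma> KU c t) + sg (\<sigma> KG c t)"
    "wt (mu b \<sigma>) (A1 KV c t) (B1 KG c t) = sg (\<not> \<sigma> KV c t) + sg (\<sigma> KG c t)"
    "c' \<in> set Cs \<Longrightarrow> t' \<le> K \<Longrightarrow> conf c' t' c t \<Longrightarrow> wt (mu b \<sigma>) (A1 KV c t) (B1 KU c' t') = sg (\<sigma> KU c' t') - 1"
  using assms by (auto simp: wt_def vote_def ranks_def sg_def image_iff set_opts)

lemma assignment_mu: "assignment Vs nbr (mu b \<sigma>)"
  unfolding assignment_def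
proof
  fix u assume "u \<in> Vs"
  then have "u \<in> V_A \<or> u \<in> V_B" by (simp add: Vs_def)
  then show "mu b \<sigma> u \<in> Vs \<and> mu b \<sigma> (mu b \<sigma> u) = u \<and> (mu b \<sigma> u \<noteq> u \<longrightarrow> nbr u (mu b \<sigma> u))"
  proof
    assume "u \<in> V_A"
    then show ?thesis by (rule V_A_cases) (auto simp: Vs_def nbr_def)
  next
    assume "u \<in> V_B"
    then show ?thesis by (rule V_B_cases) (auto simp: Vs_def nbr_def set_opts image_iff)
  qed
qed

text \<open>With \<alpha> constant up to sign on each cycle, being a witness becomes a list of
  inequalities for one value \<open>\<alpha> (A1 k c t)\<close> per gadget. This serves the witness
  built from a solution as well as the constant witness 0.\<close>

lemma witness_mu:
  assumes zero: "\<And>u. u \<in> Vs \<Longrightarrow> \<alpha> u + \<alpha> (mu b \<sigma> u) = 0"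
    and loops: "\<And>u. u \<in> Vs \<Longrightarrow> - 1 \<le> \<alpha> u"
    and special: "0 \<le> \<alpha> PP + \<alpha> SS" "(if b then 2 else 0) \<le> \<alpha> PP + \<alpha> QQ" "0 \<le> \<alpha> BB + \<alpha> QQ" "0 \<le> \<alpha> AA + \<alpha> TT"
      "0 \<le> \<alpha> RR + \<alpha> TT" "0 \<le> \<alpha> RR + \<alpha> ZZ"
    and gadget: "\<And>k c t. c \<in> set Cs \<Longrightarrow> t \<le> K \<Longrightarrow> \<alpha> (A2 k c t) = \<alpha> (A1 k c t)"
      "\<And>k c t. c \<in> set Cs \<Longrightarrow> t \<le> K \<Longrightarrow> \<alpha> (B1 k c t) = - \<alpha> (A1 k c t)"
      "\<And>k c t. c \<in> set Cs \<Longrightarrow> t \<le> K \<Longrightarrow> \<alpha> (B2 k c t) = - \<alpha> (A1 k c t)"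
    and links: "\<And>c. c \<in> set Cs \<Longrightarrow> \<alpha> (A1 KG c K) \<le> \<alpha> RR"
      "\<And>c t. c \<in> set Cs \<Longrightarrow> t \<le> K \<Longrightarrow> sg (\<sigma> KV c t) - 1 \<le> \<alpha> RR - \<alpha> (A1 KV c t)"
      "\<And>c t. c \<in> set Cs \<Longrightarrow> t \<le> K \<Longrightarrow> 0 \<le> \<alpha> (A1 KG c t) + \<alpha> TT"
      "\<And>c. c \<in> set Cs \<Longrightarrow> 0 \<le> \<alpha> (A1 KG c 0) + \<alpha> SS"
      "\<And>c t. c \<in> set Cs \<Longrightarrow> t \<le> K \<Longrightarrow> 0 \<le> \<alpha> (A1 KU c t) + \<alpha> SS"
      "\<And>c t. c \<in> set Cs \<Longrightarrow> t \<le> K \<Longrightarrow> 0 < t \<Longrightarrow> sg (\<not> \<sigma> KG c t) - 1 \<le> \<alpha> (A1 KG c t) - \<alpha> (A1 KG c (t - 1))"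
      "\<And>c t. c \<in> set Cs \<Longrightarrow> t \<le> K \<Longrightarrow> sg (\<not> \<sigma> KU c t) + sg (\<sigma> KG c t) \<le> \<alpha> (A1 KU c t) - \<alpha> (A1 KG c t)"
      "\<And>c t. c \<in> set Cs \<Longrightarrow> t \<le> K \<Longrightarrow> sg (\<not> \<sigma> KV c t) + sg (\<sigma> KG c t) \<le> \<alpha> (A1 KV c t) - \<alpha> (A1 KG c t)"
      "\<And>c t c' t'. c \<in> set Cs \<Longrightarrow> t \<le> K \<Longrightarrow> c' \<in> set Cs \<Longrightarrow> t' \<le> K \<Longrightarrow> conf c' t' c t \<Longrightarrow>
        sg (\<sigma> KU c' t') - 1 \<le> \<alpha> (A1 KV c t) - \<alpha> (A1 KU c' t')"
  shows "witness Vs nbr P (mu b \<sigma>) \<alpha>"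
proof -
  have edge_A: "wt (mu b \<sigma>) u v \<le> \<alpha> u + \<alpha> v" if uv: "u \<in> V_A" "nbr u v" for u v
    using uv(1)
  proof (cases rule: V_A_cases)
    case (5 c t)
    then consider "v = TT" | "v = B1 KG c t" | "v = B2 KG c t" | "0 < t" "v = B2 KG c (t - 1)" | "t = 0" "v = SS"
      using uv by (auto simp: nbr_def split: if_splits)
    then show ?thesis
    proof cases
      case 4
      then show ?thesis
        using 5 wt_links(6)[of c t b \<sigma>] links(6)[of c t] gadget(3)[of c "t - 1" KG] by simp
    qed (use 5 links(3,4) wt_links(3,4)[of c t b \<sigma>] in \<open>simp_all add: wt_gadget gadget\<close>)
  next
    case (6 c t)
    then show ?thesis using uv links(5,7)[of c t]
      by (auto simp: nbr_def wt_gadget wt_links gadget)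
  next
    case (7 c t)
    then show ?thesis using uv links(8)[of c t] links(9)[of c t]
      by (auto simp: nbr_def wt_gadget wt_links gadget set_opts)
  next
    case (8 k c t)
    then show ?thesis using uv by (auto simp: nbr_def wt_gadget gadget)
  qed (use uv special links(1,2) gadget(2) in \<open>auto simp: nbr_def wt_special wt_links(2) wt_links(1)[of _ 0 b \<sigma>] set_opts\<close>)
  have edge: "wt (mu b \<sigma>) u v \<le> \<alpha> u + \<alpha> v" if "u \<in> Vs" "v \<in> Vs" "nbr u v" for u v
  proof (cases "u \<in> V_A")
    case True
    then show ?thesis using edge_A that by blast
  next
    case False
    then have "v \<in> V_A" using that pref_list_B by (auto simp: Vs_def nbr_def)
    then show ?thesis using edge_A[of v u] nbr_sym[of u v] that wt_commute by (simp add: add.commute)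
  qed
  have "vote P u u (mu b \<sigma> u) \<le> \<alpha> u" if "u \<in> Vs" for u
    using loops[OF that] zero[OF that] by (auto simp: vote_def ranks_def of_bool_def)
  then show ?thesis using edge zero assignment_mu by (auto simp: witness_def wt_def)
qed


lemma witness_if_solution:
  assumes sel: "\<And>c. c \<in> set Cs \<Longrightarrow> 1 \<le> sel c \<and> sel c \<le> K"
    and conf: "\<And>c c'. c \<in> set Cs \<Longrightarrow> c' \<in> set Cs \<Longrightarrow> \<not> conf c (sel c) c' (sel c')"
  shows "\<exists>\<sigma> \<alpha>. witness Vs nbr P (mu True \<sigma>) \<alpha>"
proof -
  define \<sigma> where "\<sigma> k c t \<longleftrightarrow> t = sel c" for k :: kind and c t
  \<comment> \<open>The chain of \<open>c\<close> keeps the value 1 up to the link into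
    \<open>t = sel c\<close>, whose weight -2 permits the drop to 0. \<open>KU\<close> must be 1
    next to \<open>SS\<close>. \<open>KV\<close> may be at most 0 next to \<open>RR\<close> where
    the link has weight 0, which is at \<open>t = sel c\<close>.\<close>
  define y :: "kind \<Rightarrow> 'c \<Rightarrow> nat \<Rightarrow> int"
    where "y k c t = (case k of KG \<Rightarrow> of_bool (t < sel c) | KU \<Rightarrow> 1 | KV \<Rightarrow> of_bool (t \<noteq> sel c))" for k c t
  define \<alpha> where "\<alpha> u = (case u of PP \<Rightarrow> 1 | SS \<Rightarrow> - 1 | QQ \<Rightarrow> 1 | BB \<Rightarrow> - 1 | AA \<Rightarrow> 0 | RR \<Rightarrow> 0 | TT \<Rightarrow> 0 | ZZ \<Rightarrow> 0
    | A1 k c t \<Rightarrow> y k c t | A2 k c t \<Rightarrow> y k c t | B1 k c t \<Rightarrow> - y k c t | B2 k c t \<Rightarrow> - y k c t)" for u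
  have y: "- 1 \<le> y k c t" "y k c t \<le> 1" for k c t by (cases k; simp add: y_def)+
  have "witness Vs nbr P (mu True \<sigma>) \<alpha>"
  proof (rule witness_mu)
    show "\<alpha> u + \<alpha> (mu True \<sigma> u) = 0" for u by (cases u) (auto simp: \<alpha>_def)
    show "- 1 \<le> \<alpha> u" for u using y by (cases u) (auto simp: \<alpha>_def)
  next
    fix c c' t t' assume "c \<in> set Cs" "c' \<in> set Cs" "conf c' t' c t"
    then have "\<not> (t = sel c \<and> t' = sel c')" using conf by blast
    then show "sg (\<sigma> KU c' t') - 1 \<le> \<alpha> (A1 KV c t) - \<alpha> (A1 KU c' t')"
      by (auto simp: \<alpha>_def y_def \<sigma>_def sg_def)
  next
    fix c assume "c \<in> set Cs"
    then show "\<alpha> (A1 KG c K) \<le> \<alpha> RR" "0 \<le> \<alpha> (A1 KG c 0) + \<alpha> SS"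
      using sel[of c] by (auto simp: \<alpha>_def y_def)
  qed (auto simp: \<alpha>_def y_def \<sigma>_def sg_def)
  then show ?thesis by blast
qed

section \<open>From a witness to a solution\<close>

context
  fixes \<mu> \<alpha>
  assumes W: "witness Vs nbr P \<mu> \<alpha>"
begin

lemma assignment_W: "assignment Vs nbr \<mu>"
  using W by (simp add: witness_def)

lemma W_in: "u \<in> Vs \<Longrightarrow> \<mu> u \<in> Vs"
  and W_W: "u \<in> Vs \<Longrightarrow> \<mu> (\<mu> u) = u"
  and W_nbr: "u \<in> Vs \<Longrightarrow> \<mu> u \<noteq> u \<Longrightarrow> \<mu> u \<in> set (pref_list u)"
  using assignment_W by (auto simp: assignment_def nbr_def)

lemma W_zero: "u \<in> Vs \<Longrightarrow> \<alpha> u + \<alpha> (\<mu> u) = 0"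
  using W by (simp add: witness_def)

lemma W_loop: "u \<in> Vs \<Longrightarrow> - 1 \<le> \<alpha> u"
proof -
  assume "u \<in> Vs"
  then have "vote P u u (\<mu> u) \<le> \<alpha> u" using W by (simp add: witness_def)
  then show ?thesis by (auto simp: vote_def ranks_def of_bool_def split: if_splits)
qed

text \<open>The mate of \<open>u\<close> carries the opposite value, so the lower bound from the
  loop at the mate is an upper bound at \<open>u\<close>.\<close>

lemma W_le_1: "u \<in> Vs \<Longrightarrow> \<alpha> u \<le> 1"
  using W_loop[OF W_in, of u] W_zero[of u] by simp

lemma W_edge: "u \<in> Vs \<Longrightarrow> v \<in> Vs \<Longrightarrow> v \<in> set (pref_list u) \<Longrightarrow> wt \<mu> u v \<le> \<alpha> u + \<alpha> v"
  using W by (simp add: witness_def wt_def nbr_def)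

text \<open>The constant 0 is a witness of the reference matchings \<^term>\<open>mu False \<sigma>\<close>, so every popular matching
  uses only edges that have weight 0 with respect to each of them.\<close>

lemma W_reference:
  assumes \<sigma>: "\<And>c t. \<sigma> KG c t \<Longrightarrow> \<sigma> KU c t \<and> \<sigma> KV c t" and u: "u \<in> Vs"
  shows "wt (mu False \<sigma>) u (\<mu> u) = 0"
proof -
  \<comment> \<open>With all values 0 it remains to exclude links of weight 2, which is what the
    hypothesis on \<sigma> does.\<close>
  have "witness Vs nbr P (mu False \<sigma>) (\<lambda>_. 0)"
    by (rule witness_mu) (use \<sigma> in \<open>auto simp: sg_def\<close>)
  from witness_tight[OF finite_Vs this W u] show ?thesis by (simp add: wt_def)
qed

text \<open>A loop at a node matched in a reference matching has weight -2, not 0, so a popular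
  matching cannot leave the node single.\<close>

lemma W_matched: "u \<in> Vs \<Longrightarrow> mu False (\<lambda>_ _ _. True) u \<noteq> u \<Longrightarrow> \<mu> u \<noteq> u"
  using W_reference[of "\<lambda>_ _ _. True" u] by (auto simp: wt_def vote_def ranks_def)

lemma W_BB: "\<mu> BB \<noteq> BB \<Longrightarrow> \<mu> BB = QQ"
  using W_nbr[of BB] by (auto simp: Vs_def)

lemma W_QQ: "\<mu> PP \<noteq> QQ \<Longrightarrow> \<mu> QQ = BB"
  using W_nbr[of QQ] W_matched[of QQ] W_W[of QQ] by (auto simp: Vs_def)

lemma W_AA: "\<mu> AA \<noteq> TT \<Longrightarrow> \<mu> AA = AA"
  using W_nbr[of AA] by (auto simp: Vs_def)

text \<open>The list of \<open>TT\<close> begins with \<open>RR\<close> and \<open>AA\<close> for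
  this purpose: if \<open>TT\<close> were matched to a gadget while \<open>AA\<close> is single, the
  edge \<open>AA\<close>-\<open>TT\<close> would have weight 2, more than 0 plus a value of at most
  1.\<close>

lemma W_TT:
  assumes AA: "\<mu> AA = AA"
  shows "\<mu> TT = RR"
proof (rule ccontr)
  assume "\<mu> TT \<noteq> RR"
  moreover have "\<mu> TT \<noteq> AA" using AA W_W[of TT] by (auto simp: Vs_def)
  ultimately obtain c t where "\<mu> TT = A1 KG c t" "c \<in> set Cs" "t \<le> K"
    using W_nbr[of TT] W_matched[of TT] by (auto simp: Vs_def set_opts)
  then have "wt \<mu> AA TT = 2"
    using AA by (auto simp: wt_def vote_def ranks_def image_iff)
  then have "2 \<le> \<alpha> AA + \<alpha> TT" using W_edge[of AA TT] by (simp add: Vs_def)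
  moreover have "\<alpha> AA = 0" using W_zero[of AA] AA by (simp add: Vs_def)
  ultimately show False using W_le_1[of TT] by (simp add: Vs_def)
qed

context
  assumes BB: "\<mu> BB = QQ" and TT: "\<mu> TT = RR"
begin

lemma W_special: "\<mu> QQ = BB" "\<mu> PP = SS" "\<mu> SS = PP" "\<mu> RR = TT" "\<mu> AA = AA" "\<mu> ZZ = ZZ"
proof -
  show QQ: "\<mu> QQ = BB" using W_W[of BB] BB by (simp add: Vs_def)
  show RR: "\<mu> RR = TT" using W_W[of TT] TT by (simp add: Vs_def)
  show PP: "\<mu> PP = SS" using W_nbr[of PP] W_matched[of PP] W_W[of PP] QQ by (auto simp: Vs_def)
  show "\<mu> SS = PP" using W_W[of PP] PP by (simp add: Vs_def)
  show "\<mu> AA = AA" using W_nbr[of AA] W_W[of AA] TT by (cases "\<mu> AA = AA") (auto simp: Vs_def)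
  show "\<mu> ZZ = ZZ" using W_nbr[of ZZ] W_W[of ZZ] RR by (cases "\<mu> ZZ = ZZ") (auto simp: Vs_def)
qed

lemma W_A1:
  assumes "c \<in> set Cs" "t \<le> K"
  shows "\<mu> (A1 k c t) = B1 k c t \<or> \<mu> (A1 k c t) = B2 k c t"
proof -
  let ?u = "A1 k c t"
  have u: "?u \<in> Vs" "\<mu> ?u \<noteq> ?u" using assms W_matched[of ?u] by (auto simp: Vs_def)
  have ne: "\<mu> ?u \<noteq> SS" "\<mu> ?u \<noteq> TT" using W_W[OF u(1)] W_special TT by auto
  \<comment> \<open>Each link out of a cycle has weight -2 for some reference matching, so no
    popular matching uses it: the links to \<open>B1 KG\<close> if the copies are on and
    \<open>KG\<close> is off, the chain links if all states are on, the conflict links if all are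
    off.\<close>
  have ref: "wt (mu False (\<lambda>k _ _. k \<noteq> KG)) ?u (\<mu> ?u) = 0" "wt (mu False (\<lambda>_ _ _. True)) ?u (\<mu> ?u) = 0"
    "wt (mu False (\<lambda>_ _ _. False)) ?u (\<mu> ?u) = 0"
    using u(1) by (simp_all add: W_reference)
  show ?thesis
  proof (cases k)
    case KG
    have "\<mu> ?u \<noteq> B2 KG c (t - 1)" if "0 < t"
      using ref(2) assms that wt_links(6)[of c t False "\<lambda>_ _ _. True"] KG by (auto simp: sg_def)
    then show ?thesis using KG W_nbr[OF u] ne by (auto split: if_splits)
  next
    case KU
    have "\<mu> ?u \<noteq> B1 KG c t"
      using ref(1) assms wt_links(7)[of c t False "\<lambda>k _ _. k \<noteq> KG"] KU by (auto simp: sg_def)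
    then show ?thesis using KU W_nbr[OF u] ne by auto
  next
    case KV
    have "\<mu> ?u \<noteq> B1 KG c t"
      using ref(1) assms wt_links(8)[of c t False "\<lambda>k _ _. k \<noteq> KG"] KV by (auto simp: sg_def)
    moreover have "\<mu> ?u \<noteq> B1 KU c' t'" if "c' \<in> set Cs" "t' \<le> K" "conf c' t' c t" for c' t'
      using ref(3) assms that wt_links(9)[of c t c' t' False "\<lambda>_ _ _. False"] KV by (auto simp: sg_def)
    ultimately show ?thesis using KV W_nbr[OF u] ne by (auto simp: set_opts)
  qed
qed

text \<open>\<open>A2\<close> is adjacent to \<open>B1\<close> and \<open>B2\<close> only. So once
  \<open>A1\<close> is matched inside its cycle, the whole cycle is in one of its two states, which
  can be read off from \<open>A1\<close>.\<close>

lemma W_eq_mu: "u \<in> Vs \<Longrightarrow> \<mu> u = mu True (\<lambda>k c t. \<mu> (A1 k c t) = B1 k c t) u"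
proof -
  have gadget: "\<mu> x = mu True (\<lambda>k c t. \<mu> (A1 k c t) = B1 k c t) x"
    if c: "c \<in> set Cs" "t \<le> K" and x: "x \<in> {A1 k c t, A2 k c t, B1 k c t, B2 k c t}" for x k c t
  proof -
    have in_Vs: "A1 k c t \<in> Vs" "A2 k c t \<in> Vs" using c by (auto simp: Vs_def)
    have "\<mu> (A2 k c t) = B1 k c t \<or> \<mu> (A2 k c t) = B2 k c t"
      using W_nbr[OF in_Vs(2)] W_matched[OF in_Vs(2)] by auto
    moreover have "\<mu> (A2 k c t) \<noteq> \<mu> (A1 k c t)"
    proof
      assume "\<mu> (A2 k c t) = \<mu> (A1 k c t)"
      then have "\<mu> (\<mu> (A2 k c t)) = \<mu> (\<mu> (A1 k c t))" by (rule arg_cong)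
      then show False unfolding W_W[OF in_Vs(1)] W_W[OF in_Vs(2)] by simp
    qed
    ultimately consider "\<mu> (A1 k c t) = B1 k c t" "\<mu> (A2 k c t) = B2 k c t"
      | "\<mu> (A1 k c t) = B2 k c t" "\<mu> (A2 k c t) = B1 k c t"
      using W_A1[OF c, of k] by metis
    then show ?thesis
    proof cases
      case 1
      then have "\<mu> (B1 k c t) = A1 k c t" "\<mu> (B2 k c t) = A2 k c t"
        using W_W[OF in_Vs(1)] W_W[OF in_Vs(2)] by metis+
      then show ?thesis using x 1 by (elim insertE emptyE) simp_all
    next
      case 2
      then have "\<mu> (B1 k c t) = A2 k c t" "\<mu> (B2 k c t) = A1 k c t"
        using W_W[OF in_Vs(1)] W_W[OF in_Vs(2)] by metis+
      then show ?thesis using x 2 by (elim insertE emptyE) simp_all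
    qed
  qed
  assume "u \<in> Vs"
  then have "u \<in> V_A \<or> u \<in> V_B" by (simp add: Vs_def)
  then show ?thesis
  proof
    assume "u \<in> V_A"
    then show ?thesis by (rule V_A_cases) (use W_special BB in \<open>simp_all add: gadget del: mu.simps(9-12)\<close>)
  next
    assume "u \<in> V_B"
    then show ?thesis by (rule V_B_cases) (use W_special TT in \<open>simp_all add: gadget del: mu.simps(9-12)\<close>)
  qed
qed

text \<open>The value of \<^term>\<open>\<alpha>\<close> at \<open>A1 k c t\<close> is propagated along the edges of weight 0, from 1
  next to \<^term>\<open>SS\<close> to at most 0 next to \<^term>\<open>RR\<close>.\<close>

lemma solution_if_witness:
  shows "\<exists>sel. (\<forall>c\<in>set Cs. 1 \<le> sel c \<and> sel c \<le> K) \<and>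
    (\<forall>c\<in>set Cs. \<forall>c'\<in>set Cs. \<not> conf c (sel c) c' (sel c'))"
proof -
  define \<sigma> where "\<sigma> k c t \<longleftrightarrow> \<mu> (A1 k c t) = B1 k c t" for k c t
  have eq_mu: "\<mu> u = mu True \<sigma> u" if "u \<in> Vs" for u
    using W_eq_mu[OF that] unfolding \<sigma>_def[abs_def] .
  have edge: "wt (mu True \<sigma>) u v \<le> \<alpha> u + \<alpha> v" if "u \<in> Vs" "v \<in> set (pref_list u)" for u v
  proof -
    have "v \<in> Vs" using that pref_list_A pref_list_B by (auto simp: Vs_def)
    then show ?thesis
      using W_edge[of u v] that unfolding wt_def eq_mu[OF that(1)] eq_mu[OF \<open>v \<in> Vs\<close>] by simp
  qed
  have in_Vs: "PP \<in> Vs" "AA \<in> Vs" "RR \<in> Vs" "ZZ \<in> Vs" "QQ \<in> Vs" "TT \<in> Vs" by (auto simp: Vs_def)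
  \<comment> \<open>The weight 2 of \<open>PP\<close>-\<open>QQ\<close> is attained only if \<alpha>
    is 1 at both ends, and \<open>SS\<close> is the mate of \<open>PP\<close>.\<close>
  have SS: "\<alpha> SS = - 1"
    using edge[OF in_Vs(1), of QQ] W_le_1[OF in_Vs(1)] W_le_1[OF in_Vs(5)] W_zero[OF in_Vs(1)] W_special(2)
    by (simp add: wt_special)
  have "\<alpha> AA = 0" "\<alpha> ZZ = 0" "\<alpha> RR + \<alpha> TT = 0"
    using W_zero[OF in_Vs(2)] W_zero[OF in_Vs(4)] W_zero[OF in_Vs(3)] W_special by auto
  \<comment> \<open>The edges \<open>AA\<close>-\<open>TT\<close> and
    \<open>RR\<close>-\<open>ZZ\<close> of weight 0 lead to unmatched nodes, so neither
    \<open>TT\<close> nor \<open>RR\<close> is negative; as they are mates, both are 0.\<close>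
  then have RT: "\<alpha> RR = 0" "\<alpha> TT = 0"
    using edge[OF in_Vs(2), of TT] edge[OF in_Vs(3), of ZZ] by (auto simp: wt_special)
  \<comment> \<open>Every edge of the cycle has weight 0. The two matched edges sum to 0, so the
    four values have total 0, and the other two edges, being nonnegative, are tight as well.\<close>
  have B1: "\<alpha> (B1 k c t) = - \<alpha> (A1 k c t)" and B2: "\<alpha> (B2 k c t) = - \<alpha> (A1 k c t)"
    if c: "c \<in> set Cs" "t \<le> K" for k c t
  proof -
    have Vs: "A1 k c t \<in> Vs" "A2 k c t \<in> Vs" using c by (auto simp: Vs_def)
    have mem: "B1 k c t \<in> set (pref_list (A1 k c t))" "B2 k c t \<in> set (pref_list (A1 k c t))"
      by (cases k; simp)+
    have "0 \<le> \<alpha> (A1 k c t) + \<alpha> (B1 k c t)" "0 \<le> \<alpha> (A1 k c t) + \<alpha> (B2 k c t)"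
      "0 \<le> \<alpha> (A2 k c t) + \<alpha> (B1 k c t)" "0 \<le> \<alpha> (A2 k c t) + \<alpha> (B2 k c t)"
      using edge[OF Vs(1) mem(1)] edge[OF Vs(1) mem(2)] edge[OF Vs(2), of "B1 k c t"] edge[OF Vs(2), of "B2 k c t"]
      by (simp_all add: wt_gadget[OF c])
    then show "\<alpha> (B1 k c t) = - \<alpha> (A1 k c t)" "\<alpha> (B2 k c t) = - \<alpha> (A1 k c t)"
      using W_zero[OF Vs(1)] W_zero[OF Vs(2)] unfolding eq_mu[OF Vs(1)] eq_mu[OF Vs(2)] mu.simps
      by (simp_all split: if_splits)
  qed
  have Vs: "A1 k c t \<in> Vs" "B1 k c t \<in> Vs" "B2 k c t \<in> Vs" if "c \<in> set Cs" "t \<le> K" for k c t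
    using that by (auto simp: Vs_def)
  \<comment> \<open>The links to \<open>TT\<close> exist for this bound: with it no value exceeds a
    value of \<open>KG\<close> by 2, and \<open>GU\<close> can exclude the weight 2 of the links
    between copies.\<close>
  have KG_ge: "0 \<le> \<alpha> (A1 KG c t)" if "c \<in> set Cs" "t \<le> K" for c t
    using edge[OF Vs(1)[OF that], of TT KG] RT that by (simp add: wt_links(3))
  have KU: "\<alpha> (A1 KU c t) = 1" if "c \<in> set Cs" "t \<le> K" for c t
    using edge[OF Vs(1)[OF that], of SS KU] SS that W_le_1[OF Vs(1)[OF that, of KU]] by (simp add: wt_links(5))
  have GU: "\<sigma> KU c t" "\<sigma> KV c t" if c: "c \<in> set Cs" "t \<le> K" and \<sigma>: "\<sigma> KG c t" for c t
  proof -
    have le: "\<alpha> (A1 k c t) - \<alpha> (A1 KG c t) < 2" for k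
      using KG_ge[OF c] W_le_1[OF Vs(1)[OF c, of k]] by simp
    have "wt (mu True \<sigma>) (A1 KU c t) (B1 KG c t) \<le> \<alpha> (A1 KU c t) + \<alpha> (B1 KG c t)"
      by (rule edge[OF Vs(1)[OF c]]) simp
    then show "\<sigma> KU c t"
      using \<sigma> le[of KU] unfolding wt_links(7)[OF c] B1[OF c] sg_def by (cases "\<sigma> KU c t") simp_all
    have "wt (mu True \<sigma>) (A1 KV c t) (B1 KG c t) \<le> \<alpha> (A1 KV c t) + \<alpha> (B1 KG c t)"
      by (rule edge[OF Vs(1)[OF c]]) simp
    then show "\<sigma> KV c t"
      using \<sigma> le[of KV] unfolding wt_links(8)[OF c] B1[OF c] sg_def by (cases "\<sigma> KV c t") simp_all
  qed
  have KV: "\<alpha> (A1 KV c t) \<le> 0" if "c \<in> set Cs" "t \<le> K" "\<sigma> KV c t" for c t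
    using edge[OF in_Vs(3), of "B1 KV c t"] that RT B1[OF that(1,2), of KV]
    by (auto simp: wt_links(2) sg_def image_iff)
  \<comment> \<open>The path from \<open>SS\<close> through \<open>KU\<close> of the first
    assignment and \<open>KV\<close> of the second one to \<open>RR\<close> would carry the value 1
    to a place where at most 0 is allowed.\<close>
  have no_conf: "\<not> conf c t c' t'"
    if c: "c \<in> set Cs" "t \<le> K" "c' \<in> set Cs" "t' \<le> K" and \<sigma>: "\<sigma> KG c t" "\<sigma> KG c' t'" for c t c' t'
  proof
    assume conf: "conf c t c' t'"
    then have "B1 KU c t \<in> set (pref_list (A1 KV c' t'))" using c by (auto simp: set_opts image_iff intro!: exI[of _ "(c, t)"])
    from edge[OF Vs(1)[OF c(3,4)] this] have "\<alpha> (A1 KU c t) \<le> \<alpha> (A1 KV c' t')"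
      using wt_links(9)[OF c(3,4,1,2) conf] GU[OF c(1,2)] B1[OF c(1,2), of KU] \<sigma> by (simp add: sg_def)
    then show False using KU[OF c(1,2)] KV[OF c(3,4) GU(2)[OF c(3,4)]] \<sigma> by simp
  qed
  \<comment> \<open>If no value above 0 were selected, the chain would carry the value 1 from the
    dummy gadget next to \<open>SS\<close> up to the link of \<open>B1 KG c K\<close> to
    \<open>RR\<close>.\<close>
  have ex: "\<exists>t. 1 \<le> t \<and> t \<le> K \<and> \<sigma> KG c t" if c: "c \<in> set Cs" for c
  proof (rule ccontr)
    assume none: "\<not> ?thesis"
    have "1 \<le> \<alpha> (A1 KG c t)" if "t \<le> K" for t
      using that
    proof (induction t)
      case 0
      then show ?case using edge[OF Vs(1)[OF c, of 0 KG], of SS] SS c wt_links(4)[of c 0] by simp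
    next
      case (Suc t)
      then have "wt (mu True \<sigma>) (A1 KG c (Suc t)) (B2 KG c t) = 0"
        using none wt_links(6)[of c "Suc t" True \<sigma>] c by (simp add: sg_def)
      moreover have "wt (mu True \<sigma>) (A1 KG c (Suc t)) (B2 KG c t) \<le> \<alpha> (A1 KG c (Suc t)) + \<alpha> (B2 KG c t)"
        using Suc.prems c by (intro edge Vs) auto
      ultimately show ?case using B2[of c t KG] Suc c by simp
    qed
    then have "1 \<le> \<alpha> (A1 KG c K)" by simp
    moreover have "wt (mu True \<sigma>) RR (B1 KG c K) \<le> \<alpha> RR + \<alpha> (B1 KG c K)"
      using c by (intro edge in_Vs) auto
    ultimately show False using RT B1[of c K KG] c wt_links(1)[of c K] by simp
  qed
  define sel where "sel c = (SOME t. 1 \<le> t \<and> t \<le> K \<and> \<sigma> KG c t)" for c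
  have "1 \<le> sel c \<and> sel c \<le> K \<and> \<sigma> KG c (sel c)" if "c \<in> set Cs" for c
    unfolding sel_def by (rule someI_ex) (use ex[OF that] in simp)
  then show ?thesis using no_conf by blast
qed

end

end

end

section \<open>Instances with numbered nodes\<close>

lemma vote_transfer:
  assumes "h x = h y \<longleftrightarrow> x = y" "h x = h z \<longleftrightarrow> x = z" "P' (h x) (h y) (h z) \<longleftrightarrow> P x y z" "P' (h x) (h z) (h y) \<longleftrightarrow> P x z y"
  shows "vote P' (h x) (h y) (h z) = vote P x y z"
proof -
  have "(h y = h x) = (y = x)" "(h z = h x) = (z = x)" using assms(1,2) by auto
  then show ?thesis using assms(3,4) by (simp add: vote_def ranks_def)
qed

text \<open>Applied in both directions between symbolic nodes and their numbers, with the roles of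
  \<open>g\<close> and \<open>h\<close> exchanged.\<close>

lemma witness_transfer:
  assumes w: "witness V adj P \<mu> \<alpha>"
    and g: "\<And>n. n \<in> V' \<Longrightarrow> g n \<in> V \<and> h (g n) = n"
    and h: "\<And>x. x \<in> V \<Longrightarrow> h x \<in> V' \<and> g (h x) = x"
    and adj: "\<And>x y. x \<in> V \<Longrightarrow> y \<in> V \<Longrightarrow> adj' (h x) (h y) \<longleftrightarrow> adj x y"
    and P: "\<And>x y z. x \<in> V \<Longrightarrow> y \<in> V \<Longrightarrow> z \<in> V \<Longrightarrow> P' (h x) (h y) (h z) \<longleftrightarrow> P x y z"
  shows "witness V' adj' P' (\<lambda>n. h (\<mu> (g n))) (\<lambda>n. \<alpha> (g n))"
proof -
  have inj: "h x = h y \<longleftrightarrow> x = y" if "x \<in> V" "y \<in> V" for x y using h that by metis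
  have vote: "vote P' (h x) (h y) (h z) = vote P x y z" if "x \<in> V" "y \<in> V" "z \<in> V" for x y z
    using that by (intro vote_transfer inj P)
  have \<mu>: "\<mu> x \<in> V" "\<mu> (\<mu> x) = x" "\<mu> x \<noteq> x \<Longrightarrow> adj x (\<mu> x)" if "x \<in> V" for x
    using w that by (auto simp: witness_def assignment_def)
  have a: "assignment V' adj' (\<lambda>n. h (\<mu> (g n)))"
    unfolding assignment_def
  proof
    fix n assume n: "n \<in> V'"
    define x where "x = g n"
    have x: "x \<in> V" "n = h x" using g[OF n] by (auto simp: x_def)
    show "h (\<mu> (g n)) \<in> V' \<and> h (\<mu> (g (h (\<mu> (g n))))) = n \<and> (h (\<mu> (g n)) \<noteq> n \<longrightarrow> adj' n (h (\<mu> (g n))))"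
      using h[OF \<mu>(1)[OF x(1)]] \<mu>[OF x(1)] inj[OF \<mu>(1)[OF x(1)] x(1)] adj[OF x(1) \<mu>(1)[OF x(1)]]
      h[OF x(1)] unfolding x(2) by simp
  qed
  have 1: "\<alpha> (g n) + \<alpha> (g (h (\<mu> (g n)))) = 0 \<and> vote P' n n (h (\<mu> (g n))) \<le> \<alpha> (g n)" if n: "n \<in> V'" for n
  proof -
    define x where "x = g n"
    have x: "x \<in> V" "n = h x" using g[OF n] by (auto simp: x_def)
    have "\<alpha> x + \<alpha> (\<mu> x) = 0 \<and> vote P x x (\<mu> x) \<le> \<alpha> x" using w x(1) by (simp add: witness_def)
    then show ?thesis
      using h[OF \<mu>(1)[OF x(1)]] vote[OF x(1) x(1) \<mu>(1)[OF x(1)]]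
      h[OF x(1)] unfolding x(2) by simp
  qed
  have 2: "vote P' m n (h (\<mu> (g m))) + vote P' n m (h (\<mu> (g n))) \<le> \<alpha> (g m) + \<alpha> (g n)"
    if mn: "m \<in> V'" "n \<in> V'" "adj' m n" for m n
  proof -
    define x where "x = g m"
    define y where "y = g n"
    have x: "x \<in> V" "m = h x" and y: "y \<in> V" "n = h y"
      using g mn by (auto simp: x_def y_def)
    have "adj x y" using mn(3) adj[OF x(1) y(1)] x y by simp
    then have "vote P x y (\<mu> x) + vote P y x (\<mu> y) \<le> \<alpha> x + \<alpha> y" using w x y by (simp add: witness_def)
    then show ?thesis
      using vote[OF x(1) y(1) \<mu>(1)[OF x(1)]] vote[OF y(1) x(1) \<mu>(1)[OF y(1)]]
      h[OF x(1)] h[OF y(1)] unfolding x(2) y(2) by simp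
  qed
  show ?thesis using a 1 2 by (simp add: witness_def)
qed

lemma witness_cong:
  assumes "witness V adj P \<mu> \<alpha>" "\<And>u. u \<in> V \<Longrightarrow> \<nu> u = \<mu> u"
  shows "witness V adj P \<nu> \<alpha>"
  using assms by (simp add: witness_def assignment_def)

lemma before_map:
  assumes "inj_on f X" "set xs \<subseteq> X" "v \<in> X" "w \<in> X"
  shows "before (map f xs) (f v) (f w) \<longleftrightarrow> before xs v w"
proof -
  have "(map f xs ! i = f v) = (xs ! i = v)" "(map f xs ! i = f w) = (xs ! i = w)" if "i < length xs" for i
    using assms that nth_mem[OF that] by (auto simp: inj_on_eq_iff[OF assms(1)] subset_iff)
  then show ?thesis unfolding before_def by (metis length_map order.strict_trans)
qed

definition obeys where
  "obeys e0 e1 u0 u1 \<mu> \<longleftrightarrow> (\<forall>(u, v)\<in>set e0. \<mu> u \<noteq> v) \<and> (\<forall>(u, v)\<in>set e1. \<mu> u = v) \<and>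
     (\<forall>u\<in>set u0. \<mu> u = u) \<and> (\<forall>u\<in>set u1. \<mu> u \<noteq> u)"

text \<open>For \<open>\<mu> BB = QQ\<close> the options are to forbid
  \<open>PP\<close>-\<open>QQ\<close>, to force \<open>QQ\<close>-\<open>BB\<close> or to require
  \<open>BB\<close> matched; for \<open>\<mu> TT = RR\<close> to forbid
  \<open>AA\<close>-\<open>TT\<close>, to force \<open>RR\<close>-\<open>TT\<close> or to require
  \<open>AA\<close> unmatched. Each entry combines one option of each kind, in the order of the
  cases (i) to (vi).\<close>

definition restrictions :: "(('c node \<times> 'c node) list \<times> ('c node \<times> 'c node) list \<times> 'c node list \<times> 'c node list) list" where
  "restrictions = [([(AA, TT), (PP, QQ)], [], [], []), ([], [(RR, TT), (QQ, BB)], [], []),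
     ([(AA, TT)], [(QQ, BB)], [], []), ([], [], [AA], [BB]), ([], [(QQ, BB)], [AA], []), ([], [(RR, TT)], [], [BB])]"

context csp
begin

text \<open>The order of numbering: four special nodes, then a block of six nodes for each pair in
  \<open>opts\<close>. The regular blocks give the numbers a closed form.\<close>

definition alist :: "'c node list" where
  "alist = [PP, BB, AA, RR] @ concat (map (\<lambda>x. concat (map (\<lambda>k.
     [A1 k (fst x) (snd x), A2 k (fst x) (snd x)]) [KG, KU, KV])) opts)"

definition blist :: "'c node list" where
  "blist = [SS, QQ, TT, ZZ] @ concat (map (\<lambda>x. concat (map (\<lambda>k.
     [B1 k (fst x) (snd x), B2 k (fst x) (snd x)]) [KG, KU, KV])) opts)"

definition solution_exists :: bool where
  "solution_exists \<longleftrightarrow> (\<exists>sel. (\<forall>c\<in>set Cs. 1 \<le> sel c \<and> sel c \<le> K) \<and>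
    (\<forall>c\<in>set Cs. \<forall>c'\<in>set Cs. \<not> conf c (sel c) c' (sel c')))"

lemma UNIV_kind: "(UNIV :: kind set) = {KG, KU, KV}"
  by (auto intro: kind.exhaust)

lemma set_alist: "set alist = V_A" and set_blist: "set blist = V_B"
  unfolding V_A_def V_B_def alist_def blist_def UNIV_kind by (fastforce simp: set_opts)+

end

text \<open>The numbering stays abstract here; its arithmetic matters only to the program that
  prints the instance.\<close>

locale csp_numbering = csp Cs K conf for Cs :: "'c list" and K conf +
  fixes num :: "'c node \<Rightarrow> nat"
  assumes map_num: "map num (alist @ blist) = [0..<length (alist @ blist)]"
begin

definition inst :: "('c node \<times> 'c node) list \<Rightarrow> ('c node \<times> 'c node) list \<Rightarrow> 'c node list \<Rightarrow> 'c node list \<Rightarrow> popm" where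
  "inst e0 e1 u0 u1 = \<lparr>left_size = length alist, prefs = map (\<lambda>x. map num (pref_list x)) (alist @ blist),
     E0_list = map (map_prod num num) e0, E1_list = map (map_prod num num) e1,
     U0_list = map num u0, U1_list = map num u1\<rparr>"

definition node_of :: "nat \<Rightarrow> 'c node" where "node_of n = (alist @ blist) ! n"

lemma set_vlist: "set (alist @ blist) = Vs"
  by (simp add: set_alist set_blist Vs_def)

lemma inj_num: "inj_on num Vs"
  using distinct_map[of num "alist @ blist"] unfolding map_num set_vlist by simp

lemma num_node_of: "n < length (alist @ blist) \<Longrightarrow> num (node_of n) = n"
  using arg_cong[OF map_num, of "\<lambda>xs. xs ! n"] by (simp add: node_of_def del: map_append)

lemma node_of_in: "n < length (alist @ blist) \<Longrightarrow> node_of n \<in> Vs"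
  unfolding node_of_def set_vlist[symmetric] by (rule nth_mem)

lemma num_less: "x \<in> Vs \<Longrightarrow> num x < length (alist @ blist)"
proof -
  assume "x \<in> Vs"
  then have "num x \<in> set (map num (alist @ blist))" unfolding set_map set_vlist by simp
  then show ?thesis unfolding map_num by simp
qed

lemma node_of_num: "x \<in> Vs \<Longrightarrow> node_of (num x) = x"
  by (rule inj_onD[OF inj_num num_node_of[OF num_less] node_of_in[OF num_less]])

lemma num_A: "x \<in> V_A \<Longrightarrow> num x < length alist" and num_B: "x \<in> V_B \<Longrightarrow> length alist \<le> num x"
proof -
  have "map num alist @ map num blist = [0..<length alist] @ [length alist..<length alist + length blist]"
    using map_num upt_add_eq_append[of 0 "length alist" "length blist"] by simp
  then have A: "map num alist = [0..<length alist]" and B: "map num blist = [length alist..<length alist + length blist]"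
    by (simp_all add: append_eq_append_conv)
  show "x \<in> V_A \<Longrightarrow> num x < length alist"
    using arg_cong[OF A, of set] unfolding set_alist[symmetric] by auto
  show "x \<in> V_B \<Longrightarrow> length alist \<le> num x"
    using arg_cong[OF B, of set] unfolding set_blist[symmetric] by auto
qed

context
  fixes e0 e1 :: "('c node \<times> 'c node) list" and u0 u1 :: "'c node list"
begin

abbreviation "I \<equiv> inst e0 e1 u0 u1"

lemma side_A_inst: "side_A I = num ` V_A" and side_B_inst: "side_B I = num ` V_B"
proof -
  have *: "n \<in> num ` V_A \<longleftrightarrow> n < length alist" "n \<in> num ` V_B \<longleftrightarrow> length alist \<le> n"
    if "n < length (alist @ blist)" for n
    using num_node_of[OF that] node_of_in[OF that] num_A num_B unfolding Vs_def
    by (metis Un_iff imageE image_eqI leD)+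
  show "side_A I = num ` V_A" using * num_A by (force simp: side_A_def inst_def)
  show "side_B I = num ` V_B" using * num_B num_less by (force simp: side_B_def inst_def Vs_def)
qed

lemma nodes_inst: "nodes I = num ` Vs"
  by (simp add: nodes_def side_A_inst side_B_inst Vs_def image_Un)

lemma prefs_inst: "x \<in> Vs \<Longrightarrow> prefs I ! num x = map num (pref_list x)"
  using num_less[of x] node_of_num[of x] by (simp add: inst_def node_of_def del: map_append)

lemma pref_list_in: "x \<in> Vs \<Longrightarrow> set (pref_list x) \<subseteq> Vs"
  using pref_list_A pref_list_B by (auto simp: Vs_def)

lemma edges_inst: "edges I = {{num x, num y} | x y. x \<in> Vs \<and> nbr x y}"
proof -
  have "{num x, w} \<in> {{num x, num y} | x y. x \<in> Vs \<and> nbr x y}" if "x \<in> Vs" "w \<in> set (prefs I ! num x)" for x w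
    using that by (auto simp: prefs_inst nbr_def)
  moreover have "num y \<in> set (prefs I ! num x)" if "x \<in> Vs" "nbr x y" for x y
    using that by (simp add: prefs_inst nbr_def)
  ultimately show ?thesis unfolding edges_def nodes_inst by blast
qed

lemma pref_inst:
  "x \<in> Vs \<Longrightarrow> y \<in> Vs \<Longrightarrow> z \<in> Vs \<Longrightarrow> pref I (num x) (num y) (num z) \<longleftrightarrow> P x y z"
  unfolding pref_def prefs_inst before_def[symmetric] by (rule before_map[OF inj_num pref_list_in])

lemma mem_edges_inst:
  assumes "x \<in> Vs" "y \<in> Vs"
  shows "{num x, num y} \<in> edges I \<longleftrightarrow> nbr x y"
proof
  assume "{num x, num y} \<in> edges I"
  then obtain x' y' where "{num x, num y} = {num x', num y'}" "x' \<in> Vs" "nbr x' y'"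
    unfolding edges_inst by auto
  moreover from this have "y' \<in> Vs" using pref_list_in by (auto simp: nbr_def)
  ultimately have "x = x' \<and> y = y' \<or> x = y' \<and> y = x'" "nbr x' y'" "nbr y' x'"
    using assms inj_onD[OF inj_num] nbr_sym by (auto simp: doubleton_eq_iff)
  then show "nbr x y" by auto
qed (use assms edges_inst in blast)

interpretation bip: bipartite_graph "nodes I" "edges I" "side_A I" "side_B I"
proof
  show "finite (nodes I)" by (simp add: nodes_inst finite_Vs)
  show "nodes I = side_A I \<union> side_B I" by (simp add: nodes_def)
  show "side_A I \<inter> side_B I = {}" by (auto simp: side_A_def side_B_def)
  show *: "\<exists>a\<in>side_A I. \<exists>b\<in>side_B I. e = {a, b}" if e: "e \<in> edges I" for e
  proof -
    obtain x y where xy: "e = {num x, num y}" "x \<in> Vs" "nbr x y" using e unfolding edges_inst by blast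
    have "x \<in> V_A \<and> y \<in> V_B \<or> x \<in> V_B \<and> y \<in> V_A"
      using xy(2,3) pref_list_A[of x] pref_list_B[of x] by (auto simp: Vs_def nbr_def)
    then show ?thesis using xy(1) unfolding side_A_inst side_B_inst by (auto simp: insert_commute)
  qed
  show "\<exists>u v. e = {u, v} \<and> u \<noteq> v \<and> u \<in> nodes I \<and> v \<in> nodes I" if "e \<in> edges I" for e
  proof -
    from *[OF that] obtain a b where "a \<in> side_A I" "b \<in> side_B I" "e = {a, b}" by blast
    then show ?thesis
      by (intro exI[of _ a] exI[of _ b]) (auto simp: nodes_def side_A_def side_B_def)
  qed
qed

lemma wf_inst:
  assumes "\<And>u v. (u, v) \<in> set e0 \<union> set e1 \<Longrightarrow> u \<in> Vs \<and> nbr u v" "set u0 \<union> set u1 \<subseteq> Vs"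
  shows "wf_popm I"
proof -
  have "distinct (prefs I ! u)" if "u \<in> nodes I" for u
  proof -
    from that obtain x where x: "u = num x" "x \<in> Vs" unfolding nodes_inst by blast
    then show ?thesis
      using distinct_pref_list[OF x(2)] inj_on_subset[OF inj_num pref_list_in[OF x(2)]] by (simp add: prefs_inst distinct_map)
  qed
  moreover have "set (prefs I ! a) \<subseteq> side_B I" if "a \<in> side_A I" for a
    using that prefs_inst pref_list_A unfolding side_A_inst side_B_inst by (fastforce simp: Vs_def)
  moreover have "set (prefs I ! b) \<subseteq> side_A I" if "b \<in> side_B I" for b
    using that prefs_inst pref_list_B unfolding side_A_inst side_B_inst by (fastforce simp: Vs_def)
  moreover have "b \<in> set (prefs I ! a) \<longleftrightarrow> a \<in> set (prefs I ! b)" if ab: "a \<in> side_A I" "b \<in> side_B I" for a b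
  proof -
    from ab obtain x y where xy: "a = num x" "x \<in> V_A" "b = num y" "y \<in> V_B"
      unfolding side_A_inst side_B_inst by auto
    then have Vs: "x \<in> Vs" "y \<in> Vs" by (auto simp: Vs_def)
    have "num v \<in> set (map num (pref_list u)) \<longleftrightarrow> nbr u v" if "u \<in> Vs" "v \<in> Vs" for u v
      using inj_on_image_mem_iff[OF inj_num that(2) pref_list_in[OF that(1)]] by (simp add: nbr_def)
    then show ?thesis using Vs xy nbr_sym_A[OF xy(2,4)] by (simp add: prefs_inst)
  qed
  moreover have "E0 I \<subseteq> edges I" "E1 I \<subseteq> edges I"
    using assms(1) unfolding edges_inst by (fastforce simp: E0_def E1_def inst_def)+
  moreover have "U0 I \<subseteq> nodes I" "U1 I \<subseteq> nodes I"
    using assms(2) unfolding nodes_inst by (auto simp: U0_def U1_def inst_def)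
  moreover have "left_size I \<le> length (prefs I)" by (simp add: inst_def)
  ultimately show ?thesis by (simp add: wf_popm_def)
qed

text \<open>By duality popularity is the existence of a witness, and the forced and forbidden
  elements depend only on the involution; both can be moved between numbers and symbolic
  nodes.\<close>

lemma solvable_inst_iff:
  assumes e: "\<And>u v. (u, v) \<in> set e0 \<union> set e1 \<Longrightarrow> u \<in> Vs \<and> v \<in> Vs \<and> u \<noteq> v" and u: "set u0 \<union> set u1 \<subseteq> Vs"
  shows "solvable I \<longleftrightarrow> (\<exists>\<mu> \<alpha>. witness Vs nbr P \<mu> \<alpha> \<and> obeys e0 e1 u0 u1 \<mu>)"
proof -
  let ?ok = "\<lambda>M. E1 I \<subseteq> M \<and> E0 I \<inter> M = {} \<and> (\<forall>u\<in>U1 I. matched M u) \<and> (\<forall>u\<in>U0 I. \<not> matched M u)"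
  have cond: "?ok M \<longleftrightarrow> obeys e0 e1 u0 u1 \<mu>"
    if M: "matching (edges I) M" and \<mu>: "\<And>u. u \<in> Vs \<Longrightarrow> \<mu> u \<in> Vs \<and> mate M (num u) = num (\<mu> u)" for M \<mu>
  proof -
    have edge: "{num u, num v} \<in> M \<longleftrightarrow> \<mu> u = v" if "u \<in> Vs" "v \<in> Vs" "u \<noteq> v" for u v
    proof -
      have "num u \<noteq> num v" "num (\<mu> u) = num v \<longleftrightarrow> \<mu> u = v"
        using that \<mu>[OF that(1)] inj_on_eq_iff[OF inj_num] by simp_all
      then show ?thesis using \<mu>[OF that(1)] bip.matching_edge_iff[OF M, of "num u" "num v"] by simp
    qed
    have node: "matched M (num u) \<longleftrightarrow> \<mu> u \<noteq> u" if "u \<in> Vs" for u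
      using \<mu>[OF that] that inj_on_eq_iff[OF inj_num] bip.matched_iff_mate[OF M, of "num u"] by simp
    have "E0 I \<inter> M = {} \<longleftrightarrow> (\<forall>(u, v)\<in>set e0. {num u, num v} \<notin> M)"
      by (auto simp: E0_def inst_def)
    also have "\<dots> \<longleftrightarrow> (\<forall>(u, v)\<in>set e0. \<mu> u \<noteq> v)"
      by (rule ball_cong) (use edge e in auto)
    finally have "E0 I \<inter> M = {} \<longleftrightarrow> (\<forall>(u, v)\<in>set e0. \<mu> u \<noteq> v)" .
    moreover have "E1 I \<subseteq> M \<longleftrightarrow> (\<forall>(u, v)\<in>set e1. \<mu> u = v)"
    proof -
      have "E1 I \<subseteq> M \<longleftrightarrow> (\<forall>(u, v)\<in>set e1. {num u, num v} \<in> M)"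
        by (auto simp: E1_def inst_def)
      also have "\<dots> \<longleftrightarrow> (\<forall>(u, v)\<in>set e1. \<mu> u = v)"
        by (rule ball_cong) (use edge e in auto)
      finally show ?thesis .
    qed
    moreover have "(\<forall>u\<in>U1 I. matched M u) \<longleftrightarrow> (\<forall>u\<in>set u1. \<mu> u \<noteq> u)" "(\<forall>u\<in>U0 I. \<not> matched M u) \<longleftrightarrow> (\<forall>u\<in>set u0. \<mu> u = u)"
      using node u by (simp_all add: U0_def U1_def inst_def subset_iff)
    ultimately show ?thesis unfolding obeys_def by (simp only: conj_ac)
  qed
  have adj: "bip.adj (num x) (num y) \<longleftrightarrow> nbr x y" if "x \<in> Vs" "y \<in> Vs" for x y
    using mem_edges_inst[OF that] by (simp add: bip.adj_def)
  have g: "node_of n \<in> Vs \<and> num (node_of n) = n" if "n \<in> nodes I" for n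
    using that by (auto simp: nodes_inst node_of_num)
  have h: "num x \<in> nodes I \<and> node_of (num x) = x" if "x \<in> Vs" for x
    using that by (auto simp: nodes_inst node_of_num)
  show ?thesis
  proof
    assume "solvable I"
    then obtain M where M: "popular (nodes I) (edges I) (pref I) M"
      and c: "?ok M"
      by (auto simp: solvable_def)
    then have match: "matching (edges I) M" by (simp add: popular_def)
    obtain \<beta> where \<beta>: "witness (nodes I) bip.adj (pref I) (mate M) \<beta>"
      using bip.witness_if_popular[OF match M] .
    define \<mu> where "\<mu> x = node_of (mate M (num x))" for x
    have w: "witness Vs nbr P (\<lambda>x. node_of (mate M (num x))) (\<lambda>x. \<beta> (num x))"
    proof (rule witness_transfer[OF \<beta> h g])
      fix x y assume "x \<in> nodes I" "y \<in> nodes I"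
      then show "nbr (node_of x) (node_of y) \<longleftrightarrow> bip.adj x y" using adj g by metis
    next
      fix x y z assume "x \<in> nodes I" "y \<in> nodes I" "z \<in> nodes I"
      then show "P (node_of x) (node_of y) (node_of z) \<longleftrightarrow> pref I x y z" using pref_inst g by metis
    qed
    have "mate M n \<in> nodes I" if "n \<in> nodes I" for n
      using bip.assignment_mate[OF match] that by (simp add: assignment_def)
    then have "\<mu> u \<in> Vs \<and> mate M (num u) = num (\<mu> u)" if "u \<in> Vs" for u
      using g h that by (simp add: \<mu>_def)
    from cond[OF match this] c w show "\<exists>\<mu> \<alpha>. witness Vs nbr P \<mu> \<alpha> \<and> obeys e0 e1 u0 u1 \<mu>"
      unfolding \<mu>_def[symmetric] by blast
  next
    assume "\<exists>\<mu> \<alpha>. witness Vs nbr P \<mu> \<alpha> \<and> obeys e0 e1 u0 u1 \<mu>"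
    then obtain \<mu> \<alpha> where w: "witness Vs nbr P \<mu> \<alpha>" and c: "obeys e0 e1 u0 u1 \<mu>" by blast
    have w': "witness (nodes I) bip.adj (pref I) (\<lambda>n. num (\<mu> (node_of n))) (\<lambda>n. \<alpha> (node_of n))"
      by (rule witness_transfer[OF w g h adj pref_inst])
    then have "assignment (nodes I) bip.adj (\<lambda>n. num (\<mu> (node_of n)))" by (simp add: witness_def)
    then obtain M where M: "matching (edges I) M" "\<And>n. n \<in> nodes I \<Longrightarrow> mate M n = num (\<mu> (node_of n))"
      by (rule bip.matching_of_assignment) (blast intro: that)
    have "popular (nodes I) (edges I) (pref I) M"
      by (rule bip.popular_if_witness[OF M(1) witness_cong[OF w' M(2)]])
    moreover have "\<mu> u \<in> Vs \<and> mate M (num u) = num (\<mu> u)" if "u \<in> Vs" for u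
      using W_in[OF w that] M(2) h[OF that] by simp
    from cond[OF M(1) this] c
    have "?ok M" by blast
    ultimately show "solvable I" by (auto simp: solvable_def)
  qed
qed

text \<open>Isolates what a restriction has to supply: \<open>core\<close> leads from a matching to
  a solution, and \<open>mu\<close> makes the matching built from a solution admissible.\<close>

lemma solvable_iff_solution:
  assumes e: "\<And>u v. (u, v) \<in> set e0 \<union> set e1 \<Longrightarrow> u \<in> Vs \<and> v \<in> Vs \<and> u \<noteq> v" and u: "set u0 \<union> set u1 \<subseteq> Vs"
    and core: "\<And>\<mu> \<alpha>. witness Vs nbr P \<mu> \<alpha> \<Longrightarrow> obeys e0 e1 u0 u1 \<mu> \<Longrightarrow> \<mu> BB = QQ \<and> \<mu> TT = RR"
    and mu: "\<And>\<sigma>. obeys e0 e1 u0 u1 (mu True \<sigma>)"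
  shows "solvable I \<longleftrightarrow> solution_exists"
proof -
  have iff: "solvable I \<longleftrightarrow> (\<exists>\<mu> \<alpha>. witness Vs nbr P \<mu> \<alpha> \<and> obeys e0 e1 u0 u1 \<mu>)"
    by (rule solvable_inst_iff) (use e u in blast)+
  show ?thesis
  proof
    assume "solvable I"
    then obtain \<mu> \<alpha> where w: "witness Vs nbr P \<mu> \<alpha>" and c: "obeys e0 e1 u0 u1 \<mu>"
      unfolding iff by (elim exE conjE)
    from core[OF w c] show solution_exists
      using solution_if_witness[OF w] by (simp add: solution_exists_def)
  next
    assume solution_exists
    then obtain sel where sel: "\<forall>c\<in>set Cs. 1 \<le> sel c \<and> sel c \<le> K"
      "\<forall>c\<in>set Cs. \<forall>c'\<in>set Cs. \<not> conf c (sel c) c' (sel c')"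
      unfolding solution_exists_def by (elim exE conjE)
    have "\<exists>\<sigma> \<alpha>. witness Vs nbr P (mu True \<sigma>) \<alpha>"
      by (rule witness_if_solution[of sel]) (use sel in blast)+
    then show "solvable I" unfolding iff using mu by blast
  qed
qed

end

lemma W_alternatives:
  assumes w: "witness Vs nbr P \<mu> \<alpha>"
  shows "\<mu> BB \<noteq> BB \<Longrightarrow> \<mu> BB = QQ" "\<mu> QQ = BB \<Longrightarrow> \<mu> BB = QQ" "\<mu> PP \<noteq> QQ \<Longrightarrow> \<mu> BB = QQ"
    "\<mu> AA = AA \<Longrightarrow> \<mu> TT = RR" "\<mu> AA \<noteq> TT \<Longrightarrow> \<mu> TT = RR" "\<mu> RR = TT \<Longrightarrow> \<mu> TT = RR"
proof -
  have in_Vs: "QQ \<in> Vs" "RR \<in> Vs" by (simp_all add: Vs_def)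
  show QB: "\<mu> QQ = BB \<Longrightarrow> \<mu> BB = QQ" using W_W[OF w in_Vs(1)] by simp
  show "\<mu> RR = TT \<Longrightarrow> \<mu> TT = RR" using W_W[OF w in_Vs(2)] by simp
  show "\<mu> BB \<noteq> BB \<Longrightarrow> \<mu> BB = QQ" by (rule W_BB[OF w])
  show "\<mu> PP \<noteq> QQ \<Longrightarrow> \<mu> BB = QQ" by (rule QB[OF W_QQ[OF w]])
  show "\<mu> AA = AA \<Longrightarrow> \<mu> TT = RR" by (rule W_TT[OF w])
  show "\<mu> AA \<noteq> TT \<Longrightarrow> \<mu> TT = RR" by (rule W_TT[OF w W_AA[OF w]])
qed

lemma restrictions:
  assumes "(e0, e1, u0, u1) \<in> set restrictions"
  shows "solvable (inst e0 e1 u0 u1) \<longleftrightarrow> solution_exists" and "wf_popm (inst e0 e1 u0 u1)"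
proof -
  have in_Vs: "AA \<in> Vs" "TT \<in> Vs" "PP \<in> Vs" "QQ \<in> Vs" "RR \<in> Vs" "BB \<in> Vs" by (simp_all add: Vs_def)
  show "solvable (inst e0 e1 u0 u1) \<longleftrightarrow> solution_exists"
  proof (rule solvable_iff_solution)
    show "u \<in> Vs \<and> v \<in> Vs \<and> u \<noteq> v" if "(u, v) \<in> set e0 \<union> set e1" for u v
      using assms that in_Vs by (auto simp: restrictions_def)
    show "set u0 \<union> set u1 \<subseteq> Vs" using assms in_Vs by (auto simp: restrictions_def)
    show "\<mu> BB = QQ \<and> \<mu> TT = RR" if "witness Vs nbr P \<mu> \<alpha>" "obeys e0 e1 u0 u1 \<mu>" for \<mu> \<alpha>
      using assms that(2) W_alternatives[OF that(1)] by (auto simp: restrictions_def obeys_def)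
  qed (use assms in \<open>auto simp: restrictions_def obeys_def\<close>)
  show "wf_popm (inst e0 e1 u0 u1)"
    by (rule wf_inst) (use assms in_Vs in \<open>auto simp: restrictions_def nbr_def\<close>)
qed

end

section \<open>Computations as constraint satisfaction problems\<close>

type_synonym option_t = "nat \<times> nat list \<times> (nat \<times> int) list"

definition oq :: "option_t \<Rightarrow> nat" where "oq o1 = fst o1"
definition ors :: "option_t \<Rightarrow> nat list" where "ors o1 = fst (snd o1)"
definition osym :: "option_t \<Rightarrow> nat \<Rightarrow> nat" where "osym o1 j = fst (snd (snd o1) ! j)"
definition oflag :: "option_t \<Rightarrow> nat \<Rightarrow> int" where "oflag o1 j = snd (snd (snd o1) ! j)"

text \<open>
  The tableau of a computation of \<^term>\<open>M\<close>, as a constraint satisfaction problem: the cell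
  \<open>(\<tau>, i)\<close> with \<open>i \<le> 2 * T\<close> carries the state and all the symbols read at time \<open>\<tau>\<close> and, for
  each tape, the symbol at position \<open>i - T\<close> together with the sign of this position relative to
  the head.
\<close>

locale tableau =
  fixes M :: machine
  assumes tm: "turing_machine M" and tapes: "3 \<le> num_tapes M"
begin

text \<open>A halted configuration repeats itself under \<open>step\<close>. Extending
  \<open>delta\<close> accordingly lets all rows of the tableau obey the same rule.\<close>

definition nxt :: "nat \<Rightarrow> nat list \<Rightarrow> nat \<times> (nat \<times> direction) list" where
  "nxt q rs = (if q < num_states M then delta M q rs else (q, map (\<lambda>s. (s, Stay)) rs))"

text \<open>The last conjunct lets the cell under a head vouch for the symbol read there;
  \<open>hbad\<close> then makes this symbol common to the whole row.\<close>

definition valid :: "option_t \<Rightarrow> bool" where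
  "valid o1 \<longleftrightarrow> oq o1 \<le> num_states M \<and> length (ors o1) = num_tapes M \<and> set (ors o1) \<subseteq> {..<num_symbols M} \<and>
     length (snd (snd o1)) = num_tapes M \<and>
     (\<forall>j<num_tapes M. osym o1 j < num_symbols M \<and> oflag o1 j \<in> {-1, 0, 1} \<and> (oflag o1 j = 0 \<longrightarrow> ors o1 ! j = osym o1 j))"

text \<open>The valid options become the domain of the constraint problem, whose size is thus
  independent of the input.\<close>

lemma finite_valid: "finite {o1. valid o1}"
proof (rule finite_subset)
  show "{o1. valid o1} \<subseteq> {..num_states M} \<times> {rs. set rs \<subseteq> {..<num_symbols M} \<and> length rs = num_tapes M} \<times>
      {cs. set cs \<subseteq> {..<num_symbols M} \<times> {-1, 0, 1} \<and> length cs = num_tapes M}"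
  proof
    fix o1 assume v: "o1 \<in> {o1. valid o1}"
    obtain q rs cs where o1: "o1 = (q, rs, cs)" by (cases o1)
    have "set cs \<subseteq> {..<num_symbols M} \<times> {-1, 0, 1}"
    proof
      fix c assume "c \<in> set cs"
      then obtain j where "j < length cs" "c = cs ! j" by (auto simp: in_set_conv_nth)
      then show "c \<in> {..<num_symbols M} \<times> {-1, 0, 1}"
        using v by (simp add: valid_def o1 osym_def oflag_def mem_Times_iff)
    qed
    then show "o1 \<in> {..num_states M} \<times> {rs. set rs \<subseteq> {..<num_symbols M} \<and> length rs = num_tapes M} \<times>
      {cs. set cs \<subseteq> {..<num_symbols M} \<times> {-1, 0, 1} \<and> length cs = num_tapes M}"
      using v by (auto simp: o1 valid_def oq_def ors_def)
  qed
qed (intro finite_cartesian_product finite_lists_length_eq; simp)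

text \<open>The permitted pairs of flags make a row read -1, ..., -1, 0, 1, ..., 1 for each tape. As
  (-1, 1) is not among them, the sign cannot change without a head in between.\<close>

definition hbad :: "option_t \<Rightarrow> option_t \<Rightarrow> bool" where
  "hbad o1 o2 \<longleftrightarrow> oq o1 \<noteq> oq o2 \<or> ors o1 \<noteq> ors o2 \<or>
     (\<exists>j<num_tapes M. (oflag o1 j, oflag o2 j) \<notin> {(-1, -1), (-1, 0), (0, 1), (1, 1)})"

definition vbad :: "option_t \<Rightarrow> option_t \<Rightarrow> bool" where
  "vbad o1 o2 \<longleftrightarrow> fst (nxt (oq o1) (ors o1)) \<noteq> oq o2 \<or>
     (\<exists>j<num_tapes M. osym o2 j \<noteq> (if oflag o1 j = 0 then fst (snd (nxt (oq o1) (ors o1)) ! j) else osym o1 j))"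

text \<open>Only the cell that the head moves to is constrained; one flag 0 determines all other
  flags of the row.\<close>

definition mbad :: "direction \<Rightarrow> option_t \<Rightarrow> option_t \<Rightarrow> bool" where
  "mbad d o1 o2 \<longleftrightarrow> (\<exists>j<num_tapes M. oflag o1 j = 0 \<and> snd (snd (nxt (oq o1) (ors o1)) ! j) = d \<and> oflag o2 j \<noteq> 0)"

text \<open>The certificate on tape 1 is guessed. Forbidding a bit to the right of a blank makes the
  guess the contents of a string.\<close>

definition ybad :: "option_t \<Rightarrow> option_t \<Rightarrow> bool" where
  "ybad o1 o2 \<longleftrightarrow> osym o1 1 = 0 \<and> osym o2 1 \<noteq> 0"

text \<open>\<open>s\<close> is the sign of the cell relative to the heads, \<open>a\<close> the
  symbol of the input there, and \<open>b\<close> tells whether the certificate may extend to this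
  cell.\<close>

definition start :: "int \<Rightarrow> nat \<Rightarrow> bool \<Rightarrow> option_t \<Rightarrow> bool" where
  "start s a b o1 \<longleftrightarrow> oq o1 = 0 \<and> osym o1 0 = a \<and> osym o1 1 \<le> 2 \<and> (b \<or> osym o1 1 = 0) \<and>
     (\<forall>j<num_tapes M. oflag o1 j = s \<and> (2 \<le> j \<longrightarrow> osym o1 j = 0))"

text \<open>The answer \<open>[True]\<close> is written as the symbol 2 at position 0, which is the
  column \<open>T\<close> at which \<open>consistent\<close> makes this test.\<close>

definition accepting :: "option_t \<Rightarrow> bool" where
  "accepting o1 \<longleftrightarrow> osym o1 (num_tapes M - 1) = 2"

definition run :: "bool list \<Rightarrow> bool list \<Rightarrow> nat \<Rightarrow> config" where
  "run x y t = (step M ^^ t) (init M [x, y])"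

text \<open>A head moves by at most one cell per step, so up to time \<open>T\<close> it stays on
  the \<open>2 * T + 1\<close> cells of a row.\<close>

definition good :: "nat \<Rightarrow> config \<Rightarrow> bool" where
  "good t cf \<longleftrightarrow> fst cf \<le> num_states M \<and> length (snd cf) = num_tapes M \<and>
     (\<forall>j<num_tapes M. (\<forall>z. fst (snd cf ! j) z < num_symbols M) \<and> \<bar>snd (snd cf ! j)\<bar> \<le> int t)"

lemma read_tape_eq: "read_tape t = fst t (snd t)" by (cases t) simp

lemma nxt_props:
  assumes "q \<le> num_states M" "length rs = num_tapes M" "set rs \<subseteq> {..<num_symbols M}"
  shows "fst (nxt q rs) \<le> num_states M" "length (snd (nxt q rs)) = num_tapes M"
    "j < num_tapes M \<Longrightarrow> fst (snd (nxt q rs) ! j) < num_symbols M"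
proof -
  have *: "fst (nxt q rs) \<le> num_states M \<and> length (snd (nxt q rs)) = num_tapes M \<and> fst ` set (snd (nxt q rs)) \<subseteq> {..<num_symbols M}"
    using tm assms by (auto simp: nxt_def turing_machine_def)
  then show "fst (nxt q rs) \<le> num_states M" and len: "length (snd (nxt q rs)) = num_tapes M" by simp_all
  assume "j < num_tapes M"
  then have "snd (nxt q rs) ! j \<in> set (snd (nxt q rs))" using len by simp
  then show "fst (snd (nxt q rs) ! j) < num_symbols M" using * by blast
qed

lemma act_Stay: "act (fst t (snd t), Stay) t = t"
  by (cases t) simp

lemma step_nxt:
  assumes "length ts = num_tapes M"
  shows "step M (q, ts) = (fst (nxt q (map read_tape ts)), map2 act (snd (nxt q (map read_tape ts))) ts)"
proof (cases "q < num_states M")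
  case True
  then show ?thesis by (simp add: step_def nxt_def split: prod.split)
next
  case False
  have "map2 act (map (\<lambda>s. (s, Stay)) (map read_tape ts)) ts = ts"
    by (rule nth_equalityI) (simp_all add: read_tape_eq act_Stay)
  then show ?thesis using False by (simp add: step_def nxt_def)
qed

lemma read_symbols: "good t cf \<Longrightarrow> set (map read_tape (snd cf)) \<subseteq> {..<num_symbols M}"
proof
  fix a assume g: "good t cf" and "a \<in> set (map read_tape (snd cf))"
  then obtain j where "j < length (snd cf)" "a = fst (snd cf ! j) (snd (snd cf ! j))"
    by (auto simp: in_set_conv_nth read_tape_eq)
  then show "a \<in> {..<num_symbols M}" using g by (simp add: good_def)
qed

lemma step_tape:
  assumes "good t cf" "j < num_tapes M"
  defines "a \<equiv> snd (nxt (fst cf) (map read_tape (snd cf))) ! j"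
  shows "fst (snd (step M cf) ! j) = (fst (snd cf ! j))(snd (snd cf ! j) := fst a)"
    "snd (snd (step M cf) ! j) = snd (snd cf ! j) + offset (snd a)"
proof -
  obtain q ts where cf: "cf = (q, ts)" by (cases cf)
  have len: "length ts = num_tapes M" using assms(1) by (simp add: good_def cf)
  have len': "length (snd (nxt q (map read_tape ts))) = num_tapes M"
    using nxt_props(2)[of q "map read_tape ts"] assms(1) read_symbols[OF assms(1)] by (simp add: good_def cf)
  have "snd (step M cf) ! j = act a (ts ! j)"
    using assms(2) len len' by (simp add: step_nxt[OF len] cf a_def)
  then show "fst (snd (step M cf) ! j) = (fst (snd cf ! j))(snd (snd cf ! j) := fst a)"
    "snd (snd (step M cf) ! j) = snd (snd cf ! j) + offset (snd a)"
    by (cases a; cases "ts ! j"; simp add: cf)+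
qed

lemma step_state: "good t cf \<Longrightarrow> fst (step M cf) = fst (nxt (fst cf) (map read_tape (snd cf)))"
  by (cases cf) (simp add: step_nxt good_def)

lemma good_step:
  assumes "good t cf"
  shows "good (Suc t) (step M cf)"
proof -
  obtain q ts where cf: "cf = (q, ts)" by (cases cf)
  have len: "length ts = num_tapes M" using assms(1) by (simp add: good_def cf)
  note np = nxt_props[of "fst cf" "map read_tape (snd cf)"]
  have pre: "fst cf \<le> num_states M" "length (map read_tape (snd cf)) = num_tapes M"
    "set (map read_tape (snd cf)) \<subseteq> {..<num_symbols M}"
    using assms read_symbols[OF assms] by (simp_all add: good_def)
  have off: "\<bar>offset d\<bar> \<le> 1" for d by (cases d) auto
  have "length (snd (step M cf)) = num_tapes M"
    using np(2)[OF pre] len by (simp add: step_nxt[OF len] cf)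
  moreover have "fst (snd (step M cf) ! j) z < num_symbols M" if "j < num_tapes M" for j z
    using step_tape(1)[OF assms that] np(3)[OF pre that] assms that by (simp add: good_def)
  moreover have "\<bar>snd (snd (step M cf) ! j)\<bar> \<le> int (Suc t)" if "j < num_tapes M" for j
  proof -
    have "\<bar>snd (snd cf ! j)\<bar> \<le> int t" using assms that by (simp add: good_def)
    then show ?thesis
      using step_tape(2)[OF assms that] off[of "snd (snd (nxt (fst cf) (map read_tape (snd cf))) ! j)"] by simp
  qed
  ultimately show ?thesis using np(1)[OF pre] step_state[OF assms] by (simp add: good_def)
qed

lemma good_run: "good t (run x y t)"
proof (induction t)
  case 0
  have "written w z < num_symbols M" for w z
    using tm by (auto simp: written_def turing_machine_def)
  then show ?case by (simp add: run_def init_def good_def)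
next
  case (Suc t)
  then show ?case using good_step by (simp add: run_def)
qed

section \<open>Agreement of tableaux with runs\<close>

definition agrees :: "option_t \<Rightarrow> config \<Rightarrow> int \<Rightarrow> bool" where
  "agrees o1 cf z \<longleftrightarrow> oq o1 = fst cf \<and> ors o1 = map read_tape (snd cf) \<and>
     (\<forall>j<num_tapes M. osym o1 j = fst (snd cf ! j) z \<and> oflag o1 j = sgn (z - snd (snd cf ! j)))"

text \<open>Going right from a 0 the permitted pairs leave only 1, going left only -1.\<close>

lemma flags_determined:
  fixes F :: "nat \<Rightarrow> int"
  assumes adj: "\<And>i. i < N \<Longrightarrow> (F i, F (Suc i)) \<in> {(-1, -1), (-1, 0), (0, 1), (1, 1)}"
    and h: "h \<le> N" "F h = 0" and i: "i \<le> N"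
  shows "F i = sgn (int i - int h)"
proof (cases "h \<le> i")
  case True
  have up: "h + d \<le> N \<Longrightarrow> F (h + d) = sgn (int d)" for d
  proof (induction d)
    case (Suc d)
    then show ?case using adj[of "h + d"] by (cases "d = 0") auto
  qed (simp add: h)
  from True obtain d where "i = h + d" using le_Suc_ex by blast
  then show ?thesis using up[of d] i by simp
next
  case False
  have down: "d \<le> h \<Longrightarrow> F (h - d) = - sgn (int d)" for d
  proof (induction d)
    case (Suc d)
    then have "Suc (h - Suc d) = h - d" by simp
    then show ?case using Suc adj[of "h - Suc d"] h(1) by (cases "d = 0") auto
  qed (simp add: h)
  have "F (h - (h - i)) = - sgn (int (h - i))" by (rule down) simp
  then show ?thesis using False by (simp add: of_nat_diff sgn_if)
qed

lemma row_constant: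
  assumes "\<And>i. i < N \<Longrightarrow> g i = g (Suc i)" "i \<le> N" "i' \<le> N"
  shows "g i = g i'"
proof -
  have "g i = g 0" if "i \<le> N" for i
    using that
  proof (induction i)
    case (Suc i)
    then show ?case using assms(1)[of i] by simp
  qed simp
  from this[of i] this[of i'] assms(2,3) show ?thesis by simp
qed

context
  fixes x :: "bool list" and P T :: nat
  assumes T: "length x \<le> T" "P \<le> T"
begin

definition start_at :: "nat \<Rightarrow> option_t \<Rightarrow> bool" where
  "start_at i = start (sgn (int i - int T))
     (if T \<le> i \<and> i < T + length x then if x ! (i - T) then 2 else 1 else 0) (T \<le> i \<and> i < T + P)"

definition consistent :: "(nat \<Rightarrow> nat \<Rightarrow> option_t) \<Rightarrow> bool" where
  "consistent f \<longleftrightarrow>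
     (\<forall>t\<le>T. \<forall>i\<le>2 * T. valid (f t i)) \<and>
     (\<forall>t\<le>T. \<forall>i<2 * T. \<not> hbad (f t i) (f t (Suc i))) \<and>
     (\<forall>t<T. \<forall>i\<le>2 * T. \<not> vbad (f t i) (f (Suc t) i) \<and> \<not> mbad Stay (f t i) (f (Suc t) i)) \<and>
     (\<forall>t<T. \<forall>i<2 * T. \<not> mbad Right (f t i) (f (Suc t) (Suc i)) \<and> \<not> mbad Left (f t (Suc i)) (f (Suc t) i)) \<and>
     (\<forall>i\<le>2 * T. start_at i (f 0 i)) \<and> (\<forall>i. T \<le> i \<longrightarrow> i < 2 * T \<longrightarrow> \<not> ybad (f 0 i) (f 0 (Suc i))) \<and>
     accepting (f T T)"

definition accepts :: "bool list \<Rightarrow> bool" where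
  "accepts y \<longleftrightarrow> fst (last (snd (run x y T))) 0 = 2"

lemma init_tape:
  "j < num_tapes M \<Longrightarrow> snd (init M [x, y]) ! j = (written (if j = 0 then x else if j = 1 then y else []), 0)"
  by (auto simp: init_def less_Suc_eq numeral_2_eq_2)

lemma written_shift:
  "written w (int i - int T) = (if T \<le> i \<and> i < T + length w then if w ! (i - T) then 2 else 1 else 0)"
proof (cases "T \<le> i")
  case True
  then obtain l where "i = T + l" using le_Suc_ex by blast
  then show ?thesis by (simp add: written_def)
qed (simp add: written_def)

lemma consistent_if_accepts:
  assumes y: "length y \<le> P" and acc: "accepts y"
  shows "\<exists>f. consistent f"
proof -
  define f :: "nat \<Rightarrow> nat \<Rightarrow> option_t" where "f t i = (fst (run x y t), map read_tape (snd (run x y t)),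
    map (\<lambda>tp. (fst tp (int i - int T), sgn (int i - int T - snd tp))) (snd (run x y t)))" for t i
  have len: "length (snd (run x y t)) = num_tapes M" for t using good_run[of t x y] by (simp add: good_def)
  have f: "oq (f t i) = fst (run x y t)" "ors (f t i) = map read_tape (snd (run x y t))"
    "j < num_tapes M \<Longrightarrow> osym (f t i) j = fst (snd (run x y t) ! j) (int i - int T)"
    "j < num_tapes M \<Longrightarrow> oflag (f t i) j = sgn (int i - int T - snd (snd (run x y t) ! j))" for t i j
    by (simp_all add: f_def oq_def ors_def osym_def oflag_def len)
  have run_Suc: "run x y (Suc t) = step M (run x y t)" for t by (simp add: run_def)
  have sgn_zero: "sgn z = 0 \<longleftrightarrow> z = 0" for z :: int by (simp add: sgn_if)
  have "valid (f t i)" for t i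
  proof -
    have "length (snd (snd (f t i))) = num_tapes M" by (simp add: f_def len)
    then show ?thesis using good_run[of t x y] read_symbols[OF good_run, of x y t]
      by (auto simp: valid_def f good_def sgn_if read_tape_eq)
  qed
  moreover have "\<not> hbad (f t i) (f t (Suc i))" for t i
    by (auto simp: hbad_def f sgn_if)
  moreover have "\<not> vbad (f t i) (f (Suc t) i)" for t i
    using step_state[OF good_run, of x y t] step_tape(1)[OF good_run, of _ x y t]
    by (auto simp: vbad_def f run_Suc sgn_zero)
  moreover have "\<not> mbad Stay (f t i) (f (Suc t) i)" "\<not> mbad Right (f t i) (f (Suc t) (Suc i))" "\<not> mbad Left (f t (Suc i)) (f (Suc t) i)" for t i
    using step_tape(2)[OF good_run, of _ x y t] by (auto simp: mbad_def f run_Suc sgn_zero)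
  moreover have "start_at i (f 0 i)" for i
  proof -
    have tp: "snd (run x y 0) ! j = (written (if j = 0 then x else if j = 1 then y else []), 0)"
      if "j < num_tapes M" for j
      using init_tape[OF that] by (simp add: run_def)
    have "fst (run x y 0) = 0" by (simp add: run_def init_def)
    then show ?thesis using tapes y
      by (simp add: start_at_def start_def f tp written_shift)
  qed
  moreover have "\<not> ybad (f 0 i) (f 0 (Suc i))" if "T \<le> i" for i
    using tapes that by (auto simp: ybad_def f run_def init_tape written_def)
  moreover have "accepting (f T T)"
    using acc tapes by (simp add: accepting_def accepts_def f len last_conv_nth flip: length_greater_0_conv)
  ultimately have "consistent f" by (simp add: consistent_def)
  then show ?thesis by blast
qed

lemma accepts_if_consistent:
  assumes f: "consistent f"
  shows "\<exists>y. length y \<le> P \<and> accepts y"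
proof -
  have valid: "valid (f t i)" if "t \<le> T" "i \<le> 2 * T" for t i using f that by (simp add: consistent_def)
  have h: "oq (f t i) = oq (f t (Suc i))" "ors (f t i) = ors (f t (Suc i))"
    "j < num_tapes M \<Longrightarrow> (oflag (f t i) j, oflag (f t (Suc i)) j) \<in> {(-1, -1), (-1, 0), (0, 1), (1, 1)}"
    if "t \<le> T" "i < 2 * T" for t i j
    using f that by (auto simp: consistent_def hbad_def)
  have v: "\<not> vbad (f t i) (f (Suc t) i)" if "t < T" "i \<le> 2 * T" for t i using f that by (simp add: consistent_def)
  have m: "i \<le> 2 * T \<Longrightarrow> \<not> mbad Stay (f t i) (f (Suc t) i)" "i < 2 * T \<Longrightarrow> \<not> mbad Right (f t i) (f (Suc t) (Suc i))"
    "i < 2 * T \<Longrightarrow> \<not> mbad Left (f t (Suc i)) (f (Suc t) i)" if "t < T" for t i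
    using f that by (simp_all add: consistent_def)
  have st: "start_at i (f 0 i)" if "i \<le> 2 * T" for i using f that by (simp add: consistent_def)
  have yb: "\<not> ybad (f 0 i) (f 0 (Suc i))" if "T \<le> i" "i < 2 * T" for i using f that by (simp add: consistent_def)
  define s where "s l = osym (f 0 (T + l)) 1" for l
  have sP: "s P = 0" using st[of "T + P"] T by (simp add: s_def start_at_def start_def)
  \<comment> \<open>The certificate ends at the first blank of tape 1 from position 0 on.
    \<open>start_at\<close> requires a blank at position \<open>P\<close>, so its length is at most
    \<open>P\<close>.\<close>
  define L where "L = (LEAST l. s l = 0)"
  have L: "s L = 0" "L \<le> P" unfolding L_def by (rule LeastI[of "\<lambda>l. s l = 0", OF sP], rule Least_le[of "\<lambda>l. s l = 0", OF sP])
  have below: "s l = 1 \<or> s l = 2" if "l < L" for l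
  proof -
    have "s l \<noteq> 0" using that not_less_Least unfolding L_def by blast
    moreover have "s l \<le> 2" using st[of "T + l"] that L T by (simp add: s_def start_at_def start_def)
    ultimately show ?thesis by linarith
  qed
  have above: "s (L + d) = 0" if "L + d \<le> T" for d
    using that
  proof (induction d)
    case (Suc d)
    then show ?case using yb[of "T + (L + d)"] by (simp add: s_def ybad_def)
  qed (simp add: L)
  define y where "y = map (\<lambda>l. s l = 2) [0..<L]"
  have ly: "length y = L" by (simp add: y_def)
  have sym1: "osym (f 0 i) 1 = written y (int i - int T)" if i: "i \<le> 2 * T" for i
  proof (cases "T \<le> i")
    case True
    then obtain l where l: "i = T + l" using le_Suc_ex by blast
    show ?thesis
    proof (cases "l < L")
      case True
      then show ?thesis using below[OF True] by (auto simp: l written_def ly y_def s_def)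
    next
      case False
      then obtain d where "l = L + d" using le_Suc_ex not_less by blast
      then show ?thesis using above[of d] i by (simp add: l written_def ly s_def)
    qed
  next
    case False
    then show ?thesis using st[OF i] by (simp add: written_def start_at_def start_def)
  qed
  \<comment> \<open>Common to the base case and the induction step: if a row has the right state and
    symbols and a flag 0 at each head, then \<open>hbad\<close> fixes the other flags and
    \<open>valid\<close> the symbols read.\<close>
  have heads: "agrees (f t i) cf (int i - int T)"
    if t: "t \<le> T" and cf: "length (snd cf) = num_tapes M" "\<And>j. j < num_tapes M \<Longrightarrow> \<bar>snd (snd cf ! j)\<bar> \<le> int T"
      and q: "\<And>i. i \<le> 2 * T \<Longrightarrow> oq (f t i) = fst cf"
      and sym: "\<And>i j. i \<le> 2 * T \<Longrightarrow> j < num_tapes M \<Longrightarrow> osym (f t i) j = fst (snd cf ! j) (int i - int T)"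
      and flag: "\<And>i j. i \<le> 2 * T \<Longrightarrow> j < num_tapes M \<Longrightarrow> int i - int T = snd (snd cf ! j) \<Longrightarrow> oflag (f t i) j = 0"
      and i: "i \<le> 2 * T" for t cf i
  proof -
    have fl: "oflag (f t i) j = sgn (int i - int T - snd (snd cf ! j))"
      and rs: "ors (f t i) ! j = read_tape (snd cf ! j)" if j: "j < num_tapes M" for j
    proof -
      define k where "k = nat (snd (snd cf ! j) + int T)"
      have k: "k \<le> 2 * T" "int k - int T = snd (snd cf ! j)" using cf(2)[OF j] by (auto simp: k_def)
      have zero: "oflag (f t k) j = 0" by (rule flag[OF k(1) j k(2)])
      have "oflag (f t i) j = sgn (int i - int k)"
        by (rule flags_determined[of "2 * T" "\<lambda>i. oflag (f t i) j", OF h(3)[OF t _ j] k(1) zero i])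
      moreover have "int i - int T - snd (snd cf ! j) = int i - int k" using k(2) by simp
      ultimately show "oflag (f t i) j = sgn (int i - int T - snd (snd cf ! j))" by (simp only:)
      have "ors (f t i) = ors (f t k)"
        by (rule row_constant[of "2 * T" "\<lambda>i. ors (f t i)", OF h(2)[OF t] i k(1)])
      moreover have "ors (f t k) ! j = osym (f t k) j" using valid[OF t k(1)] zero j by (simp add: valid_def)
      ultimately show "ors (f t i) ! j = read_tape (snd cf ! j)" using sym[OF k(1) j] k(2) by (simp add: read_tape_eq)
    qed
    have "ors (f t i) = map read_tape (snd cf)"
      using valid[OF t i] cf(1) rs by (intro nth_equalityI) (simp_all add: valid_def)
    then show ?thesis using q[OF i] sym[OF i] fl by (simp add: agrees_def)
  qed
  have agr: "t \<le> T \<Longrightarrow> i \<le> 2 * T \<Longrightarrow> agrees (f t i) (run x y t) (int i - int T)" for t i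
  proof (induction t arbitrary: i)
    case 0
    have len: "length (snd (init M [x, y])) = num_tapes M" by (simp add: init_def)
    show ?case
      unfolding run_def funpow_0
    proof (rule heads[OF 0(1) len _ _ _ _ 0(2)])
      fix i j assume i: "i \<le> 2 * T" and j: "j < num_tapes M"
      have s: "start_at i (f 0 i)" by (rule st[OF i])
      consider "j = 0" | "j = 1" | "2 \<le> j" by linarith
      then show "osym (f 0 i) j = fst (snd (init M [x, y]) ! j) (int i - int T)"
      proof cases
        case 1
        then show ?thesis using s j by (simp add: init_tape start_at_def start_def written_shift)
      next
        case 2
        then show ?thesis using sym1[OF i] j by (simp add: init_tape)
      next
        case 3
        then show ?thesis using s j by (simp add: init_tape start_at_def start_def written_shift)
      qed
      assume "int i - int T = snd (snd (init M [x, y]) ! j)"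
      then show "oflag (f 0 i) j = 0" using s j by (simp add: init_tape start_at_def start_def)
    qed (use st in \<open>auto simp: init_tape start_at_def start_def init_def\<close>)
  next
    case (Suc t)
    define cf where "cf = run x y t"
    have g: "good t cf" unfolding cf_def by (rule good_run)
    have g': "good (Suc t) (step M cf)" by (rule good_step[OF g])
    have IH: "agrees (f t i) cf (int i - int T)" if "i \<le> 2 * T" for i
      using Suc that by (simp add: cf_def)
    have t: "t < T" using Suc.prems by simp
    have "agrees (f (Suc t) i) (step M cf) (int i - int T)"
    proof (rule heads[OF Suc.prems(1) _ _ _ _ _ Suc.prems(2)])
      show "length (snd (step M cf)) = num_tapes M" using g' by (simp add: good_def)
      show "\<bar>snd (snd (step M cf) ! j)\<bar> \<le> int T" if "j < num_tapes M" for j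
        using g' that Suc.prems by (force simp: good_def)
    next
      fix i assume i: "i \<le> 2 * T"
      show "oq (f (Suc t) i) = fst (step M cf)"
        using v[OF t i] IH[OF i] step_state[OF g] by (simp add: vbad_def agrees_def)
    next
      fix i j assume i: "i \<le> 2 * T" and j: "j < num_tapes M"
      show "osym (f (Suc t) i) j = fst (snd (step M cf) ! j) (int i - int T)"
        using v[OF t i] IH[OF i] step_tape(1)[OF g j] j by (simp add: vbad_def agrees_def sgn_if split: if_splits)
      define a where "a = snd (nxt (fst cf) (map read_tape (snd cf))) ! j"
      assume "int i - int T = snd (snd (step M cf) ! j)"
      then have pos: "int i - int T = snd (snd cf ! j) + offset (snd a)"
        using step_tape(2)[OF g j] by (simp add: a_def)
      define k where "k = nat (snd (snd cf ! j) + int T)"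
      have "\<bar>snd (snd cf ! j)\<bar> \<le> int t" using g j by (simp add: good_def)
      then have k: "int k - int T = snd (snd cf ! j)" "k \<le> 2 * T" using t by (auto simp: k_def)
      have ag: "oq (f t k) = fst cf" "ors (f t k) = map read_tape (snd cf)" "oflag (f t k) j = 0"
        using IH[OF k(2)] j k(1) by (simp_all add: agrees_def)
      show "oflag (f (Suc t) i) j = 0"
      proof (cases "snd a")
        case Stay
        then have "i = k" using pos k by simp
        then show ?thesis using m(1)[OF t i] ag j Stay by (auto simp: mbad_def a_def)
      next
        case Right
        then have "i = Suc k" using pos k by simp
        then show ?thesis using m(2)[OF t, of k] i ag j Right by (auto simp: mbad_def a_def)
      next
        case Left
        then have "k = Suc i" using pos k by simp
        then show ?thesis using m(3)[OF t, of i] k ag j Left by (auto simp: mbad_def a_def)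
      qed
    qed
    then show ?case by (simp add: cf_def run_def)
  qed
  have "accepting (f T T)" using f by (simp add: consistent_def)
  moreover have "length (snd (run x y T)) = num_tapes M" using good_run[of T x y] by (simp add: good_def)
  ultimately have "accepts y"
    using agr[of T T] tapes by (simp add: accepting_def accepts_def agrees_def last_conv_nth flip: length_greater_0_conv)
  then show ?thesis using ly L by blast
qed

end

end

section \<open>Polynomial-time programs\<close>

datatype instr = INC nat | DEC nat | OUT bool | JZ nat nat | JB nat | JMP nat | MARK | SCAN nat

text \<open>
  A register machine is run by a Turing machine that keeps each register in the position of a head.
  \<open>MARK\<close> adds 3 to the symbols at position 0, which makes registers testable for 0.
  Register 0 is the head of the input tape; \<open>SCAN r\<close> moves it past the input and adds the
  length of the input to the register \<open>r\<close>.
\<close>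

fun next_pc :: "instr \<Rightarrow> nat \<Rightarrow> nat list \<Rightarrow> nat" where
  "next_pc (JZ r l) q rs = (if 3 \<le> rs ! r then l else Suc q)"
| "next_pc (JB l) q rs = (if rs ! 0 = 2 \<or> rs ! 0 = 5 then Suc q else l)"
| "next_pc (JMP l) q rs = l"
| "next_pc (SCAN r) q rs = (if rs ! 0 mod 3 = 0 then Suc q else q)"
| "next_pc _ q rs = Suc q"

text \<open>Tape \<open>m\<close> is the output tape, the tapes below it are the registers.
  \<open>DEC\<close> does not move a head on a marked symbol, which makes it truncated
  subtraction.\<close>

fun action :: "nat \<Rightarrow> instr \<Rightarrow> nat list \<Rightarrow> nat \<Rightarrow> nat \<times> direction" where
  "action m (INC r) rs j = (rs ! j, if j = r then Right else Stay)"
| "action m (DEC r) rs j = (rs ! j, if j = r \<and> rs ! j < 3 then Left else Stay)"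
| "action m (OUT b) rs j = (if j = m then (if b then 2 else 1, Right) else (rs ! j, Stay))"
| "action m MARK rs j = (if j = m then rs ! j else rs ! j mod 3 + 3, Stay)"
| "action m (SCAN r) rs j = (rs ! j, if rs ! 0 mod 3 \<noteq> 0 \<and> (j = 0 \<or> j = r) then Right else Stay)"
| "action m _ rs j = (rs ! j, Stay)"

text \<open>The \<open>min\<close> keeps all jump targets in range, so the result is a Turing
  machine for every list of instructions.\<close>

definition machine_of :: "nat \<Rightarrow> instr list \<Rightarrow> machine" where
  "machine_of m P = \<lparr>num_tapes = Suc m, num_symbols = 6, num_states = length P,
     delta = (\<lambda>q rs. (min (next_pc (P ! q) q rs) (length P), map (action m (P ! q) rs) [0..<Suc m]))\<rparr>"

lemma turing_machine_machine_of: "turing_machine (machine_of m P)"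
proof -
  have "fst (action m i rs j) < 6" if "length rs = Suc m" "set rs \<subseteq> {..<6}" "j < Suc m" for i rs j
  proof -
    have "rs ! j < 6" using that nth_mem[of j rs] by (metis lessThan_iff subsetD)
    moreover have "rs ! j mod 3 < 3" by simp
    ultimately show ?thesis by (cases i) auto
  qed
  then show ?thesis by (force simp: turing_machine_def machine_of_def simp del: upt_Suc)
qed

section \<open>Simulation of the register machine\<close>

type_synonym store = "(nat \<Rightarrow> nat) \<times> bool list"

definition reg_tape :: "bool list \<Rightarrow> nat \<Rightarrow> nat \<Rightarrow> tape" where
  "reg_tape x j k = (\<lambda>z. (if j = 0 then written x z else 0) + (if z = 0 then 3 else 0), int k)"

definition config_of :: "nat \<Rightarrow> bool list \<Rightarrow> nat \<Rightarrow> store \<Rightarrow> config" where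
  "config_of m x q st = (q, map (\<lambda>j. reg_tape x j (fst st j)) [0..<m] @ [(written (snd st), int (length (snd st)))])"

definition input_bit :: "bool list \<Rightarrow> nat \<Rightarrow> bool" where
  "input_bit x k \<longleftrightarrow> k < length x \<and> x ! k"

fun instr_step :: "bool list \<Rightarrow> instr \<Rightarrow> nat \<times> store \<Rightarrow> nat \<times> store" where
  "instr_step x (INC r) (q, s, out) = (Suc q, s(r := Suc (s r)), out)"
| "instr_step x (DEC r) (q, s, out) = (Suc q, s(r := s r - 1), out)"
| "instr_step x (OUT b) (q, s, out) = (Suc q, s, out @ [b])"
| "instr_step x (JZ r l) (q, s, out) = (if s r = 0 then l else Suc q, s, out)"
| "instr_step x (JB l) (q, s, out) = (if input_bit x (s 0) then Suc q else l, s, out)"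
| "instr_step x (JMP l) (q, s, out) = (l, s, out)"
| "instr_step x (SCAN r) (q, s, out) =
     (if s 0 < length x then (q, s(0 := Suc (s 0), r := Suc (s r)), out) else (Suc q, s, out))"
| "instr_step x MARK st = st"

fun regs_instr :: "instr \<Rightarrow> nat set" where
  "regs_instr (INC r) = {r}"
| "regs_instr (DEC r) = {r}"
| "regs_instr (JZ r l) = {r}"
| "regs_instr (SCAN r) = {r}"
| "regs_instr _ = {}"

lemma act_map2:
  "map2 act (map f [0..<Suc m]) (map g [0..<m] @ [t]) = map (\<lambda>j. act (f j) (g j)) [0..<m] @ [act (f m) t]"
proof -
  have "map2 act (map f [0..<m]) (map g [0..<m]) = map (\<lambda>j. act (f j) (g j)) [0..<m]"
    by (rule nth_equalityI) auto
  then show ?thesis by simp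
qed

lemma written_snoc: "(written out)(int (length out) := (if b then 2 else 1)) = written (out @ [b])"
  by (rule ext) (auto simp: written_def nth_append)

lemma written_cases: "written x z = 0 \<or> written x z = 1 \<or> written x z = 2"
  by (simp add: written_def)

lemma step_machine_of:
  assumes i: "q < length P" "P ! q = i" "i \<noteq> MARK" "regs_instr i \<subseteq> {0<..<m} \<or> (regs_instr i \<subseteq> {..<m} \<and> (\<forall>r. i \<noteq> SCAN r))"
    and m: "0 < m"
    and st': "instr_step x i (q, s, out) = (q', st')" and q': "q' \<le> length P"
  shows "step (machine_of m P) (config_of m x q (s, out)) = config_of m x q' st'"
proof -
  define rs where "rs = map (\<lambda>j. read_tape (reg_tape x j (s j))) [0..<m] @ [0::nat]"
  have rs: "map read_tape (snd (config_of m x q (s, out))) = rs"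
    by (simp add: config_of_def rs_def written_def)
  have rs_nth: "rs ! j = (if j = 0 then written x (int (s j)) else 0) + (if s j = 0 then 3 else 0)" if "j < m" for j
    using that by (simp add: rs_def nth_append reg_tape_def)
  have rs_m: "rs ! m = 0" by (simp add: rs_def nth_append)
  have ge3: "3 \<le> rs ! j \<longleftrightarrow> s j = 0" if "j < m" for j
    using that written_cases[of x "int (s j)"] by (auto simp: rs_nth)
  have bit: "(rs ! 0 = 2 \<or> rs ! 0 = 5) \<longleftrightarrow> input_bit x (s 0)"
    using m by (auto simp: rs_nth written_def input_bit_def)
  have blank: "rs ! 0 mod 3 = 0 \<longleftrightarrow> \<not> s 0 < length x"
    using m by (auto simp: rs_nth written_def)
  have pc: "next_pc i q rs = q'"
    using i(3,4) st' ge3 bit blank by (cases i) (auto simp del: One_nat_def)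
  have keep: "act (rs ! j, d) (reg_tape x j (s j)) = (fst (reg_tape x j (s j)), int (s j) + offset d)"
    if "j < m" for j d
    using that by (auto simp: reg_tape_def rs_nth)
  have keep': "act (rs ! m, Stay) (written out, int (length out)) = (written out, int (length out))"
    by (auto simp: rs_m written_def)
  have regs: "act (action m i rs j) (reg_tape x j (s j)) = reg_tape x j (fst st' j)" if j: "j < m" for j
    using i(3,4) st' ge3[OF j] blank j keep[OF j, of Stay] keep[OF j, of Left] keep[OF j, of Right]
    by (cases i) (auto simp: reg_tape_def of_nat_diff split: if_splits)
  have out: "act (action m i rs m) (written out, int (length out)) = (written (snd st'), int (length (snd st')))"
    using i(3,4) st' keep' m by (cases i) (auto simp: written_snoc split: if_splits)
  have "step (machine_of m P) (config_of m x q (s, out))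
    = (q', map2 act (map (action m i rs) [0..<Suc m]) (map (\<lambda>j. reg_tape x j (s j)) [0..<m] @ [(written out, int (length out))]))"
    using rs i(1,2) pc q' by (simp add: step_def config_of_def machine_of_def min_def del: upt_Suc)
  also have "\<dots> = config_of m x q' st'"
    unfolding act_map2 out by (simp add: config_of_def regs)
  finally show ?thesis .
qed

section \<open>Structured commands and their code\<close>

datatype com = Skip | Inc nat | Dec nat | Out bool | Seq com com | IfZ nat com com | IfB com com | Loop nat com

fun decr :: "nat \<Rightarrow> store \<Rightarrow> store" where
  "decr r (s, out) = (s(r := s r - 1), out)"

primrec exec :: "com \<Rightarrow> bool list \<Rightarrow> store \<Rightarrow> store" where
  "exec Skip x st = st"
| "exec (Inc r) x st = ((fst st)(r := Suc (fst st r)), snd st)"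
| "exec (Dec r) x st = decr r st"
| "exec (Out b) x st = (fst st, snd st @ [b])"
| "exec (Seq c1 c2) x st = exec c2 x (exec c1 x st)"
| "exec (IfZ r c1 c2) x st = (if fst st r = 0 then exec c1 x st else exec c2 x st)"
| "exec (IfB c1 c2) x st = (if input_bit x (fst st 0) then exec c1 x st else exec c2 x st)"
| "exec (Loop r c) x st = ((\<lambda>st. exec c x (decr r st)) ^^ fst st r) st"

text \<open>The exact number of machine steps. The branch whose code is placed first also pays for
  the jump over the other one; each round of a loop costs 3 for \<open>JZ\<close>,
  \<open>DEC\<close> and \<open>JMP\<close>, and leaving it costs one more
  \<open>JZ\<close>.\<close>

primrec time :: "com \<Rightarrow> bool list \<Rightarrow> store \<Rightarrow> nat" where
  "time Skip x st = 0"
| "time (Inc r) x st = 1"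
| "time (Dec r) x st = 1"
| "time (Out b) x st = 1"
| "time (Seq c1 c2) x st = time c1 x st + time c2 x (exec c1 x st)"
| "time (IfZ r c1 c2) x st = (if fst st r = 0 then 1 + time c1 x st else 2 + time c2 x st)"
| "time (IfB c1 c2) x st = (if input_bit x (fst st 0) then 2 + time c1 x st else 1 + time c2 x st)"
| "time (Loop r c) x st =
     1 + (\<Sum>i<fst st r. 3 + time c x (decr r (((\<lambda>st. exec c x (decr r st)) ^^ i) st)))"

primrec code_size :: "com \<Rightarrow> nat" where
  "code_size Skip = 0"
| "code_size (Inc r) = 1"
| "code_size (Dec r) = 1"
| "code_size (Out b) = 1"
| "code_size (Seq c1 c2) = code_size c1 + code_size c2"
| "code_size (IfZ r c1 c2) = 2 + code_size c1 + code_size c2"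
| "code_size (IfB c1 c2) = 2 + code_size c1 + code_size c2"
| "code_size (Loop r c) = 3 + code_size c"

primrec code :: "com \<Rightarrow> nat \<Rightarrow> instr list" where
  "code Skip i = []"
| "code (Inc r) i = [INC r]"
| "code (Dec r) i = [DEC r]"
| "code (Out b) i = [OUT b]"
| "code (Seq c1 c2) i = code c1 i @ code c2 (i + code_size c1)"
| "code (IfZ r c1 c2) i = JZ r (i + 2 + code_size c2) # code c2 (i + 1) @
     JMP (i + 2 + code_size c2 + code_size c1) # code c1 (i + 2 + code_size c2)"
| "code (IfB c1 c2) i = JB (i + 2 + code_size c1) # code c1 (i + 1) @
     JMP (i + 2 + code_size c1 + code_size c2) # code c2 (i + 2 + code_size c1)"
| "code (Loop r c) i = JZ r (i + 3 + code_size c) # DEC r # code c (i + 2) @ [JMP i]"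

lemma length_code [simp]: "length (code c i) = code_size c"
  by (induction c arbitrary: i) auto

text \<open>These are the registers that need a tape. A register that \<open>IfZ\<close> only tests
  is therefore included.\<close>

primrec modified :: "com \<Rightarrow> nat set" where
  "modified Skip = {}"
| "modified (Inc r) = {r}"
| "modified (Dec r) = {r}"
| "modified (Out b) = {}"
| "modified (Seq c1 c2) = modified c1 \<union> modified c2"
| "modified (IfZ r c1 c2) = insert r (modified c1 \<union> modified c2)"
| "modified (IfB c1 c2) = modified c1 \<union> modified c2"
| "modified (Loop r c) = insert r (modified c)"

text \<open>The code tests the loop register in every round, while \<open>exec\<close> fixes the
  number of rounds at the start. They agree if the body leaves this register alone.\<close>

primrec loops_ok :: "com \<Rightarrow> bool" where
  "loops_ok Skip \<longleftrightarrow> True"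
| "loops_ok (Inc r) \<longleftrightarrow> True"
| "loops_ok (Dec r) \<longleftrightarrow> True"
| "loops_ok (Out b) \<longleftrightarrow> True"
| "loops_ok (Seq c1 c2) \<longleftrightarrow> loops_ok c1 \<and> loops_ok c2"
| "loops_ok (IfZ r c1 c2) \<longleftrightarrow> loops_ok c1 \<and> loops_ok c2"
| "loops_ok (IfB c1 c2) \<longleftrightarrow> loops_ok c1 \<and> loops_ok c2"
| "loops_ok (Loop r c) \<longleftrightarrow> r \<notin> modified c \<and> loops_ok c"

lemma finite_modified: "finite (modified c)"
  by (induction c) auto

lemma fst_decr: "fst (decr r st) = (fst st)(r := fst st r - 1)"
  by (cases st) simp

lemma exec_unmodified: "r \<notin> modified c \<Longrightarrow> fst (exec c x st) r = fst st r"
proof (induction c arbitrary: st)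
  case (Loop r' c)
  have "fst (((\<lambda>st. exec c x (decr r' st)) ^^ n) st) r = fst st r" for n
    by (induction n) (use Loop in \<open>auto simp: fst_decr\<close>)
  then show ?case by simp
qed (auto simp: fst_decr)

lemma funpow_trans: "(f ^^ a) u = v \<Longrightarrow> (f ^^ b) v = w \<Longrightarrow> (f ^^ (a + b)) u = w"
  by (metis add.commute comp_apply funpow_add)

lemma funpow_step: "f u = v \<Longrightarrow> (f ^^ b) v = w \<Longrightarrow> (f ^^ Suc b) u = w"
  by (simp add: funpow_swap1)

text \<open>Jump targets are absolute, so the induction is over code placed between an arbitrary
  \<open>pre\<close> and \<open>post\<close>.\<close>

lemma code_correct:
  assumes "P = pre @ code c (length pre) @ post" "modified c \<subseteq> {..<m}" "loops_ok c" "0 < m"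
  shows "(step (machine_of m P) ^^ time c x st) (config_of m x (length pre) st)
    = config_of m x (length pre + code_size c) (exec c x st)"
  using assms
proof (induction c arbitrary: pre post st)
  case Skip
  then show ?case by simp
next
  case (Inc r)
  then show ?case
    by (cases st) (simp add: step_machine_of[of _ _ "INC r"] nth_append)
next
  case (Dec r)
  then show ?case
    by (cases st) (simp add: step_machine_of[of _ _ "DEC r"] nth_append)
next
  case (Out b)
  then show ?case
    by (cases st) (simp add: step_machine_of[of _ _ "OUT b"] nth_append)
next
  case (Seq c1 c2)
  have 1: "(step (machine_of m P) ^^ time c1 x st) (config_of m x (length pre) st)
    = config_of m x (length pre + code_size c1) (exec c1 x st)"
    using Seq.prems by (intro Seq.IH(1)[of pre "code c2 (length pre + code_size c1) @ post"]) auto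
  have 2: "(step (machine_of m P) ^^ time c2 x (exec c1 x st)) (config_of m x (length (pre @ code c1 (length pre))) (exec c1 x st))
    = config_of m x (length (pre @ code c1 (length pre)) + code_size c2) (exec c2 x (exec c1 x st))"
    using Seq.prems by (intro Seq.IH(2)[of "pre @ code c1 (length pre)" post]) auto
  show ?case using funpow_trans[OF 1 2[simplified]] by (simp add: add.assoc)
next
  case (IfZ r c1 c2)
  obtain s out where st: "st = (s, out)" by (cases st)
  let ?M = "machine_of m P" and ?n = "length pre"
  show ?case
  proof (cases "s r = 0")
    case True
    let ?pre = "pre @ JZ r (?n + 2 + code_size c2) # code c2 (?n + 1) @ [JMP (?n + 2 + code_size c2 + code_size c1)]"
    have "step ?M (config_of m x ?n st) = config_of m x (length ?pre) st"
      using IfZ.prems True unfolding st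
      by (intro step_machine_of[of _ _ "JZ r (?n + 2 + code_size c2)"]) (auto simp: nth_append)
    moreover have "(step ?M ^^ time c1 x st) (config_of m x (length ?pre) st) = config_of m x (length ?pre + code_size c1) (exec c1 x st)"
      using IfZ.prems by (intro IfZ.IH(1)[of ?pre post]) auto
    ultimately show ?thesis using True st funpow_step[of "step ?M"] by (fastforce simp: add.commute add.left_commute)
  next
    case False
    let ?pre = "pre @ [JZ r (?n + 2 + code_size c2)]"
    let ?post = "JMP (?n + 2 + code_size c2 + code_size c1) # code c1 (?n + 2 + code_size c2) @ post"
    have 1: "step ?M (config_of m x ?n st) = config_of m x (length ?pre) st"
      using IfZ.prems False unfolding st
      by (intro step_machine_of[of _ _ "JZ r (?n + 2 + code_size c2)"]) (auto simp: nth_append)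
    have 2: "(step ?M ^^ time c2 x st) (config_of m x (length ?pre) st) = config_of m x (length ?pre + code_size c2) (exec c2 x st)"
      using IfZ.prems by (intro IfZ.IH(2)[of ?pre ?post]) auto
    obtain s' out' where st': "exec c2 x st = (s', out')" by (cases "exec c2 x st")
    have 3: "step ?M (config_of m x (length ?pre + code_size c2) (exec c2 x st)) = config_of m x (?n + 2 + code_size c2 + code_size c1) (exec c2 x st)"
      using IfZ.prems unfolding st'
      by (intro step_machine_of[of _ _ "JMP (?n + 2 + code_size c2 + code_size c1)"]) (auto simp: nth_append)
    have "(step ?M ^^ (time c2 x st + 1)) (config_of m x (length ?pre) st) = config_of m x (?n + 2 + code_size c2 + code_size c1) (exec c2 x st)"
      by (rule funpow_trans[OF 2]) (simp add: 3[simplified])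
    from funpow_step[OF 1 this] show ?thesis using False st by (simp add: ac_simps)
  qed
next
  case (IfB c1 c2)
  obtain s out where st: "st = (s, out)" by (cases st)
  let ?M = "machine_of m P" and ?n = "length pre"
  show ?case
  proof (cases "input_bit x (s 0)")
    case False
    let ?pre = "pre @ JB (?n + 2 + code_size c1) # code c1 (?n + 1) @ [JMP (?n + 2 + code_size c1 + code_size c2)]"
    have "step ?M (config_of m x ?n st) = config_of m x (length ?pre) st"
      using IfB.prems False unfolding st
      by (intro step_machine_of[of _ _ "JB (?n + 2 + code_size c1)"]) (auto simp: nth_append)
    moreover have "(step ?M ^^ time c2 x st) (config_of m x (length ?pre) st) = config_of m x (length ?pre + code_size c2) (exec c2 x st)"
      using IfB.prems by (intro IfB.IH(2)[of ?pre post]) auto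
    ultimately show ?thesis using False st funpow_step[of "step ?M"] by (fastforce simp: add.commute add.left_commute)
  next
    case True
    let ?pre = "pre @ [JB (?n + 2 + code_size c1)]"
    let ?post = "JMP (?n + 2 + code_size c1 + code_size c2) # code c2 (?n + 2 + code_size c1) @ post"
    have 1: "step ?M (config_of m x ?n st) = config_of m x (length ?pre) st"
      using IfB.prems True unfolding st
      by (intro step_machine_of[of _ _ "JB (?n + 2 + code_size c1)"]) (auto simp: nth_append)
    have 2: "(step ?M ^^ time c1 x st) (config_of m x (length ?pre) st) = config_of m x (length ?pre + code_size c1) (exec c1 x st)"
      using IfB.prems by (intro IfB.IH(1)[of ?pre ?post]) auto
    obtain s' out' where st': "exec c1 x st = (s', out')" by (cases "exec c1 x st")
    have 3: "step ?M (config_of m x (length ?pre + code_size c1) (exec c1 x st)) = config_of m x (?n + 2 + code_size c1 + code_size c2) (exec c1 x st)"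
      using IfB.prems unfolding st'
      by (intro step_machine_of[of _ _ "JMP (?n + 2 + code_size c1 + code_size c2)"]) (auto simp: nth_append)
    have "(step ?M ^^ (time c1 x st + 1)) (config_of m x (length ?pre) st) = config_of m x (?n + 2 + code_size c1 + code_size c2) (exec c1 x st)"
      by (rule funpow_trans[OF 2]) (simp add: 3[simplified])
    from funpow_step[OF 1 this] show ?thesis using True st by (simp add: ac_simps)
  qed
next
  case (Loop r c)
  let ?M = "machine_of m P" and ?n = "length pre"
  define body where "body = (\<lambda>st. exec c x (decr r st))"
  have iterate: "(step ?M ^^ (1 + (\<Sum>i<k. 3 + time c x (decr r ((body ^^ i) st))))) (config_of m x ?n st)
      = config_of m x (?n + 3 + code_size c) ((body ^^ k) st)" if "fst st r = k" for k st
    using that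
  proof (induction k arbitrary: st)
    case 0
    obtain s out where st: "st = (s, out)" by (cases st)
    have "step ?M (config_of m x ?n st) = config_of m x (?n + 3 + code_size c) st"
      using Loop.prems 0 unfolding st
      by (intro step_machine_of[of _ _ "JZ r (?n + 3 + code_size c)"]) (auto simp: nth_append)
    then show ?case by simp
  next
    case (Suc k)
    obtain s out where st: "st = (s, out)" by (cases st)
    let ?pre = "pre @ [JZ r (?n + 3 + code_size c), DEC r]"
    have 1: "step ?M (config_of m x ?n st) = config_of m x (Suc ?n) st"
      using Loop.prems Suc.prems unfolding st
      by (intro step_machine_of[of _ _ "JZ r (?n + 3 + code_size c)"]) (auto simp: nth_append)
    have 2: "step ?M (config_of m x (Suc ?n) st) = config_of m x (length ?pre) (decr r st)"
      using Loop.prems unfolding st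
      by (intro step_machine_of[of _ _ "DEC r"]) (auto simp: nth_append)
    have 3: "(step ?M ^^ time c x (decr r st)) (config_of m x (length ?pre) (decr r st)) = config_of m x (length ?pre + code_size c) (body st)"
      unfolding body_def using Loop.prems by (intro Loop.IH[of ?pre "JMP ?n # post"]) auto
    obtain s' out' where st': "body st = (s', out')" by (cases "body st")
    have 4: "step ?M (config_of m x (length ?pre + code_size c) (body st)) = config_of m x ?n (body st)"
      using Loop.prems unfolding st'
      by (intro step_machine_of[of _ _ "JMP ?n"]) (auto simp: nth_append)
    have "fst (body st) r = k"
      using Loop.prems Suc.prems by (simp add: body_def exec_unmodified fst_decr)
    note 5 = Suc.IH[OF this]
    have 6: "(step ?M ^^ (time c x (decr r st) + Suc (1 + (\<Sum>i<k. 3 + time c x (decr r ((body ^^ i) (body st)))))))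
       (config_of m x (length ?pre) (decr r st)) = config_of m x (?n + 3 + code_size c) ((body ^^ k) (body st))"
      by (rule funpow_trans[OF 3]) (rule funpow_step[OF 4 5])
    have eq: "1 + (\<Sum>i<Suc k. 3 + time c x (decr r ((body ^^ i) st)))
      = Suc (Suc (time c x (decr r st) + Suc (1 + (\<Sum>i<k. 3 + time c x (decr r ((body ^^ i) (body st)))))))"
      unfolding sum.lessThan_Suc_shift by (simp add: funpow_swap1)
    show ?case
      using funpow_step[OF 1 funpow_step[OF 2 6]] unfolding eq by (simp only: funpow_Suc_right comp_apply)
  qed
  show ?case using iterate[OF refl, of st] by (simp add: body_def add.commute add.left_commute)
qed

text \<open>After \<open>SCAN\<close> the input head is behind the input, so register 0 holds the
  length as well.\<close>

definition start_store :: "bool list \<Rightarrow> store" where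
  "start_store x = ((\<lambda>_. 0)(0 := length x, 1 := length x), [])"

text \<open>The \<open>length x + 2\<close> steps are one for \<open>MARK\<close>, one of
  \<open>SCAN\<close> for each input bit and one to notice the blank behind the input.\<close>

lemma computes_within_com:
  assumes c: "modified c \<subseteq> {..<m}" "loops_ok c" and m: "2 \<le> m"
    and t: "length x + 2 + time c x (start_store x) \<le> t"
  shows "computes_within (machine_of m (MARK # SCAN 1 # code c 2)) [x] (snd (exec c x (start_store x))) t"
proof -
  define P where "P = MARK # SCAN 1 # code c 2"
  let ?M = "machine_of m P"
  have 1: "step ?M (init ?M [x]) = config_of m x 1 (\<lambda>_. 0, [])"
  proof -
    define T where "T = map (\<lambda>j. (written (if j = 0 then x else []), 0::int)) [0..<m]"
    define rs where "rs = map read_tape T @ [0]"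
    have init: "init ?M [x] = (0, T @ [(written [], 0)])"
      using m by (auto simp: init_def machine_of_def T_def)
    have rs_m: "rs ! m = 0" by (simp add: rs_def T_def nth_append)
    have rs_nth: "rs ! j = written (if j = 0 then x else []) 0" if "j < m" for j
      using that by (simp add: rs_def T_def nth_append)
    have mod3: "written y z mod 3 = written y z" for y z by (simp add: written_def)
    have "step ?M (init ?M [x]) = (1, map2 act (map (action m MARK rs) [0..<Suc m]) (T @ [(written [], 0)]))"
      unfolding init by (simp add: step_def machine_of_def P_def rs_def written_def del: upt_Suc)
    also have "\<dots> = config_of m x 1 (\<lambda>_. 0, [])"
      unfolding T_def act_map2
      by (auto simp: config_of_def rs_nth rs_m mod3 reg_tape_def fun_eq_iff written_def[of "[]"])
    finally show ?thesis .
  qed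
  have scan: "(step ?M ^^ Suc k) (config_of m x 1 ((\<lambda>_. 0)(0 := length x - k, 1 := length x - k), []))
      = config_of m x 2 (start_store x)" if "k \<le> length x" for k
    using that
  proof (induction k)
    case 0
    have "step ?M (config_of m x 1 ((\<lambda>_. 0)(0 := length x, 1 := length x), [])) = config_of m x 2 ((\<lambda>_. 0)(0 := length x, 1 := length x), [])"
      using m by (intro step_machine_of[of _ _ "SCAN 1"]) (auto simp: P_def)
    then show ?case by (simp add: start_store_def fun_upd_def)
  next
    case (Suc k)
    have "step ?M (config_of m x 1 ((\<lambda>_. 0)(0 := length x - Suc k, 1 := length x - Suc k), []))
      = config_of m x 1 ((\<lambda>_. 0)(0 := length x - k, 1 := length x - k), [])"
      using m Suc.prems by (intro step_machine_of[of _ _ "SCAN 1"]) (auto simp: P_def Suc_diff_Suc)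
    then show ?case by (rule funpow_step[OF _ Suc.IH]) (use Suc.prems in simp)
  qed
  have 2: "(step ?M ^^ Suc (length x)) (config_of m x 1 (\<lambda>_. 0, [])) = config_of m x 2 (start_store x)"
  proof -
    have "((\<lambda>_. 0)(0 := length x - length x, 1 := length x - length x)) = (\<lambda>_. 0::nat)" by auto
    from scan[OF order.refl, unfolded this] show ?thesis .
  qed
  have 3: "(step ?M ^^ time c x (start_store x)) (config_of m x 2 (start_store x))
      = config_of m x (2 + code_size c) (exec c x (start_store x))"
    using code_correct[of P "[MARK, SCAN 1]" c "[]" m x "start_store x"] c m by (simp add: P_def numeral_2_eq_2)
  have halted: "(step ?M ^^ k) (config_of m x (2 + code_size c) st) = config_of m x (2 + code_size c) st" for k st
    by (induction k) (simp_all add: step_def config_of_def machine_of_def P_def)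
  have "(step ?M ^^ (Suc (Suc (length x) + (time c x (start_store x) + k)))) (init ?M [x])
      = config_of m x (2 + code_size c) (exec c x (start_store x))" for k
    by (rule funpow_step[OF 1 funpow_trans[OF 2 funpow_trans[OF 3 halted]]])
  moreover have "Suc (Suc (length x) + (time c x (start_store x) + (t - (length x + 2 + time c x (start_store x))))) = t"
    using t by simp
  ultimately have "(step ?M ^^ t) (init ?M [x]) = config_of m x (2 + code_size c) (exec c x (start_store x))"
    by metis
  then show ?thesis using m
    by (simp add: computes_within_def config_of_def machine_of_def P_def)
qed

section \<open>A language of bounded loops\<close>

datatype aexp = C nat | V nat | Add aexp aexp | Mul aexp aexp
datatype bexp = Le aexp aexp | Bit aexp aexp | Not bexp | And bexp bexp
datatype prog = Emit bool | Then prog prog (infixr ";;" 60) | If bexp prog prog | For aexp prog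

text \<open>Variables are numbered by the nesting depth of their loops. The depth \<open>d\<close> is a parameter of
  the semantics: a loop at depth \<open>d\<close> binds the variable \<open>d\<close> and keeps its counter in the variable
  \<open>d + 1\<close>. Variable 1 is the length of the input.\<close>

primrec aval :: "aexp \<Rightarrow> (nat \<Rightarrow> nat) \<Rightarrow> nat" where
  "aval (C k) s = k"
| "aval (V v) s = s v"
| "aval (Add a b) s = aval a s + aval b s"
| "aval (Mul a b) s = aval a s * aval b s"

text \<open>Subtraction is confined to \<open>Bit\<close>: the input bit belonging to column
  \<open>i\<close> of the tableau is at position \<open>i - T\<close>.\<close>

primrec bval :: "bexp \<Rightarrow> bool list \<Rightarrow> (nat \<Rightarrow> nat) \<Rightarrow> bool" where
  "bval (Le a b) x s = (aval a s \<le> aval b s)"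
| "bval (Bit a b) x s = input_bit x (aval a s - aval b s)"
| "bval (Not b) x s = (\<not> bval b x s)"
| "bval (And b c) x s = (bval b x s \<and> bval c x s)"

primrec eval :: "prog \<Rightarrow> nat \<Rightarrow> bool list \<Rightarrow> (nat \<Rightarrow> nat) \<Rightarrow> bool list" where
  "eval (Emit b) d x s = [b]"
| "eval (p ;; q) d x s = eval p d x s @ eval q d x s"
| "eval (If b p q) d x s = (if bval b x s then eval p d x s else eval q d x s)"
| "eval (For a p) d x s =
     concat (map (\<lambda>i. eval p (d + 2) x (s(d := i, d + 1 := aval a s - Suc i))) [0..<aval a s])"

primrec avars :: "aexp \<Rightarrow> nat set" where
  "avars (C k) = {}"
| "avars (V v) = {v}"
| "avars (Add a b) = avars a \<union> avars b"
| "avars (Mul a b) = avars a \<union> avars b"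

primrec bvars :: "bexp \<Rightarrow> nat set" where
  "bvars (Le a b) = avars a \<union> avars b"
| "bvars (Bit a b) = avars a \<union> avars b"
| "bvars (Not b) = bvars b"
| "bvars (And b c) = bvars b \<union> bvars c"

primrec pvars :: "prog \<Rightarrow> nat set" where
  "pvars (Emit b) = {}"
| "pvars (p ;; q) = pvars p \<union> pvars q"
| "pvars (If b p q) = bvars b \<union> pvars p \<union> pvars q"
| "pvars (For a p) = avars a \<union> pvars p"

text \<open>Reading a variable empties its register and refills it. So a loop body must not even
  read its counter \<open>d + 1\<close>, and register 0 is reserved for the input head.\<close>

primrec well_scoped :: "prog \<Rightarrow> nat \<Rightarrow> bool" where
  "well_scoped (Emit b) d \<longleftrightarrow> True"
| "well_scoped (p ;; q) d \<longleftrightarrow> well_scoped p d \<and> well_scoped q d"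
| "well_scoped (If b p q) d \<longleftrightarrow> bvars b \<subseteq> {0<..<d} \<and> well_scoped p d \<and> well_scoped q d"
| "well_scoped (For a p) d \<longleftrightarrow> avars a \<subseteq> {0<..<d} \<and> d + 1 \<notin> pvars p \<and> well_scoped p (d + 2)"

text \<open>\<open>add_aexp a r d\<close> adds the value of \<^term>\<open>a\<close> to the register \<open>r\<close>, using the registers from
  \<open>d\<close> on, which contain 0, as scratch space.\<close>

primrec add_aexp :: "aexp \<Rightarrow> nat \<Rightarrow> nat \<Rightarrow> com" where
  "add_aexp (C k) r d = (Seq (Inc r) ^^ k) Skip"
| "add_aexp (V v) r d = Seq (Loop v (Seq (Inc d) (Inc r))) (Loop d (Inc v))"
| "add_aexp (Add a b) r d = Seq (add_aexp a r d) (add_aexp b r d)"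
| "add_aexp (Mul a b) r d = Seq (add_aexp a d (d + 1)) (Loop d (add_aexp b r (d + 1)))"

text \<open>\<open>Le\<close> tests whether the truncated difference is 0. \<open>Bit\<close> moves
  the input head to the position in question and back to 0. \<open>And\<close> decrements the sum of
  two truth values once, so that only 1 + 1 remains positive.\<close>

primrec add_bexp :: "bexp \<Rightarrow> nat \<Rightarrow> nat \<Rightarrow> com" where
  "add_bexp (Le a b) r d = Seq (add_aexp a d (d + 1)) (Seq (add_aexp b (d + 1) (d + 2))
     (Seq (Loop (d + 1) (Dec d)) (Seq (IfZ d (Inc r) Skip) (Loop d Skip))))"
| "add_bexp (Bit a b) r d = Seq (add_aexp a 0 d) (Seq (add_aexp b d (d + 1))
     (Seq (Loop d (Dec 0)) (Seq (IfB (Inc r) Skip) (Loop 0 Skip))))"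
| "add_bexp (Not b) r d = Seq (add_bexp b d (d + 1)) (IfZ d (Inc r) (Dec d))"
| "add_bexp (And b c) r d = Seq (add_bexp b d (d + 1)) (Seq (add_bexp c d (d + 1))
     (Seq (Dec d) (IfZ d Skip (Seq (Dec d) (Inc r)))))"

primrec compile :: "prog \<Rightarrow> nat \<Rightarrow> com" where
  "compile (Emit b) d = Out b"
| "compile (p ;; q) d = Seq (compile p d) (compile q d)"
| "compile (If b p q) d = Seq (add_bexp b d (d + 1)) (IfZ d (compile q d) (Seq (Dec d) (compile p d)))"
| "compile (For a p) d = Seq (add_aexp a (d + 1) (d + 2))
     (Seq (Loop (d + 1) (Seq (compile p (d + 2)) (Inc d))) (Loop d Skip))"

text \<open>Instead of an invariant, the exact store \<open>I i\<close> after \<open>i\<close>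
  rounds is given; this also yields the exact running time.\<close>

lemma exec_Loop:
  assumes "fst (I 0) r = n" "\<And>i. i < n \<Longrightarrow> exec c x (decr r (I i)) = I (Suc i)"
  shows "exec (Loop r c) x (I 0) = I n"
    and "time (Loop r c) x (I 0) = 1 + (\<Sum>i<n. 3 + time c x (decr r (I i)))"
proof -
  have iter: "((\<lambda>st. exec c x (decr r st)) ^^ i) (I 0) = I i" if "i \<le> n" for i
    using that by (induction i) (use assms(2) in auto)
  then show "exec (Loop r c) x (I 0) = I n" using assms(1) by simp
  have "(\<Sum>i<n. 3 + time c x (decr r (((\<lambda>st. exec c x (decr r st)) ^^ i) (I 0)))) = (\<Sum>i<n. 3 + time c x (decr r (I i)))"
    by (rule sum.cong) (simp_all add: iter)
  then show "time (Loop r c) x (I 0) = 1 + (\<Sum>i<n. 3 + time c x (decr r (I i)))"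
    using assms(1) by simp
qed

lemma exec_Loop_Skip:
  "exec (Loop r Skip) x (s, out) = (s(r := 0), out)" "time (Loop r Skip) x (s, out) = 1 + 3 * s r"
  using exec_Loop[of "\<lambda>i. (s(r := s r - i), out)" r "s r" Skip x]
  by (simp_all add: fun_upd_idem)

lemma modified_add_aexp: "modified (add_aexp a r d) \<subseteq> insert r (avars a \<union> {d..})"
proof (induction a arbitrary: r d)
  case (C k)
  show ?case by (induction k) auto
next
  case (Mul a b)
  then show ?case
    using Mul.IH(1)[of d "d + 1"] Mul.IH(2)[of r "d + 1"] by (fastforce dest!: subsetD)
next
  case (Add a b)
  show ?case using Add.IH(1)[of r d] Add.IH(2)[of r d] by auto
qed auto

lemma modified_add_bexp: "modified (add_bexp b r d) \<subseteq> insert 0 (insert r (bvars b \<union> {d..}))"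
proof (induction b arbitrary: r d)
  case (Le a b)
  then show ?case
    using modified_add_aexp[of a d "d + 1"] modified_add_aexp[of b "d + 1" "d + 2"]
    by (fastforce dest!: subsetD)
next
  case (Bit a b)
  have "modified (add_aexp b d (d + 1)) \<subseteq> avars b \<union> {d..}"
    by (rule order_trans[OF modified_add_aexp]) auto
  then show ?case using modified_add_aexp[of a 0 d] by auto
next
  case (Not b)
  then show ?case using Not.IH[of d "d + 1"] by (fastforce dest!: subsetD)
next
  case (And b c)
  then show ?case using And.IH[of d "d + 1"] by (fastforce dest!: subsetD)
qed

lemma loops_ok_add_aexp:
  "avars a \<subseteq> {..<d} \<Longrightarrow> r < d \<Longrightarrow> r \<notin> avars a \<Longrightarrow> loops_ok (add_aexp a r d)"
proof (induction a arbitrary: r d)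
  case (C k)
  show ?case by (induction k) auto
next
  case (Mul a b)
  then have vars: "avars a \<subseteq> {..<d}" "avars b \<subseteq> {..<d}" "r \<notin> avars b" by simp_all
  then have "d \<notin> modified (add_aexp b r (d + 1))" "d \<notin> avars a" "avars a \<subseteq> {..<d + 1}" "avars b \<subseteq> {..<d + 1}"
    using modified_add_aexp[of b r "d + 1"] Mul.prems(2) by (fastforce dest!: subsetD)+
  then show ?case using Mul.IH(1)[of "d + 1" d] Mul.IH(2)[of "d + 1" r] Mul.prems vars by simp
qed auto

lemma loops_ok_add_bexp:
  "bvars b \<subseteq> {0<..<d} \<Longrightarrow> r < d \<Longrightarrow> r \<notin> bvars b \<Longrightarrow> loops_ok (add_bexp b r d)"
proof (induction b arbitrary: r d)
  case (Le a b)
  then have "avars a \<subseteq> {..<d + 1}" "d \<notin> avars a" "avars b \<subseteq> {..<d + 2}" "d + 1 \<notin> avars b"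
    by (fastforce dest!: subsetD)+
  then show ?case
    using loops_ok_add_aexp[of a "d + 1" d] loops_ok_add_aexp[of b "d + 2" "d + 1"] by simp
next
  case (Bit a b)
  then have "avars a \<subseteq> {..<d}" "0 \<notin> avars a" "avars b \<subseteq> {..<d + 1}" "d \<notin> avars b"
    by (fastforce dest!: subsetD)+
  then show ?case using loops_ok_add_aexp[of a d 0] loops_ok_add_aexp[of b "d + 1" d] Bit.prems(2) by simp
next
  case (Not b)
  then have "bvars b \<subseteq> {0<..<d + 1}" "d \<notin> bvars b" by (fastforce dest!: subsetD)+
  then show ?case using Not.IH[of "d + 1" d] by simp
next
  case (And b c)
  then have "bvars b \<subseteq> {0<..<d + 1}" "d \<notin> bvars b" "bvars c \<subseteq> {0<..<d + 1}" "d \<notin> bvars c"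
    by (fastforce dest!: subsetD)+
  then show ?case using And.IH(1)[of "d + 1" d] And.IH(2)[of "d + 1" d] by simp
qed

lemma modified_compile: "modified (compile p d) \<subseteq> insert 0 (pvars p \<union> {d..})"
proof (induction p arbitrary: d)
  case (Then p q)
  show ?case using Then.IH[of d] by auto
next
  case (If b p q)
  have "modified (add_bexp b d (d + 1)) \<subseteq> insert 0 (bvars b \<union> {d..})"
    by (rule order_trans[OF modified_add_bexp]) auto
  then show ?case using If.IH(1)[of d] If.IH(2)[of d] by auto
next
  case (For a p)
  have "modified (add_aexp a (d + 1) (d + 2)) \<subseteq> insert 0 (avars a \<union> {d..})"
    by (rule order_trans[OF modified_add_aexp]) auto
  moreover have "modified (compile p (d + 2)) \<subseteq> insert 0 (pvars p \<union> {d..})"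
    by (rule order_trans[OF For.IH]) auto
  ultimately show ?case by auto
qed auto

lemma loops_ok_compile: "0 < d \<Longrightarrow> well_scoped p d \<Longrightarrow> loops_ok (compile p d)"
proof (induction p arbitrary: d)
  case (If b p q)
  then have "bvars b \<subseteq> {0<..<d + 1}" "d \<notin> bvars b" by (fastforce dest!: subsetD)+
  then show ?case using If loops_ok_add_bexp[of b "d + 1" d] by simp
next
  case (For a p)
  then have a: "avars a \<subseteq> {..<d + 2}" "d + 1 \<notin> avars a" by (fastforce dest!: subsetD)+
  have "d + 1 \<notin> modified (compile p (d + 2))"
    using For.prems modified_compile[of p "d + 2"] by (fastforce dest!: subsetD)
  then show ?case using For loops_ok_add_aexp[OF a(1) _ a(2)] by simp
qed auto

lemma aval_cong: "(\<And>v. v \<in> avars a \<Longrightarrow> s v = s' v) \<Longrightarrow> aval a s = aval a s'"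
  by (induction a) auto

lemma bval_cong: "(\<And>v. v \<in> bvars b \<Longrightarrow> s v = s' v) \<Longrightarrow> bval b x s = bval b x s'"
  by (induction b) (auto cong: aval_cong simp: aval_cong[of _ s s'])

section \<open>Polynomial bounds on values and running times\<close>

primrec abound :: "aexp \<Rightarrow> nat \<Rightarrow> nat" where
  "abound (C k) B = k"
| "abound (V v) B = B"
| "abound (Add a b) B = abound a B + abound b B"
| "abound (Mul a b) B = abound a B * abound b B"

primrec atime :: "aexp \<Rightarrow> nat \<Rightarrow> nat" where
  "atime (C k) B = k"
| "atime (V v) B = 2 + 9 * B"
| "atime (Add a b) B = atime a B + atime b B"
| "atime (Mul a b) B = atime a B + 1 + abound a B * (3 + atime b B)"

primrec btime :: "bexp \<Rightarrow> nat \<Rightarrow> nat" where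
  "btime (Le a b) B = atime a B + atime b B + 5 + 4 * abound b B + 3 * abound a B"
| "btime (Bit a b) B = atime a B + atime b B + 5 + 4 * abound b B + 3 * abound a B"
| "btime (Not b) B = btime b B + 3"
| "btime (And b c) B = btime b B + btime c B + 5"

text \<open>Per round of \<open>For\<close>, 4 steps go to the loop and the increment of
  \<open>d\<close>, and 3 to clearing \<open>d\<close> afterwards. The loop variable may exceed
  \<open>B\<close>, so the body is charged for the larger bound
  \<open>B + abound a B\<close>.\<close>

primrec ptime :: "prog \<Rightarrow> nat \<Rightarrow> nat" where
  "ptime (Emit b) B = 1"
| "ptime (p ;; q) B = ptime p B + ptime q B"
| "ptime (If b p q) B = btime b B + 3 + ptime p B + ptime q B"
| "ptime (For a p) B = atime a B + 2 + abound a B * (7 + ptime p (B + abound a B))"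

lemma aval_le_abound: "(\<And>v. v \<in> avars a \<Longrightarrow> s v \<le> B) \<Longrightarrow> aval a s \<le> abound a B"
  by (induction a) (auto intro: add_mono mult_mono)

lemma exec_add_aexp:
  assumes "avars a \<subseteq> {..<d}" "r < d" "r \<notin> avars a" "\<And>j. d \<le> j \<Longrightarrow> s j = 0"
    "\<And>v. v \<in> avars a \<Longrightarrow> s v \<le> B"
  shows "exec (add_aexp a r d) x (s, out) = (s(r := s r + aval a s), out) \<and>
    time (add_aexp a r d) x (s, out) \<le> atime a B"
  using assms
proof (induction a arbitrary: r d s)
  case (C k)
  have "exec ((Seq (Inc r) ^^ k) Skip) x (s, out) = (s(r := s r + k), out) \<and>
    time ((Seq (Inc r) ^^ k) Skip) x (s, out) = k" for s
    by (induction k arbitrary: s) auto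
  from this[of s] show ?case unfolding add_aexp.simps aval.simps atime.simps by auto
next
  case (V v)
  define k where "k = s v"
  have ne: "v \<noteq> d" "r \<noteq> d" "v \<noteq> r" "s d = 0" using V by auto
  \<comment> \<open>The first loop moves the contents of \<open>v\<close> to both \<open>d\<close>
    and \<open>r\<close>; the second one, described by \<open>J\<close>, moves them back from
    \<open>d\<close>.\<close>
  define I where "I i = (s(v := k - i, d := i, r := s r + i), out)" for i
  have I0: "I 0 = (s, out)" using ne by (auto simp: I_def k_def)
  have step: "exec (Seq (Inc d) (Inc r)) x (decr v (I i)) = I (Suc i)" if "i < k" for i
    using that ne by (auto simp: I_def fun_eq_iff)
  have count: "fst (I 0) v = k" by (simp add: I0 k_def)
  note L1 = exec_Loop[OF count step, unfolded I0]
  define J where "J i = (s(v := i, d := k - i, r := s r + k), out)" for i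
  have J0: "J 0 = I k" by (simp add: J_def I_def)
  have step': "exec (Inc v) x (decr d (J i)) = J (Suc i)" if "i < k" for i
    using that ne by (auto simp: J_def fun_eq_iff)
  have count': "fst (J 0) d = k" using ne by (simp add: J_def)
  note L2 = exec_Loop[OF count' step', unfolded J0]
  have "J k = (s(r := s r + k), out)" using ne by (auto simp: J_def k_def fun_eq_iff)
  moreover have "k \<le> B" using V by (simp add: k_def)
  ultimately show ?case using L1 L2
    unfolding add_aexp.simps exec.simps(5) time.simps(5) aval.simps atime.simps
    by (simp add: k_def) (simp add: fun_eq_iff)?
next
  case (Add a b)
  have a: "exec (add_aexp a r d) x (s, out) = (s(r := s r + aval a s), out)" "time (add_aexp a r d) x (s, out) \<le> atime a B"
    using Add.IH(1)[of d r s] Add.prems by auto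
  let ?s = "s(r := s r + aval a s)"
  have "exec (add_aexp b r d) x (?s, out) = (?s(r := ?s r + aval b ?s), out) \<and> time (add_aexp b r d) x (?s, out) \<le> atime b B"
    using Add.prems by (intro Add.IH(2)) auto
  moreover have "aval b ?s = aval b s" using Add.prems(3) by (intro aval_cong) auto
  ultimately show ?case using a by (auto simp: fun_eq_iff)
next
  case (Mul a b)
  have d: "s d = 0" "d \<notin> avars a" "d \<notin> avars b" "r \<noteq> d" using Mul.prems by auto
  define m where "m = aval a s"
  define n where "n = aval b s"
  have "exec (add_aexp a d (d + 1)) x (s, out) = (s(d := s d + aval a s), out) \<and> time (add_aexp a d (d + 1)) x (s, out) \<le> atime a B"
    using Mul.prems d by (intro Mul.IH(1)) auto
  then have a: "exec (add_aexp a d (d + 1)) x (s, out) = (s(d := m), out)" "time (add_aexp a d (d + 1)) x (s, out) \<le> atime a B"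
    using d by (simp_all add: m_def)
  define I where "I i = (s(d := m - i, r := s r + i * n), out)" for i
  have b: "exec (add_aexp b r (d + 1)) x (decr d (I i)) = I (Suc i) \<and> time (add_aexp b r (d + 1)) x (decr d (I i)) \<le> atime b B"
    if "i < m" for i
  proof -
    define s' where "s' = s(d := m - Suc i, r := s r + i * n)"
    have dec: "decr d (I i) = (s', out)" using d by (auto simp: I_def s'_def fun_eq_iff)
    have "aval b s' = n" unfolding n_def s'_def using d Mul.prems(3) by (intro aval_cong) auto
    moreover have "exec (add_aexp b r (d + 1)) x (s', out) = (s'(r := s' r + aval b s'), out) \<and> time (add_aexp b r (d + 1)) x (s', out) \<le> atime b B"
    proof (rule Mul.IH(2))
      show "s' v \<le> B" if "v \<in> avars b" for v
      proof -
        have "v \<noteq> d" "v \<noteq> r" using that d Mul.prems(3) by auto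
        then show ?thesis using Mul.prems(5) that by (simp add: s'_def)
      qed
      show "s' j = 0" if "d + 1 \<le> j" for j
        using that Mul.prems(2,4) by (simp add: s'_def)
    qed (use Mul.prems in auto)
    ultimately show ?thesis unfolding dec by (auto simp: I_def s'_def fun_eq_iff)
  qed
  have I0: "I 0 = (s(d := m), out)" using d by (auto simp: I_def fun_eq_iff)
  have count: "fst (I 0) d = m" by (simp add: I0)
  have step: "exec (add_aexp b r (d + 1)) x (decr d (I i)) = I (Suc i)" if "i < m" for i
    using b that by blast
  note L = exec_Loop[OF count step, unfolded I0]
  have "(\<Sum>i<m. 3 + time (add_aexp b r (d + 1)) x (decr d (I i))) \<le> of_nat (card {..<m}) * (3 + atime b B)"
    using b by (intro sum_bounded_above) auto
  then have "(\<Sum>i<m. 3 + time (add_aexp b r (d + 1)) x (decr d (I i))) \<le> m * (3 + atime b B)"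
    by (simp only: card_lessThan of_nat_id)
  moreover have "m * (3 + atime b B) \<le> abound a B * (3 + atime b B)"
    using aval_le_abound[of a s B] Mul.prems(5) by (simp add: m_def)
  ultimately have 2: "time (Loop d (add_aexp b r (d + 1))) x (s(d := m), out) \<le> 1 + abound a B * (3 + atime b B)"
    using L(2) by linarith
  moreover have "I m = (s(r := s r + m * n), out)" using d by (auto simp: I_def fun_eq_iff)
  ultimately show ?case using a 2 L(1) unfolding m_def[symmetric] n_def[symmetric]
    by (simp only: add_aexp.simps exec.simps(5) time.simps(5) aval.simps atime.simps
        m_def[symmetric] n_def[symmetric]) (auto simp: fun_eq_iff)
qed

lemma exec_add_bexp:
  assumes "bvars b \<subseteq> {0<..<d}" "0 < r" "r < d" "r \<notin> bvars b" "\<And>j. d \<le> j \<Longrightarrow> s j = 0" "s 0 = 0"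
    "\<And>v. v \<in> bvars b \<Longrightarrow> s v \<le> B"
  shows "exec (add_bexp b r d) x (s, out) = (s(r := s r + of_bool (bval b x s)), out) \<and>
    time (add_bexp b r d) x (s, out) \<le> btime b B"
  using assms
proof (induction b arbitrary: r d s)
  case (Le a b)
  define m where "m = aval a s"
  define n where "n = aval b s"
  have vars: "avars a \<subseteq> {..<d + 1}" "d \<notin> avars a" "avars b \<subseteq> {..<d + 2}" "d \<notin> avars b" "d + 1 \<notin> avars b"
    using Le.prems(1) by (fastforce dest!: subsetD)+
  have d: "s d = 0" "s (d + 1) = 0" "r \<noteq> d" "r \<noteq> d + 1" using Le.prems by auto
  have mn: "m \<le> abound a B" "n \<le> abound b B"
    using aval_le_abound[of a s B] aval_le_abound[of b s B] Le.prems(7) by (auto simp: m_def n_def)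
  define s1 where "s1 = s(d := m)"
  define s2 where "s2 = s(d := m, d + 1 := n)"
  define s3 where "s3 = s(d := m - n, d + 1 := 0)"
  have "exec (add_aexp a d (d + 1)) x (s, out) = (s(d := s d + aval a s), out) \<and> time (add_aexp a d (d + 1)) x (s, out) \<le> atime a B"
    using Le.prems vars by (intro exec_add_aexp) auto
  then have 1: "exec (add_aexp a d (d + 1)) x (s, out) = (s1, out)" "time (add_aexp a d (d + 1)) x (s, out) \<le> atime a B"
    using d by (simp_all add: m_def s1_def)
  have s1v: "s1 v = s v" if "v \<in> avars b" for v using that vars by (auto simp: s1_def)
  have "exec (add_aexp b (d + 1) (d + 2)) x (s1, out) = (s1(d + 1 := s1 (d + 1) + aval b s1), out) \<and> time (add_aexp b (d + 1) (d + 2)) x (s1, out) \<le> atime b B"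
  proof (rule exec_add_aexp)
    show "s1 v \<le> B" if "v \<in> avars b" for v using that s1v Le.prems(7) by auto
    show "s1 j = 0" if "d + 2 \<le> j" for j using that Le.prems(5) by (auto simp: s1_def)
  qed (use vars in auto)
  moreover have "aval b s1 = n" unfolding n_def using s1v by (intro aval_cong)
  ultimately have 2: "exec (add_aexp b (d + 1) (d + 2)) x (s1, out) = (s2, out)" "time (add_aexp b (d + 1) (d + 2)) x (s1, out) \<le> atime b B"
    using d by (auto simp: s1_def s2_def)
  define I where "I i = (s(d := m - i, d + 1 := n - i), out)" for i
  have I0: "I 0 = (s2, out)" by (simp add: I_def s2_def)
  have count: "fst (I 0) (d + 1) = n" by (simp add: I_def)
  have step: "exec (Dec d) x (decr (d + 1) (I i)) = I (Suc i)" if "i < n" for i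
    by (auto simp: I_def fun_eq_iff)
  note L = exec_Loop[OF count step, unfolded I0]
  have In: "I n = (s3, out)" by (simp add: I_def s3_def)
  have 3: "exec (Loop (d + 1) (Dec d)) x (s2, out) = (s3, out)" "time (Loop (d + 1) (Dec d)) x (s2, out) \<le> 1 + 4 * abound b B"
    using L mn unfolding In by simp_all
  define s4 where "s4 = s3(r := s r + of_bool (m \<le> n))"
  have 4: "exec (IfZ d (Inc r) Skip) x (s3, out) = (s4, out)" "time (IfZ d (Inc r) Skip) x (s3, out) \<le> 2"
    using d by (auto simp: s3_def s4_def fun_eq_iff)
  have 5: "exec (Loop d Skip) x (s4, out) = (s(r := s r + of_bool (m \<le> n)), out)" "time (Loop d Skip) x (s4, out) \<le> 1 + 3 * abound a B"
    using d mn unfolding exec_Loop_Skip by (auto simp: s3_def s4_def fun_eq_iff)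
  show ?case
    using 1 2 3 4 5 unfolding add_bexp.simps exec.simps(5) time.simps(5) btime.simps bval.simps
      m_def[symmetric] n_def[symmetric] by (simp del: exec.simps time.simps) (auto simp: fun_eq_iff)?
next
  case (Bit a b)
  define m where "m = aval a s"
  define n where "n = aval b s"
  have vars: "avars a \<subseteq> {..<d}" "0 \<notin> avars a" "avars b \<subseteq> {..<d + 1}" "d \<notin> avars b" "0 \<notin> avars b"
    using Bit.prems(1) by (fastforce dest!: subsetD)+
  have d: "s d = 0" "r \<noteq> d" "d \<noteq> 0" using Bit.prems by auto
  have mn: "m \<le> abound a B" "n \<le> abound b B"
    using aval_le_abound[of a s B] aval_le_abound[of b s B] Bit.prems(7) by (auto simp: m_def n_def)
  define s1 where "s1 = s(0 := m)"
  define s2 where "s2 = s(0 := m, d := n)"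
  define s3 where "s3 = s(0 := m - n)"
  have "exec (add_aexp a 0 d) x (s, out) = (s(0 := s 0 + aval a s), out) \<and> time (add_aexp a 0 d) x (s, out) \<le> atime a B"
    using Bit.prems vars by (intro exec_add_aexp) auto
  then have 1: "exec (add_aexp a 0 d) x (s, out) = (s1, out)" "time (add_aexp a 0 d) x (s, out) \<le> atime a B"
    using Bit.prems(6) by (simp_all add: m_def s1_def)
  have s1v: "s1 v = s v" if "v \<in> avars b" for v
  proof -
    have "v \<noteq> 0" using that vars(5) by metis
    then show ?thesis by (simp add: s1_def)
  qed
  have "exec (add_aexp b d (d + 1)) x (s1, out) = (s1(d := s1 d + aval b s1), out) \<and> time (add_aexp b d (d + 1)) x (s1, out) \<le> atime b B"
  proof (rule exec_add_aexp)
    show "s1 v \<le> B" if "v \<in> avars b" for v using that s1v Bit.prems(7) by auto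
    show "s1 j = 0" if "d + 1 \<le> j" for j using that Bit.prems(5) by (auto simp: s1_def)
  qed (use vars in auto)
  moreover have "aval b s1 = n" unfolding n_def using s1v by (intro aval_cong)
  ultimately have 2: "exec (add_aexp b d (d + 1)) x (s1, out) = (s2, out)" "time (add_aexp b d (d + 1)) x (s1, out) \<le> atime b B"
    using d by (auto simp: s1_def s2_def)
  define I where "I i = (s(0 := m - i, d := n - i), out)" for i
  have I0: "I 0 = (s2, out)" by (simp add: I_def s2_def)
  have count: "fst (I 0) d = n" by (simp add: I_def)
  have step: "exec (Dec 0) x (decr d (I i)) = I (Suc i)" if "i < n" for i
    using d by (auto simp: I_def fun_eq_iff)
  note L = exec_Loop[OF count step, unfolded I0]
  have In: "I n = (s3, out)" using d by (auto simp: I_def s3_def fun_eq_iff)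
  have 3: "exec (Loop d (Dec 0)) x (s2, out) = (s3, out)" "time (Loop d (Dec 0)) x (s2, out) \<le> 1 + 4 * abound b B"
    using L mn unfolding In by simp_all
  define s4 where "s4 = s(0 := m - n, r := s r + of_bool (input_bit x (m - n)))"
  have 4: "exec (IfB (Inc r) Skip) x (s3, out) = (s4, out)" "time (IfB (Inc r) Skip) x (s3, out) \<le> 3"
    using Bit.prems(2) by (auto simp: s3_def s4_def fun_eq_iff)
  have 5: "exec (Loop 0 Skip) x (s4, out) = (s(r := s r + of_bool (input_bit x (m - n))), out)" "time (Loop 0 Skip) x (s4, out) \<le> 1 + 3 * abound a B"
    using mn Bit.prems unfolding exec_Loop_Skip by (auto simp: s4_def fun_eq_iff)
  show ?case
    using 1 2 3 4 5 unfolding add_bexp.simps exec.simps(5) time.simps(5) btime.simps bval.simps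
      m_def[symmetric] n_def[symmetric] by (simp del: exec.simps time.simps) (auto simp: fun_eq_iff)?
next
  case (Not b)
  have "exec (add_bexp b d (d + 1)) x (s, out) = (s(d := s d + of_bool (bval b x s)), out) \<and> time (add_bexp b d (d + 1)) x (s, out) \<le> btime b B"
    using Not.prems by (intro Not.IH) (auto dest!: subsetD)
  moreover have "s d = 0" "r \<noteq> d" using Not.prems by auto
  ultimately show ?case by (auto simp: fun_eq_iff fun_upd_idem)
next
  case (And b c)
  have d: "s d = 0" "r \<noteq> d" "d \<notin> bvars c" using And.prems by (auto dest!: subsetD)
  have "exec (add_bexp b d (d + 1)) x (s, out) = (s(d := s d + of_bool (bval b x s)), out) \<and> time (add_bexp b d (d + 1)) x (s, out) \<le> btime b B"
    using And.prems by (intro And.IH) (auto dest!: subsetD)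
  moreover define s1 where "s1 = s(d := of_bool (bval b x s))"
  ultimately have 1: "exec (add_bexp b d (d + 1)) x (s, out) = (s1, out)" "time (add_bexp b d (d + 1)) x (s, out) \<le> btime b B"
    using d by simp_all
  have s1v: "s1 v = s v" if "v \<noteq> d" for v using that by (simp add: s1_def)
  have "exec (add_bexp c d (d + 1)) x (s1, out) = (s1(d := s1 d + of_bool (bval c x s1)), out) \<and> time (add_bexp c d (d + 1)) x (s1, out) \<le> btime c B"
  proof (rule And.IH(2))
    show "s1 v \<le> B" if "v \<in> bvars c" for v
      using that d s1v And.prems(7) by (cases "v = d") auto
    show "s1 j = 0" if "d + 1 \<le> j" for j using that s1v And.prems(5) by simp
    show "s1 0 = 0" using And.prems(2,3,6) s1v by simp
  qed (use And.prems in \<open>auto dest!: subsetD\<close>)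
  moreover have "bval c x s1 = bval c x s"
  proof (rule bval_cong)
    fix v assume "v \<in> bvars c"
    then have "v \<noteq> d" using d by auto
    then show "s1 v = s v" by (rule s1v)
  qed
  ultimately have 2: "exec (add_bexp c d (d + 1)) x (s1, out) = (s(d := of_bool (bval b x s) + of_bool (bval c x s)), out)"
    "time (add_bexp c d (d + 1)) x (s1, out) \<le> btime c B"
    by (simp_all add: s1_def)
  show ?case using 1 2 d by (auto simp: fun_eq_iff)
qed

text \<open>Every program restores all registers. This allows its repetition in a loop and the reuse
  of the scratch registers from \<open>d\<close> on.\<close>

lemma exec_compile:
  assumes "0 < d" "well_scoped p d" "\<And>j. d \<le> j \<Longrightarrow> s j = 0" "s 0 = 0" "\<And>j. s j \<le> B"
  shows "exec (compile p d) x (s, out) = (s, out @ eval p d x s) \<and>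
    time (compile p d) x (s, out) \<le> ptime p B"
  using assms
proof (induction p arbitrary: d s out B)
  case (Emit b)
  show ?case by simp
next
  case (Then p q)
  have "exec (compile p d) x (s, out) = (s, out @ eval p d x s) \<and> time (compile p d) x (s, out) \<le> ptime p B"
    "exec (compile q d) x (s, out @ eval p d x s) = (s, (out @ eval p d x s) @ eval q d x s) \<and>
     time (compile q d) x (s, out @ eval p d x s) \<le> ptime q B"
    using Then.IH(1)[of d s B out] Then.IH(2)[of d s B "out @ eval p d x s"] Then.prems by simp_all
  then show ?case by simp
next
  case (If b p q)
  have d: "s d = 0" using If.prems by simp
  have "exec (add_bexp b d (d + 1)) x (s, out) = (s(d := s d + of_bool (bval b x s)), out) \<and> time (add_bexp b d (d + 1)) x (s, out) \<le> btime b B"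
    using If.prems by (intro exec_add_bexp) (auto dest!: subsetD)
  then have b: "exec (add_bexp b d (d + 1)) x (s, out) = (s(d := of_bool (bval b x s)), out)" "time (add_bexp b d (d + 1)) x (s, out) \<le> btime b B"
    using d by simp_all
  have p: "exec (compile p d) x (s, out) = (s, out @ eval p d x s)" "time (compile p d) x (s, out) \<le> ptime p B"
    and q: "exec (compile q d) x (s, out) = (s, out @ eval q d x s)" "time (compile q d) x (s, out) \<le> ptime q B"
    using If.IH(1)[of d s B out] If.IH(2)[of d s B out] If.prems by simp_all
  show ?case using b p q d by (cases "bval b x s") (simp_all add: fun_upd_idem)
next
  case (For a p)
  define n where "n = aval a s"
  define f where "f i = eval p (d + 2) x (s(d := i, d + 1 := n - Suc i))" for i
  define B' where "B' = B + abound a B"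
  have d: "s d = 0" "s (d + 1) = 0" "d + 1 \<notin> avars a" using For.prems by (auto dest!: subsetD)
  have n: "n \<le> abound a B" using aval_le_abound[of a s B] For.prems(5) by (simp add: n_def)
  have "exec (add_aexp a (d + 1) (d + 2)) x (s, out) = (s(d + 1 := s (d + 1) + aval a s), out) \<and> time (add_aexp a (d + 1) (d + 2)) x (s, out) \<le> atime a B"
    using For.prems by (intro exec_add_aexp) (auto dest!: subsetD)
  then have 1: "exec (add_aexp a (d + 1) (d + 2)) x (s, out) = (s(d + 1 := n), out)" "time (add_aexp a (d + 1) (d + 2)) x (s, out) \<le> atime a B"
    using d by (simp_all add: n_def)
  define I where "I i = (s(d := i, d + 1 := n - i), out @ concat (map f [0..<i]))" for i
  have I0: "I 0 = (s(d + 1 := n), out)" using d by (simp add: I_def fun_upd_idem)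
  have body: "exec (Seq (compile p (d + 2)) (Inc d)) x (decr (d + 1) (I i)) = I (Suc i) \<and>
      time (Seq (compile p (d + 2)) (Inc d)) x (decr (d + 1) (I i)) \<le> ptime p B' + 1" if i: "i < n" for i
  proof -
    define s' where "s' = s(d := i, d + 1 := n - Suc i)"
    define out' where "out' = out @ concat (map f [0..<i])"
    have dec: "decr (d + 1) (I i) = (s', out')" by (auto simp: I_def s'_def out'_def fun_eq_iff)
    have "exec (compile p (d + 2)) x (s', out') = (s', out' @ eval p (d + 2) x s') \<and> time (compile p (d + 2)) x (s', out') \<le> ptime p B'"
    proof (rule For.IH)
      show "s' j \<le> B'" for j
        using For.prems(5)[of j] i n by (auto simp: s'_def B'_def)
    qed (use For.prems in \<open>auto simp: s'_def\<close>)
    then show ?thesis unfolding dec by (auto simp: I_def s'_def out'_def f_def fun_eq_iff)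
  qed
  have count: "fst (I 0) (d + 1) = n" by (simp add: I0)
  have step: "exec (Seq (compile p (d + 2)) (Inc d)) x (decr (d + 1) (I i)) = I (Suc i)" if "i < n" for i
    using body that by blast
  note L = exec_Loop[of I "d + 1" n "Seq (compile p (d + 2)) (Inc d)" x, OF count step, unfolded I0]
  have "(\<Sum>i<n. 3 + time (Seq (compile p (d + 2)) (Inc d)) x (decr (d + 1) (I i))) \<le> of_nat (card {..<n}) * (4 + ptime p B')"
    using body by (intro sum_bounded_above) fastforce
  then have "(\<Sum>i<n. 3 + time (Seq (compile p (d + 2)) (Inc d)) x (decr (d + 1) (I i))) \<le> n * (4 + ptime p B')"
    by (simp only: card_lessThan of_nat_id)
  moreover have "n * (4 + ptime p B') \<le> abound a B * (4 + ptime p B')" using n by simp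
  ultimately have 2: "time (Loop (d + 1) (Seq (compile p (d + 2)) (Inc d))) x (s(d + 1 := n), out) \<le> 1 + abound a B * (4 + ptime p B')"
    using L(2) by linarith
  have In: "I n = (s(d := n, d + 1 := 0), out @ eval (For a p) d x s)"
    by (simp add: I_def f_def[abs_def] n_def)
  have 3: "exec (Loop d Skip) x (I n) = (s, out @ eval (For a p) d x s)" "time (Loop d Skip) x (I n) \<le> 1 + 3 * abound a B"
    using d n unfolding In exec_Loop_Skip by (auto simp: fun_eq_iff)
  have "exec (compile (For a p) d) x (s, out) = (s, out @ eval (For a p) d x s)"
    using 1(1) L(1) 3(1) unfolding compile.simps exec.simps(5) by metis
  moreover have "time (compile (For a p) d) x (s, out)
    \<le> atime a B + ((1 + abound a B * (4 + ptime p B')) + (1 + 3 * abound a B))"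
    using 1 2 3(2) L(1) by (simp only: compile.simps time.simps(5))
  moreover have "\<dots> = ptime (For a p) B" by (simp add: B'_def algebra_simps)
  ultimately show ?case by simp
qed

definition poly_bounded :: "(nat \<Rightarrow> nat) \<Rightarrow> bool" where
  "poly_bounded f \<longleftrightarrow> (\<exists>q :: nat poly. \<forall>B. f B \<le> poly q B)"

lemma poly_mono: "B \<le> B' \<Longrightarrow> poly q B \<le> poly q B'" for q :: "nat poly"
  by (induction q) (auto intro: add_mono mult_mono)

lemma poly_bounded_const: "poly_bounded (\<lambda>B. k)"
  unfolding poly_bounded_def by (rule exI[of _ "[:k:]"]) simp

lemma poly_bounded_id: "poly_bounded (\<lambda>B. B)"
  unfolding poly_bounded_def by (rule exI[of _ "[:0, 1:]"]) simp

lemma poly_bounded_add: "poly_bounded f \<Longrightarrow> poly_bounded g \<Longrightarrow> poly_bounded (\<lambda>B. f B + g B)"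
  unfolding poly_bounded_def by (metis add_mono poly_add)

lemma poly_bounded_mult: "poly_bounded f \<Longrightarrow> poly_bounded g \<Longrightarrow> poly_bounded (\<lambda>B. f B * g B)"
  unfolding poly_bounded_def by (metis mult_mono poly_mult zero_le)

lemma poly_bounded_comp: "poly_bounded f \<Longrightarrow> poly_bounded g \<Longrightarrow> poly_bounded (\<lambda>B. f (g B))"
  unfolding poly_bounded_def by (metis order_trans poly_mono poly_pcompose)

lemmas poly_bounded_intros = poly_bounded_const poly_bounded_id poly_bounded_add poly_bounded_mult

lemma poly_bounded_abound: "poly_bounded (\<lambda>B. abound a B)"
  by (induction a) (simp_all only: abound.simps poly_bounded_intros)

lemma poly_bounded_atime: "poly_bounded (\<lambda>B. atime a B)"
  by (induction a) (simp_all only: atime.simps poly_bounded_intros poly_bounded_abound)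

lemma poly_bounded_btime: "poly_bounded (\<lambda>B. btime b B)"
  by (induction b) (simp_all only: btime.simps poly_bounded_intros poly_bounded_abound poly_bounded_atime)

lemma poly_bounded_ptime: "poly_bounded (\<lambda>B. ptime p B)"
proof (induction p)
  case (For a p)
  have "poly_bounded (\<lambda>B. ptime p (B + abound a B))"
    by (rule poly_bounded_comp[OF For]) (intro poly_bounded_intros poly_bounded_abound)
  then show ?case
    by (simp only: ptime.simps poly_bounded_intros poly_bounded_abound poly_bounded_atime)
qed (simp_all only: ptime.simps poly_bounded_intros poly_bounded_btime)

lemma poly_time_eval:
  assumes "well_scoped p 2"
  shows "poly_time (\<lambda>x. eval p 2 x ((\<lambda>_. 0)(1 := length x)))"
proof -
  \<comment> \<open>The loop brings the input head back to position 0, as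
    \<open>exec_compile\<close> requires.\<close>
  define c where "c = Seq (Loop 0 Skip) (compile p 2)"
  have ok: "loops_ok c" using loops_ok_compile[of 2 p] assms by (simp add: c_def)
  define m where "m = Suc (Suc (Max (insert 0 (modified c))))"
  have m: "modified c \<subseteq> {..<m}" "2 \<le> m"
    using Max_ge[of "insert 0 (modified c)"] finite_modified[of c] by (auto simp: m_def less_Suc_eq_le le_SucI)
  obtain q :: "nat poly" where q: "\<And>B. ptime p B \<le> poly q B"
    using poly_bounded_ptime[of p] by (auto simp: poly_bounded_def)
  \<comment> \<open>\<open>4 * n + 3\<close> is the sum of \<open>n + 2\<close> for marking and
    scanning and \<open>3 * n + 1\<close> for the return of the head.\<close>
  define r where "r = [:0, 4:] + [:3:] + q"
  have "computes_within (machine_of m (MARK # SCAN 1 # code c 2)) [x]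
      (eval p 2 x ((\<lambda>_. 0)(1 := length x))) (poly r (length x))" for x
  proof -
    define s :: "nat \<Rightarrow> nat" where "s = (\<lambda>_. 0)(1 := length x)"
    have 1: "exec (Loop 0 Skip) x (start_store x) = (s, [])" "time (Loop 0 Skip) x (start_store x) = 1 + 3 * length x"
      unfolding start_store_def exec_Loop_Skip by (auto simp: s_def fun_eq_iff)
    have 2: "exec (compile p 2) x (s, []) = (s, [] @ eval p 2 x s) \<and> time (compile p 2) x (s, []) \<le> ptime p (length x)"
      by (rule exec_compile) (use assms in \<open>auto simp: s_def\<close>)
    have "exec c x (start_store x) = (s, eval p 2 x s)"
      using 1 2 unfolding c_def exec.simps(5) by simp
    moreover have "time c x (start_store x) \<le> 1 + 3 * length x + ptime p (length x)"
      using 1 2 unfolding c_def time.simps(5) by simp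
    then have "length x + 2 + time c x (start_store x) \<le> poly r (length x)"
      using q[of "length x"] by (simp add: r_def)
    ultimately show ?thesis
      using computes_within_com[OF m(1) ok m(2), of x "poly r (length x)"] by (simp add: s_def)
  qed
  then show ?thesis unfolding poly_time_def using turing_machine_machine_of by blast
qed

section \<open>The reduction as a program\<close>

definition Nop :: prog where "Nop = For (C 0) (Emit True)"

primrec seqs :: "prog list \<Rightarrow> prog" where
  "seqs [] = Nop"
| "seqs (p # ps) = p ;; seqs ps"

definition emit_nat :: "aexp \<Rightarrow> prog" where
  "emit_nat a = For a (Emit True) ;; Emit False"

lemma eval_Nop [simp]: "eval Nop d x s = []"
  by (simp add: Nop_def)

lemma eval_seqs [simp]: "eval (seqs ps) d x s = concat (map (\<lambda>p. eval p d x s) ps)"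
  by (induction ps) auto

lemma eval_emit_nat [simp]: "eval (emit_nat a) d x s = enc_nat (aval a s)"
proof -
  have "concat (map (\<lambda>i. [True]) [0..<n]) = replicate n True" for n
    by (induction n) (simp_all add: replicate_append_same)
  then show ?thesis by (simp add: emit_nat_def enc_nat_def)
qed

definition bconst :: "bool \<Rightarrow> bexp" where
  "bconst b = (if b then Le (C 0) (C 0) else Not (Le (C 0) (C 0)))"

definition Or :: "bexp \<Rightarrow> bexp \<Rightarrow> bexp" where
  "Or a b = Not (And (Not a) (Not b))"

definition Eq :: "aexp \<Rightarrow> aexp \<Rightarrow> bexp" where
  "Eq a b = And (Le a b) (Le b a)"

lemma bval_simps [simp]:
  "bval (bconst b) x s = b" "bval (Or b1 b2) x s \<longleftrightarrow> bval b1 x s \<or> bval b2 x s"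
  "bval (Eq a1 a2) x s \<longleftrightarrow> aval a1 s = aval a2 s"
  by (auto simp: bconst_def Or_def Eq_def)

lemma bvars_simps [simp]:
  "bvars (bconst b) = {}" "bvars (Or b1 b2) = bvars b1 \<union> bvars b2" "bvars (Eq a1 a2) = avars a1 \<union> avars a2"
  by (auto simp: bconst_def Or_def Eq_def)

lemma well_scoped_simps [simp]:
  "well_scoped Nop d" "well_scoped (seqs ps) d \<longleftrightarrow> (\<forall>p\<in>set ps. well_scoped p d)"
  "well_scoped (emit_nat a) d \<longleftrightarrow> avars a \<subseteq> {0<..<d}"
  by (simp add: Nop_def, induction ps) (auto simp: emit_nat_def Nop_def)

lemma pvars_simps [simp]:
  "pvars Nop = {}" "pvars (seqs ps) = (\<Union>p\<in>set ps. pvars p)" "pvars (emit_nat a) = avars a"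
  by (simp add: Nop_def, induction ps) (auto simp: emit_nat_def Nop_def)

lemma concat_map_product:
  "concat (map f (List.product xs ys)) = concat (map (\<lambda>x. concat (map (\<lambda>y. f (x, y)) ys)) xs)"
  by (induction xs) (simp_all add: comp_def)

lemma upt_split: "i \<le> j \<Longrightarrow> j \<le> k \<Longrightarrow> [i..<k] = [i..<j] @ [j..<k]"
  using upt_add_eq_append[of i j "k - j"] by simp

lemma concat_upt_blocks:
  "concat (map (\<lambda>i. [a + m * i..<a + m * Suc i]) [0..<n]) = [a..<a + m * n]"
proof (induction n)
  case (Suc n)
  have "[a..<a + m * Suc n] = [a..<a + m * n] @ [a + m * n..<a + m * Suc n]"
    by (rule upt_split) simp_all
  then show ?case using Suc by simp
qed simp

lemma poly_aexp_exists:
  fixes p :: "nat poly"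
  shows "\<exists>a. avars a \<subseteq> {1} \<and> (\<forall>s. aval a s = poly p (s 1))"
proof (induction p)
  case 0
  show ?case by (rule exI[of _ "C 0"]) simp
next
  case (pCons c p)
  then obtain a where "avars a \<subseteq> {1}" "\<forall>s. aval a s = poly p (s 1)" by blast
  then show ?case by (intro exI[of _ "Add (C c) (Mul (V 1) a)"]) simp
qed

section \<open>Numbers of the nodes\<close>

fun slot :: "kind \<Rightarrow> nat" where
  "slot KG = 0"
| "slot KU = 2"
| "slot KV = 4"

definition cells :: "nat \<Rightarrow> (nat \<times> nat) list" where
  "cells T = List.product [0..<Suc T] [0..<Suc (2 * T)]"

text \<open>The row-major index of the pair in \<open>opts\<close>, with six nodes per pair after
  the four special ones. Both sides of the graph have the same size, so numbers on side
  \<open>B\<close> are shifted by it.\<close>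

definition gadget_num :: "nat \<Rightarrow> nat \<Rightarrow> nat \<times> nat \<Rightarrow> nat \<Rightarrow> nat" where
  "gadget_num T K c t = 4 + 6 * ((fst c * Suc (2 * T) + snd c) * Suc K + t)"

definition left_num :: "nat \<Rightarrow> nat \<Rightarrow> nat" where
  "left_num T K = 4 + 6 * (Suc T * Suc (2 * T) * Suc K)"

fun node_num :: "nat \<Rightarrow> nat \<Rightarrow> (nat \<times> nat) node \<Rightarrow> nat" where
  "node_num T K PP = 0"
| "node_num T K BB = 1"
| "node_num T K AA = 2"
| "node_num T K RR = 3"
| "node_num T K SS = left_num T K"
| "node_num T K QQ = left_num T K + 1"
| "node_num T K TT = left_num T K + 2"
| "node_num T K ZZ = left_num T K + 3"
| "node_num T K (A1 k c t) = gadget_num T K c t + slot k"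
| "node_num T K (A2 k c t) = gadget_num T K c t + slot k + 1"
| "node_num T K (B1 k c t) = left_num T K + gadget_num T K c t + slot k"
| "node_num T K (B2 k c t) = left_num T K + gadget_num T K c t + slot k + 1"

text \<open>\<open>concat_upt_blocks\<close> is applied at three levels: the values of a cell, the
  cells of a row, and the rows.\<close>

lemma concat_gadget_num:
  "concat (map (\<lambda>x. [a + gadget_num T K (fst x) (snd x)..<a + gadget_num T K (fst x) (snd x) + 6])
     (List.product (cells T) [0..<Suc K])) = [a + 4..<a + left_num T K]"
proof -
  let ?W = "Suc (2 * T)"
  have 1: "concat (map (\<lambda>t. [a + gadget_num T K c t..<a + gadget_num T K c t + 6]) [0..<Suc K])
    = [a + 4 + 6 * Suc K * (fst c * ?W + snd c)..<a + 4 + 6 * Suc K * Suc (fst c * ?W + snd c)]" for c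
    using concat_upt_blocks[of "a + 4 + 6 * Suc K * (fst c * ?W + snd c)" 6 "Suc K"]
    by (simp add: gadget_num_def algebra_simps del: upt_Suc)
  have 2: "concat (map (\<lambda>i. [a + 4 + 6 * Suc K * (r * ?W + i)..<a + 4 + 6 * Suc K * Suc (r * ?W + i)]) [0..<?W])
    = [a + 4 + 6 * Suc K * ?W * r..<a + 4 + 6 * Suc K * ?W * Suc r]" for r
    using concat_upt_blocks[of "a + 4 + 6 * Suc K * ?W * r" "6 * Suc K" ?W]
    by (simp add: algebra_simps del: upt_Suc)
  have 3: "concat (map (\<lambda>r. [a + 4 + 6 * Suc K * ?W * r..<a + 4 + 6 * Suc K * ?W * Suc r]) [0..<Suc T])
    = [a + 4..<a + left_num T K]"
    using concat_upt_blocks[of "a + 4" "6 * Suc K * ?W" "Suc T"]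
    by (simp add: left_num_def algebra_simps del: upt_Suc)
  show ?thesis
    unfolding concat_map_product cells_def fst_conv snd_conv 1 2 3 ..
qed

locale cell_csp =
  fixes T K :: nat and conf :: "nat \<times> nat \<Rightarrow> nat \<Rightarrow> nat \<times> nat \<Rightarrow> nat \<Rightarrow> bool"

sublocale cell_csp \<subseteq> csp "cells T" K conf
  by unfold_locales (simp add: cells_def distinct_product)

context cell_csp
begin

lemma map_node_num:
  "map (node_num T K) alist = [0..<left_num T K]"
  "map (node_num T K) blist = [left_num T K..<left_num T K + left_num T K]"
proof -
  have six: "[n..<n + 6] = [n, n + 1, n + 2, n + 3, n + 4, n + 5]" for n
    by (simp add: upt_rec)
  have four: "[n..<n + 4] = [n, n + 1, n + 2, n + 3]" for n
    by (simp add: upt_rec)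
  have le: "4 \<le> left_num T K" by (simp add: left_num_def)
  have "map (node_num T K) alist = [0..<4] @ concat (map (\<lambda>x. [0 + gadget_num T K (fst x) (snd x)..<0 + gadget_num T K (fst x) (snd x) + 6]) opts)"
    unfolding six four[of 0, simplified] by (simp add: alist_def map_concat comp_def numeral_eq_Suc)
  also have "\<dots> = [0..<left_num T K]"
    unfolding opts_def concat_gadget_num using upt_split[of 0 4 "left_num T K"] le by simp
  finally show "map (node_num T K) alist = [0..<left_num T K]" .
  have "map (node_num T K) blist = [left_num T K..<left_num T K + 4] @
      concat (map (\<lambda>x. [left_num T K + gadget_num T K (fst x) (snd x)..<left_num T K + gadget_num T K (fst x) (snd x) + 6]) opts)"
    unfolding six four by (simp add: blist_def map_concat comp_def numeral_eq_Suc)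
  also have "\<dots> = [left_num T K..<left_num T K + left_num T K]"
    unfolding opts_def concat_gadget_num
    using upt_split[of "left_num T K" "left_num T K + 4" "left_num T K + left_num T K"] le by simp
  finally show "map (node_num T K) blist = [left_num T K..<left_num T K + left_num T K]" .
qed

lemma length_lists: "length alist = left_num T K" "length blist = left_num T K"
  using map_node_num[THEN arg_cong[of _ _ length]] by simp_all

end

sublocale cell_csp \<subseteq> csp_numbering "cells T" K conf "node_num T K"
proof
  show "map (node_num T K) (alist @ blist) = [0..<length (alist @ blist)]"
    using upt_add_eq_append[of 0 "left_num T K" "left_num T K"]
    by (simp add: map_node_num length_lists)
qed


lemma concat_map_concat: "concat (map f (concat xss)) = concat (map (\<lambda>xs. concat (map f xs)) xss)"
  by (induction xss) auto

lemma concat_map_filter: "concat (map h (filter p xs)) = concat (map (\<lambda>x. if p x then h x else []) xs)"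
  by (induction xs) auto

section \<open>Programs that print the instance\<close>

definition gadget_e :: "aexp \<Rightarrow> nat \<Rightarrow> aexp \<times> aexp \<Rightarrow> nat \<Rightarrow> aexp" where
  "gadget_e TE K c t = Add (C 4) (Mul (C 6) (Add (Mul (Add (Mul (fst c) (Add (C 1) (Mul (C 2) TE))) (snd c)) (C (Suc K))) (C t)))"

definition left_e :: "aexp \<Rightarrow> nat \<Rightarrow> aexp" where
  "left_e TE K = Add (C 4) (Mul (C 6) (Mul (Mul (Add (C 1) TE) (Add (C 1) (Mul (C 2) TE))) (C (Suc K))))"

text \<open>Here the cells of nodes are pairs of expressions, so one node type describes both the
  program text and, through \<open>map_node (cell_val s)\<close>, the nodes that it prints.\<close>

fun num_e :: "aexp \<Rightarrow> nat \<Rightarrow> (aexp \<times> aexp) node \<Rightarrow> aexp" where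
  "num_e TE K PP = C 0"
| "num_e TE K BB = C 1"
| "num_e TE K AA = C 2"
| "num_e TE K RR = C 3"
| "num_e TE K SS = left_e TE K"
| "num_e TE K QQ = Add (left_e TE K) (C 1)"
| "num_e TE K TT = Add (left_e TE K) (C 2)"
| "num_e TE K ZZ = Add (left_e TE K) (C 3)"
| "num_e TE K (A1 k c t) = Add (gadget_e TE K c t) (C (slot k))"
| "num_e TE K (A2 k c t) = Add (gadget_e TE K c t) (C (slot k + 1))"
| "num_e TE K (B1 k c t) = Add (left_e TE K) (Add (gadget_e TE K c t) (C (slot k)))"
| "num_e TE K (B2 k c t) = Add (left_e TE K) (Add (gadget_e TE K c t) (C (slot k + 1)))"

definition cell_val :: "(nat \<Rightarrow> nat) \<Rightarrow> aexp \<times> aexp \<Rightarrow> nat \<times> nat" where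
  "cell_val s c = (aval (fst c) s, aval (snd c) s)"

lemma aval_num_e: "aval (num_e TE K nd) s = node_num (aval TE s) K (map_node (cell_val s) nd)"
proof -
  have [simp]: "aval (left_e TE K) s = left_num (aval TE s) K"
    by (simp add: left_e_def left_num_def)
  have [simp]: "aval (gadget_e TE K c t) s = gadget_num (aval TE s) K (cell_val s c) t" for c t
    by (simp add: gadget_e_def gadget_num_def cell_val_def)
  show ?thesis by (cases nd) auto
qed

definition item :: "aexp \<Rightarrow> nat \<Rightarrow> (aexp \<times> aexp) node \<Rightarrow> prog" where
  "item TE K nd = Emit True ;; emit_nat (num_e TE K nd)"

definition items :: "aexp \<Rightarrow> nat \<Rightarrow> (aexp \<times> aexp) node list \<Rightarrow> prog" where
  "items TE K nds = seqs (map (item TE K) nds)"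

text \<open>The loops bind \<open>d\<close> to the row and \<open>d + 2\<close> to the column;
  \<open>d + 1\<close> and \<open>d + 3\<close> are their counters, so the body lives at depth
  \<open>d + 4\<close>.\<close>

definition foreach :: "aexp \<Rightarrow> nat \<Rightarrow> (aexp \<times> aexp \<Rightarrow> prog) \<Rightarrow> prog" where
  "foreach TE d body = For (Add TE (C 1)) (For (Add (Mul (C 2) TE) (C 1)) (body (V d, V (d + 2))))"

type_synonym conf_exp = "aexp \<times> aexp \<Rightarrow> nat \<Rightarrow> aexp \<times> aexp \<Rightarrow> nat \<Rightarrow> bexp"

text \<open>Follows \<open>pref_list\<close> line by line. The cells depend on the input and are
  enumerated by loops; the values do not and are unrolled.\<close>

fun row :: "aexp \<Rightarrow> nat \<Rightarrow> conf_exp \<Rightarrow> nat \<Rightarrow> (aexp \<times> aexp) node \<Rightarrow> prog" where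
  "row TE K ce d PP = items TE K [QQ, SS]"
| "row TE K ce d BB = items TE K [QQ]"
| "row TE K ce d AA = items TE K [TT]"
| "row TE K ce d RR = items TE K [TT, ZZ] ;; foreach TE d (\<lambda>c. item TE K (B1 KG c K)) ;;
     foreach TE d (\<lambda>c. items TE K (map (B1 KV c) [0..<Suc K]))"
| "row TE K ce d SS = foreach TE d (\<lambda>c. items TE K (map (A1 KU c) [0..<Suc K])) ;;
     foreach TE d (\<lambda>c. item TE K (A1 KG c 0)) ;; items TE K [PP]"
| "row TE K ce d QQ = items TE K [PP, BB]"
| "row TE K ce d TT = items TE K [RR, AA] ;; foreach TE d (\<lambda>c. items TE K (map (A1 KG c) [0..<Suc K]))"
| "row TE K ce d ZZ = items TE K [RR]"
| "row TE K ce d (A1 KG c t) = items TE K ([TT, B1 KG c t] @ (if 0 < t then [B2 KG c (t - 1)] else []) @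
     [B2 KG c t] @ (if t = 0 then [SS] else []))"
| "row TE K ce d (A1 KU c t) = items TE K [B1 KU c t, B1 KG c t, B2 KU c t, SS]"
| "row TE K ce d (A1 KV c t) = items TE K [B1 KV c t, B1 KG c t, B2 KV c t] ;;
     foreach TE d (\<lambda>c'. seqs (map (\<lambda>t'. If (ce c' t' c t) (item TE K (B1 KU c' t')) Nop) [0..<Suc K]))"
| "row TE K ce d (A2 k c t) = items TE K [B2 k c t, B1 k c t]"
| "row TE K ce d (B1 KG c t) = items TE K ((if t = K then [RR] else []) @ [A2 KG c t, A1 KU c t, A1 KV c t, A1 KG c t])"
| "row TE K ce d (B1 KU c t) = items TE K [A2 KU c t] ;;
     foreach TE d (\<lambda>c'. seqs (map (\<lambda>t'. If (ce c t c' t') (item TE K (A1 KV c' t')) Nop) [0..<Suc K])) ;;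
     items TE K [A1 KU c t]"
| "row TE K ce d (B1 KV c t) = items TE K [A2 KV c t, RR, A1 KV c t]"
| "row TE K ce d (B2 k c t) = items TE K ([A1 k c t, A2 k c t] @ (if k = KG \<and> t < K then [A1 KG c (t + 1)] else []))"

definition full_row :: "aexp \<Rightarrow> nat \<Rightarrow> conf_exp \<Rightarrow> nat \<Rightarrow> (aexp \<times> aexp) node \<Rightarrow> prog" where
  "full_row TE K ce d nd = Emit True ;; row TE K ce d nd ;; Emit False"

definition rows :: "aexp \<Rightarrow> nat \<Rightarrow> conf_exp \<Rightarrow> (aexp \<times> aexp) node list \<Rightarrow> (aexp \<times> aexp \<Rightarrow> nat \<Rightarrow> (aexp \<times> aexp) node list) \<Rightarrow> prog" where
  "rows TE K ce nds f = seqs (map (full_row TE K ce 2) nds) ;;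
     foreach TE 2 (\<lambda>c. seqs (map (\<lambda>t. seqs (map (full_row TE K ce 6) (f c t))) [0..<Suc K]))"

definition emit_list :: "('a \<Rightarrow> prog) \<Rightarrow> 'a list \<Rightarrow> prog" where
  "emit_list g xs = seqs (map (\<lambda>x. Emit True ;; g x) xs) ;; Emit False"

definition program where
  "program TE K ce = (\<lambda>(e0, e1, u0, u1). emit_nat (left_e TE K) ;;
     rows TE K ce [PP, BB, AA, RR] (\<lambda>c t. concat (map (\<lambda>k. [A1 k c t, A2 k c t]) [KG, KU, KV])) ;;
     rows TE K ce [SS, QQ, TT, ZZ] (\<lambda>c t. concat (map (\<lambda>k. [B1 k c t, B2 k c t]) [KG, KU, KV])) ;; Emit False ;;
     emit_list (\<lambda>e. emit_nat (num_e TE K (fst e)) ;; emit_nat (num_e TE K (snd e))) e0 ;;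
     emit_list (\<lambda>e. emit_nat (num_e TE K (fst e)) ;; emit_nat (num_e TE K (snd e))) e1 ;;
     emit_list (\<lambda>u. emit_nat (num_e TE K u)) u0 ;; emit_list (\<lambda>u. emit_nat (num_e TE K u)) u1)"

lemma eval_item:
  "eval (item TE K nd) d x s = True # enc_nat (node_num (aval TE s) K (map_node (cell_val s) nd))"
  by (simp add: item_def aval_num_e)

lemma eval_items:
  "eval (items TE K nds) d x s = concat (map (\<lambda>nd. True # enc_nat (node_num (aval TE s) K (map_node (cell_val s) nd))) nds)"
  by (simp add: items_def comp_def eval_item)

lemma eval_foreach:
  assumes TE: "avars TE \<subseteq> {1}" and d: "2 \<le> d"
    and body: "\<And>s'. (\<And>v. v < d \<Longrightarrow> s' v = s v) \<Longrightarrow> (s' d, s' (d + 2)) \<in> set (cells (aval TE s)) \<Longrightarrow>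
      eval (body (V d, V (d + 2))) (d + 4) x s' = G (s' d, s' (d + 2))"
  shows "eval (foreach TE d body) d x s = concat (map G (cells (aval TE s)))"
proof -
  define T where "T = aval TE s"
  have TE': "aval TE s' = T" if "s' 1 = s 1" for s'
    unfolding T_def using that TE by (intro aval_cong) auto
  have "eval (foreach TE d body) d x s = concat (map (\<lambda>r. concat (map (\<lambda>i.
      eval (body (V d, V (d + 2))) (d + 4) x (s(d := r, d + 1 := T - r, d + 2 := i, d + 3 := 2 * T - i))) [0..<Suc (2 * T)])) [0..<Suc T])"
    using d by (simp add: foreach_def TE' numeral_eq_Suc del: upt_Suc)
  also have "\<dots> = concat (map (\<lambda>r. concat (map (\<lambda>i. G (r, i)) [0..<Suc (2 * T)])) [0..<Suc T])"
  proof (intro arg_cong[of _ _ concat] map_cong refl)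
    fix r i assume "r \<in> set [0..<Suc T]" "i \<in> set [0..<Suc (2 * T)]"
    then show "eval (body (V d, V (d + 2))) (d + 4) x (s(d := r, d + 1 := T - r, d + 2 := i, d + 3 := 2 * T - i)) = G (r, i)"
      using body[of "s(d := r, d + 1 := T - r, d + 2 := i, d + 3 := 2 * T - i)"] by (simp add: cells_def T_def del: upt_Suc)
  qed
  also have "\<dots> = concat (map G (cells T))" unfolding cells_def concat_map_product ..
  finally show ?thesis by (simp add: T_def)
qed


definition cell_vars :: "aexp \<times> aexp \<Rightarrow> nat set" where
  "cell_vars c = avars (fst c) \<union> avars (snd c)"

lemma cell_val_cong: "(\<And>v. v \<in> cell_vars c \<Longrightarrow> s v = s' v) \<Longrightarrow> cell_val s c = cell_val s' c"
  unfolding cell_val_def cell_vars_def by (auto intro: aval_cong)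

lemma cell_val_V [simp]: "cell_val s (V v, V v') = (s v, s v')"
  by (simp add: cell_val_def)

context cell_csp
begin

context
  fixes TE :: aexp and ce :: conf_exp and x :: "bool list"
  assumes TE: "avars TE \<subseteq> {1}" "\<And>s. s 1 = length x \<Longrightarrow> aval TE s = T"
    and ce: "\<And>s c t c' t'. s 1 = length x \<Longrightarrow> t \<le> K \<Longrightarrow> t' \<le> K \<Longrightarrow>
      bval (ce c t c' t') x s \<longleftrightarrow> conf (cell_val s c) t (cell_val s c') t'"
begin

definition entry :: "(nat \<times> nat) node \<Rightarrow> bool list" where
  "entry y = True # enc_nat (node_num T K y)"

lemma eval_row:
  assumes s: "s 1 = length x" and d: "2 \<le> d" and nd: "\<And>c. c \<in> set_node nd \<Longrightarrow> cell_vars c \<subseteq> {..<d}"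
    and t: "\<And>k c t. nd \<in> {A1 k c t, B1 k c t} \<Longrightarrow> t \<le> K"
  shows "eval (row TE K ce d nd) d x s = concat (map entry (pref_list (map_node (cell_val s) nd)))"
proof -
  have T: "aval TE s = T" using s TE by simp
  have fe: "eval (foreach TE d body) d x s = concat (map G (cells T))"
    if "\<And>s'. s' 1 = length x \<Longrightarrow> aval TE s' = T \<Longrightarrow> (\<And>c. c \<in> set_node nd \<Longrightarrow> cell_val s' c = cell_val s c) \<Longrightarrow>
      eval (body (V d, V (d + 2))) (d + 4) x s' = G (s' d, s' (d + 2))" for body G
    unfolding T[symmetric]
  proof (rule eval_foreach[OF TE(1) d])
    fix s' :: "nat \<Rightarrow> nat" assume s': "\<And>v. v < d \<Longrightarrow> s' v = s v"
    have "s' 1 = length x" using s' d s by simp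
    moreover have "cell_val s' c = cell_val s c" if "c \<in> set_node nd" for c
      using nd[OF that] s' by (intro cell_val_cong) auto
    ultimately show "eval (body (V d, V (d + 2))) (d + 4) x s' = G (s' d, s' (d + 2))"
      using that TE(2) by blast
  qed
  have prod: "concat (map (\<lambda>x. entry (f (fst x) (snd x))) opts) = concat (map (\<lambda>c. concat (map (\<lambda>t. entry (f c t)) [0..<Suc K])) (cells T))" for f
    by (simp add: opts_def concat_map_product comp_def del: upt_Suc)
  have prodf: "concat (map (\<lambda>x. entry (f (fst x) (snd x))) (filter p opts))
     = concat (map (\<lambda>c. concat (map (\<lambda>t. if p (c, t) then entry (f c t) else []) [0..<Suc K])) (cells T))" for f p
    unfolding concat_map_filter
    by (simp add: opts_def concat_map_product comp_def del: upt_Suc cong: if_cong)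
  have items: "eval (items TE K nds) d' x s' = concat (map entry (map (map_node (cell_val s')) nds))"
    if "aval TE s' = T" for nds d' s'
    by (simp add: that entry_def comp_def eval_items)
  have item: "eval (item TE K y) d' x s' = entry (map_node (cell_val s') y)" if "aval TE s' = T" for y d' s'
    by (simp add: that entry_def eval_item)
  show ?thesis
  proof (cases nd)
    case RR
    have "eval (foreach TE d (\<lambda>c. item TE K (B1 KG c K))) d x s = concat (map (\<lambda>c. entry (B1 KG c K)) (cells T))"
      by (rule fe) (simp add: item)
    moreover have "eval (foreach TE d (\<lambda>c. items TE K (map (B1 KV c) [0..<Suc K]))) d x s
      = concat (map (\<lambda>c. concat (map (\<lambda>t. entry (B1 KV c t)) [0..<Suc K])) (cells T))"
      by (rule fe) (simp add: items comp_def del: upt_Suc)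
    ultimately show ?thesis using RR T by (simp add: items prod[of "B1 KV"] comp_def del: upt_Suc)
  next
    case SS
    have "eval (foreach TE d (\<lambda>c. item TE K (A1 KG c 0))) d x s = concat (map (\<lambda>c. entry (A1 KG c 0)) (cells T))"
      by (rule fe) (simp add: item)
    moreover have "eval (foreach TE d (\<lambda>c. items TE K (map (A1 KU c) [0..<Suc K]))) d x s
      = concat (map (\<lambda>c. concat (map (\<lambda>t. entry (A1 KU c t)) [0..<Suc K])) (cells T))"
      by (rule fe) (simp add: items comp_def del: upt_Suc)
    ultimately show ?thesis using SS T by (simp add: items prod[of "A1 KU"] comp_def del: upt_Suc)
  next
    case TT
    have "eval (foreach TE d (\<lambda>c. items TE K (map (A1 KG c) [0..<Suc K]))) d x s
      = concat (map (\<lambda>c. concat (map (\<lambda>t. entry (A1 KG c t)) [0..<Suc K])) (cells T))"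
      by (rule fe) (simp add: items comp_def del: upt_Suc)
    then show ?thesis using TT T by (simp add: items prod[of "A1 KG"] comp_def del: upt_Suc)
  next
    case (A1 k c t)
    show ?thesis
    proof (cases k)
      case KV
      have "eval (foreach TE d (\<lambda>c'. seqs (map (\<lambda>t'. If (ce c' t' c t) (item TE K (B1 KU c' t')) Nop) [0..<Suc K]))) d x s
        = concat (map (\<lambda>c'. concat (map (\<lambda>t'. if conf c' t' (cell_val s c) t then entry (B1 KU c' t') else []) [0..<Suc K])) (cells T))"
        using A1 t by (intro fe) (auto simp: ce item comp_def simp del: upt_Suc intro!: arg_cong[of _ _ concat])
      then show ?thesis using A1 KV T
        by (simp add: items prodf[of "B1 KU" "\<lambda>x. conf (fst x) (snd x) (cell_val s c) t"] comp_def del: upt_Suc)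
    qed (use A1 T in \<open>simp_all add: items\<close>)
  next
    case (B1 k c t)
    show ?thesis
    proof (cases k)
      case KU
      have "eval (foreach TE d (\<lambda>c'. seqs (map (\<lambda>t'. If (ce c t c' t') (item TE K (A1 KV c' t')) Nop) [0..<Suc K]))) d x s
        = concat (map (\<lambda>c'. concat (map (\<lambda>t'. if conf (cell_val s c) t c' t' then entry (A1 KV c' t') else []) [0..<Suc K])) (cells T))"
        using B1 t by (intro fe) (auto simp: ce item comp_def simp del: upt_Suc intro!: arg_cong[of _ _ concat])
      then show ?thesis using B1 KU T
        by (simp add: items prodf[of "A1 KV" "\<lambda>x. conf (cell_val s c) t (fst x) (snd x)"] comp_def del: upt_Suc)
    qed (use B1 T in \<open>simp_all add: items\<close>)
  qed (use T in \<open>auto simp: items\<close>)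
qed

lemma eval_full_row:
  assumes "s 1 = length x" "2 \<le> d" "\<And>c. c \<in> set_node nd \<Longrightarrow> cell_vars c \<subseteq> {..<d}"
    "\<And>k c t. nd \<in> {A1 k c t, B1 k c t} \<Longrightarrow> t \<le> K"
  shows "eval (full_row TE K ce d nd) d x s = True # enc_list enc_nat (map (node_num T K) (pref_list (map_node (cell_val s) nd)))"
  using eval_row[of s d nd, OF assms] by (simp add: full_row_def enc_list_def entry_def[abs_def] comp_def)

lemma eval_rows:
  assumes s: "s 1 = length x" and nds: "\<And>nd. nd \<in> set nds \<Longrightarrow> nd \<in> {PP, BB, AA, RR, SS, QQ, TT, ZZ}"
    and f: "\<And>c t nd. nd \<in> set (f c t) \<Longrightarrow> \<exists>k. nd \<in> {A1 k c t, A2 k c t, B1 k c t, B2 k c t}"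
    and g: "\<And>s c t. map (map_node (cell_val s)) (f c t) = g (cell_val s c) t"
    and nds': "nds' = map (map_node (cell_val s)) nds"
  shows "eval (rows TE K ce nds f) 2 x s
    = concat (map (\<lambda>y. True # enc_list enc_nat (map (node_num T K) (pref_list y))) (nds' @ concat (map (\<lambda>x. g (fst x) (snd x)) opts)))"
proof -
  define R where "R y = True # enc_list enc_nat (map (node_num T K) (pref_list y))" for y
  have T: "aval TE s = T" using s TE by simp
  have 1: "eval (full_row TE K ce 2 nd) 2 x s = R (map_node (cell_val s) nd)" if "nd \<in> set nds" for nd
    unfolding R_def by (rule eval_full_row) (use nds[OF that] s in auto)
  have 2: "eval (foreach TE 2 (\<lambda>c. seqs (map (\<lambda>t. seqs (map (full_row TE K ce 6) (f c t))) [0..<Suc K]))) 2 x s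
      = concat (map (\<lambda>c. concat (map (\<lambda>t. concat (map R (g c t))) [0..<Suc K])) (cells (aval TE s)))"
  proof (rule eval_foreach[OF TE(1)])
    fix s' :: "nat \<Rightarrow> nat" assume "\<And>v. v < 2 \<Longrightarrow> s' v = s v"
    then have s': "s' 1 = length x" using s by simp
    let ?c = "(V 2, V (2 + 2))"
    have "eval (full_row TE K ce 6 nd) 6 x s' = R (map_node (cell_val s') nd)"
      if nd: "nd \<in> set (f ?c t)" and t: "t < Suc K" for nd t
      unfolding R_def
    proof (rule eval_full_row)
      show "s' 1 = length x" by (rule s')
      show "cell_vars c \<subseteq> {..<6}" if "c \<in> set_node nd" for c
        using f[OF nd] that by (auto simp: cell_vars_def)
      show "t' \<le> K" if "nd \<in> {A1 k c t', B1 k c t'}" for k c t'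
        using f[OF nd] that t by auto
    qed simp
    then have "concat (map (\<lambda>nd. eval (full_row TE K ce 6 nd) 6 x s') (f ?c t)) = concat (map R (g (s' 2, s' (2 + 2)) t))"
      if "t < Suc K" for t
      using that g[of s' ?c t, symmetric] by (simp add: comp_def cong: map_cong)
    then show "eval (seqs (map (\<lambda>t. seqs (map (full_row TE K ce 6) (f ?c t))) [0..<Suc K])) (2 + 4) x s'
      = concat (map (\<lambda>t. concat (map R (g (s' 2, s' (2 + 2)) t))) [0..<Suc K])"
      by (simp add: comp_def del: upt_Suc) (rule arg_cong[of _ _ concat], rule map_cong[OF refl], simp del: upt_Suc)
  qed simp
  have 3: "concat (map R (concat (map (\<lambda>x. g (fst x) (snd x)) opts)))
    = concat (map (\<lambda>c. concat (map (\<lambda>t. concat (map R (g c t))) [0..<Suc K])) (cells T))"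
    unfolding concat_map_concat by (simp add: opts_def comp_def concat_map_product del: upt_Suc)
  have "eval (rows TE K ce nds f) 2 x s = concat (map R nds') @
      concat (map (\<lambda>c. concat (map (\<lambda>t. concat (map R (g c t))) [0..<Suc K])) (cells T))"
    using 1 2 T by (simp add: rows_def nds' comp_def del: upt_Suc cong: map_cong)
  then show ?thesis
    using 3 unfolding R_def[abs_def] map_append concat_append by (simp only:)
qed

lemma eval_program:
  assumes s: "s 1 = length x"
  shows "eval (program TE K ce (e0, e1, u0, u1)) 2 x s
    = enc (inst (map (map_prod (map_node (cell_val s)) (map_node (cell_val s))) e0)
        (map (map_prod (map_node (cell_val s)) (map_node (cell_val s))) e1)
        (map (map_node (cell_val s)) u0) (map (map_node (cell_val s)) u1))"
proof -
  have T: "aval TE s = T" using s TE by simp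
  have left: "aval (left_e TE K) s = length alist" using aval_num_e[of TE K SS s] T by (simp add: length_lists)
  have A: "eval (rows TE K ce [PP, BB, AA, RR] (\<lambda>c t. concat (map (\<lambda>k. [A1 k c t, A2 k c t]) [KG, KU, KV]))) 2 x s
    = concat (map (\<lambda>y. True # enc_list enc_nat (map (node_num T K) (pref_list y))) alist)"
    unfolding alist_def by (rule eval_rows) (use s in auto)
  have B: "eval (rows TE K ce [SS, QQ, TT, ZZ] (\<lambda>c t. concat (map (\<lambda>k. [B1 k c t, B2 k c t]) [KG, KU, KV]))) 2 x s
    = concat (map (\<lambda>y. True # enc_list enc_nat (map (node_num T K) (pref_list y))) blist)"
    unfolding blist_def by (rule eval_rows) (use s in auto)
  have l: "eval (emit_list g xs) 2 x s = enc_list h ys"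
    if "map (\<lambda>z. eval (g z) 2 x s) xs = map h ys" for g h and xs :: "'b list" and ys :: "'d list"
  proof -
    have "eval (emit_list g xs) 2 x s = concat (map ((#) True) (map (\<lambda>z. eval (g z) 2 x s) xs)) @ [False]"
      by (simp add: emit_list_def comp_def)
    then show ?thesis unfolding that by (simp add: enc_list_def comp_def)
  qed
  have e: "eval (emit_list (\<lambda>e. emit_nat (num_e TE K (fst e)) ;; emit_nat (num_e TE K (snd e))) es) 2 x s
    = enc_list enc_pair (map (map_prod (node_num T K) (node_num T K)) (map (map_prod (map_node (cell_val s)) (map_node (cell_val s))) es))" for es
    by (rule l) (simp add: aval_num_e T enc_pair_def)
  have u: "eval (emit_list (\<lambda>u. emit_nat (num_e TE K u)) us) 2 x s
    = enc_list enc_nat (map (node_num T K) (map (map_node (cell_val s)) us))" for us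
    by (rule l) (simp add: aval_num_e T)
  show ?thesis
    unfolding program_def enc_def inst_def
    by (simp only: prod.case eval.simps A B e u eval_emit_nat left popm.simps)
      (simp add: enc_list_def comp_def)
qed

end

end

section \<open>Scoping of the program\<close>

lemma avars_num_e:
  assumes "avars TE \<subseteq> {1}" "\<And>c. c \<in> set_node nd \<Longrightarrow> cell_vars c \<subseteq> Y"
  shows "avars (num_e TE K nd) \<subseteq> insert 1 Y"
proof -
  have "avars (gadget_e TE K c t) \<subseteq> insert 1 Y" if "c \<in> set_node nd" for c t
    using assms(1) assms(2)[OF that] by (auto simp: gadget_e_def cell_vars_def)
  moreover have "avars (left_e TE K) \<subseteq> insert 1 Y" using assms(1) by (auto simp: left_e_def)
  ultimately show ?thesis by (cases nd) auto
qed

text \<open>The condition on a loop refers to the variables of its body, so a bound \<open>X\<close>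
  on these is carried along to make scoping compositional.\<close>

definition scoped :: "prog \<Rightarrow> nat \<Rightarrow> nat set \<Rightarrow> bool" where
  "scoped p d X \<longleftrightarrow> well_scoped p d \<and> pvars p \<subseteq> X"

lemma scoped_seq [intro]: "scoped p d X \<Longrightarrow> scoped q d X \<Longrightarrow> scoped (p ;; q) d X"
  by (simp add: scoped_def)

lemma scoped_seqs [intro]: "(\<And>p. p \<in> set ps \<Longrightarrow> scoped p d X) \<Longrightarrow> scoped (seqs ps) d X"
  by (auto simp: scoped_def)

lemma scoped_Nop [intro, simp]: "scoped Nop d X"
  by (simp add: scoped_def)

lemma scoped_Emit [intro, simp]: "scoped (Emit b) d X"
  by (simp add: scoped_def)

lemma scoped_emit_nat: "avars a \<subseteq> X \<Longrightarrow> X \<subseteq> {0<..<d} \<Longrightarrow> scoped (emit_nat a) d X"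
  by (auto simp: scoped_def)

lemma scoped_item:
  assumes "avars TE \<subseteq> {1}" "\<And>c. c \<in> set_node nd \<Longrightarrow> cell_vars c \<subseteq> X" "1 \<in> X" "X \<subseteq> {0<..<d}"
  shows "scoped (item TE K nd) d X"
proof -
  have "avars (num_e TE K nd) \<subseteq> X" using avars_num_e[OF assms(1,2)] assms(3) by (simp add: insert_absorb)
  then show ?thesis unfolding item_def by (intro scoped_seq scoped_Emit scoped_emit_nat assms(4))
qed

lemma scoped_items:
  assumes "avars TE \<subseteq> {1}" "\<And>nd c. nd \<in> set nds \<Longrightarrow> c \<in> set_node nd \<Longrightarrow> cell_vars c \<subseteq> X" "1 \<in> X" "X \<subseteq> {0<..<d}"
  shows "scoped (items TE K nds) d X"
  unfolding items_def
proof (rule scoped_seqs)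
  fix p assume "p \<in> set (map (item TE K) nds)"
  then obtain nd where p: "p = item TE K nd" "nd \<in> set nds" by auto
  show "scoped p d X" unfolding p(1) by (rule scoped_item[OF assms(1) assms(2)[OF p(2)] assms(3,4)])
qed

lemma scoped_foreach:
  assumes TE: "avars TE \<subseteq> {1}" and d: "2 \<le> d" and X: "1 \<in> X" "d + 1 \<notin> X" "d + 3 \<notin> X"
    and body: "scoped (body (V d, V (d + 2))) (d + 4) X"
  shows "scoped (foreach TE d body) d X"
proof -
  have vars: "avars TE \<subseteq> {0<..<d}" "avars TE \<subseteq> {0<..<d + 2}" "d + 1 \<notin> avars TE" "avars TE \<subseteq> X"
    using TE d X(1) by auto
  show ?thesis
    using vars X body by (auto simp: scoped_def foreach_def add.assoc numeral_eq_Suc)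
qed

lemma scoped_row:
  assumes TE: "avars TE \<subseteq> {1}" and d: "2 \<le> d"
    and ce: "\<And>c t c' t'. bvars (ce c t c' t') \<subseteq> insert 1 (cell_vars c \<union> cell_vars c')"
    and X: "1 \<in> X" "X \<subseteq> {0<..<d}" and nd: "\<And>c. c \<in> set_node nd \<Longrightarrow> cell_vars c \<subseteq> X"
  shows "scoped (row TE K ce d nd) d (X \<union> {d, d + 2})"
proof -
  define Z where "Z = X \<union> {d, d + 2}"
  let ?c = "(V d, V (d + 2))"
  have mono: "scoped p d Z" if "scoped p d X" for p using that by (auto simp: scoped_def Z_def)
  have X': "1 \<in> Z" "d + 1 \<notin> Z" "d + 3 \<notin> Z" "Z \<subseteq> {0<..<d + 4}" proof -
    have "0 < v \<and> v < d" if "v \<in> X" for v using X(2) that by auto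
    then show "1 \<in> Z" "d + 1 \<notin> Z" "d + 3 \<notin> Z" "Z \<subseteq> {0<..<d + 4}" using X(1) d unfolding Z_def by force+
  qed
  have c: "cell_vars ?c \<subseteq> Z" by (simp add: cell_vars_def Z_def)
  have items: "scoped (items TE K nds) d Z" if "\<And>y. y \<in> set nds \<Longrightarrow> set_node y \<subseteq> set_node nd" for nds
    by (rule mono, rule scoped_items[OF TE _ X]) (use that assms(6) in blast)
  have fe_items: "scoped (foreach TE d (\<lambda>c. items TE K (f c))) d Z" if "\<And>y. y \<in> set (f ?c) \<Longrightarrow> set_node y \<subseteq> {?c}" for f
  proof (rule scoped_foreach[OF TE d X'(1-3)])
    show "scoped (items TE K (f ?c)) (d + 4) Z"
      by (rule scoped_items[OF TE _ X'(1,4)]) (use that c in blast)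
  qed
  have fe_item: "scoped (foreach TE d (\<lambda>c. item TE K (f c))) d Z" if "set_node (f ?c) \<subseteq> {?c}" for f
  proof (rule scoped_foreach[OF TE d X'(1-3)])
    show "scoped (item TE K (f ?c)) (d + 4) Z"
      by (rule scoped_item[OF TE _ X'(1,4)]) (use that c in blast)
  qed
  have fe_if: "scoped (foreach TE d (\<lambda>c. seqs (map (\<lambda>t. prog.If (b c t) (item TE K (f c t)) Nop) [0..<Suc K]))) d Z"
    if "\<And>t. set_node (f ?c t) \<subseteq> {?c}" "\<And>t. bvars (b ?c t) \<subseteq> Z" for f b
  proof (rule scoped_foreach[OF TE d X'(1-3)], rule scoped_seqs)
    have 1: "scoped (item TE K (f ?c t)) (d + 4) Z" for t
      by (rule scoped_item[OF TE _ X'(1,4)]) (use that(1)[of t] c in blast)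
    fix p assume "p \<in> set (map (\<lambda>t. prog.If (b ?c t) (item TE K (f ?c t)) Nop) [0..<Suc K])"
    then obtain t where p: "p = prog.If (b ?c t) (item TE K (f ?c t)) Nop" by auto
    have "bvars (b ?c t) \<subseteq> {0<..<d + 4}" using that(2)[of t] X'(4) by blast
    then show "scoped p (d + 4) Z" using 1[of t] that(2)[of t] unfolding p scoped_def by simp
  qed
  have "scoped (row TE K ce d nd) d Z"
  proof (cases nd)
    case (A1 k c t)
    then have cX: "cell_vars c \<subseteq> X" using nd by simp
    have "bvars (ce ?c t' c t) \<subseteq> Z" for t' using ce[of ?c t' c t] c cX X(1) unfolding Z_def by blast
    then have "scoped (foreach TE d (\<lambda>c'. seqs (map (\<lambda>t'. prog.If (ce c' t' c t) (item TE K (B1 KU c' t')) Nop) [0..<Suc K]))) d Z"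
      by (intro fe_if[of "B1 KU" "\<lambda>c' t'. ce c' t' c t"]) simp_all
    then show ?thesis
      using A1 cX by (cases k) (auto intro!: scoped_seq items simp del: upt_Suc split: if_splits)
  next
    case (B1 k c t)
    then have cX: "cell_vars c \<subseteq> X" using nd by simp
    have "bvars (ce c t ?c t') \<subseteq> Z" for t' using ce[of c t ?c t'] c cX X(1) unfolding Z_def by blast
    then have "scoped (foreach TE d (\<lambda>c'. seqs (map (\<lambda>t'. prog.If (ce c t c' t') (item TE K (A1 KV c' t')) Nop) [0..<Suc K]))) d Z"
      by (intro fe_if[of "A1 KV" "\<lambda>c' t'. ce c t c' t'"]) simp_all
    then show ?thesis
      using B1 cX by (cases k) (auto intro!: scoped_seq items simp del: upt_Suc split: if_splits)
  next
    case RR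
    have "scoped (foreach TE d (\<lambda>c. item TE K (B1 KG c K))) d Z"
      by (rule fe_item[of "\<lambda>c. B1 KG c K"]) simp
    moreover have "scoped (foreach TE d (\<lambda>c. items TE K (map (B1 KV c) [0..<Suc K]))) d Z"
      by (rule fe_items[of "\<lambda>c. map (B1 KV c) [0..<Suc K]"]) auto
    moreover have "scoped (items TE K [TT, ZZ]) d Z" by (rule items) auto
    ultimately show ?thesis unfolding RR row.simps by (intro scoped_seq)
  next
    case SS
    have "scoped (foreach TE d (\<lambda>c. item TE K (A1 KG c 0))) d Z"
      by (rule fe_item[of "\<lambda>c. A1 KG c 0"]) simp
    moreover have "scoped (foreach TE d (\<lambda>c. items TE K (map (A1 KU c) [0..<Suc K]))) d Z"
      by (rule fe_items[of "\<lambda>c. map (A1 KU c) [0..<Suc K]"]) auto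
    moreover have "scoped (items TE K [PP]) d Z" by (rule items) auto
    ultimately show ?thesis unfolding SS row.simps by (intro scoped_seq)
  next
    case TT
    have "scoped (foreach TE d (\<lambda>c. items TE K (map (A1 KG c) [0..<Suc K]))) d Z"
      by (rule fe_items[of "\<lambda>c. map (A1 KG c) [0..<Suc K]"]) auto
    moreover have "scoped (items TE K [RR, AA]) d Z" by (rule items) auto
    ultimately show ?thesis unfolding TT row.simps by (intro scoped_seq)
  qed (auto intro!: items split: if_splits)
  then show ?thesis by (simp only: Z_def)
qed

lemma well_scoped_program:
  assumes TE: "avars TE \<subseteq> {1}"
    and ce: "\<And>c t c' t'. bvars (ce c t c' t') \<subseteq> insert 1 (cell_vars c \<union> cell_vars c')"
    and nds: "\<And>e. e \<in> set e0 \<union> set e1 \<Longrightarrow> set_node (fst e) = {} \<and> set_node (snd e) = {}" "\<And>u. u \<in> set u0 \<union> set u1 \<Longrightarrow> set_node u = {}"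
  shows "well_scoped (program TE K ce (e0, e1, u0, u1)) 2"
proof -
  \<comment> \<open>1 is the length of the input, 2 and 4 are the coordinates of a cell at the outer
    level and 6 and 8 at the inner one; the counters 3, 5, 7 and 9 are left out.\<close>
  let ?X = "{1, 2, 4, 6, 8} :: nat set"
  have mono: "scoped p d X \<Longrightarrow> X \<subseteq> Y \<Longrightarrow> scoped p d Y" for p d X Y by (auto simp: scoped_def)
  have rows: "scoped (rows TE K ce nds f) 2 ?X"
    if nds: "\<And>nd. nd \<in> set nds \<Longrightarrow> set_node nd = {}" and f: "\<And>c t nd. nd \<in> set (f c t) \<Longrightarrow> set_node nd \<subseteq> {c}" for nds f
    unfolding rows_def
  proof (intro scoped_seq scoped_seqs)
    fix p assume "p \<in> set (map (full_row TE K ce 2) nds)"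
    then obtain nd where p: "p = full_row TE K ce 2 nd" "nd \<in> set nds" by auto
    have "scoped (row TE K ce 2 nd) 2 ({1} \<union> {2, 2 + 2})"
      by (rule scoped_row) (use TE ce nds[OF p(2)] in auto)
    then show "scoped p 2 ?X" unfolding p full_row_def by (intro scoped_seq scoped_Emit) (erule mono, simp)
  next
    show "scoped (foreach TE 2 (\<lambda>c. seqs (map (\<lambda>t. seqs (map (full_row TE K ce 6) (f c t))) [0..<Suc K]))) 2 ?X"
    proof (rule scoped_foreach[OF TE], goal_cases)
      case 5
      let ?c = "(V 2, V (2 + 2))"
      have "scoped (row TE K ce 6 nd) 6 ({1, 2, 4} \<union> {6, 6 + 2})" if "nd \<in> set (f ?c t)" for nd t
        by (rule scoped_row[OF TE _ ce]) (use f[OF that] in \<open>auto simp: cell_vars_def\<close>)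
      then have "scoped (full_row TE K ce 6 nd) 6 ?X" if "nd \<in> set (f ?c t)" for nd t
        unfolding full_row_def using that by (intro scoped_seq scoped_Emit) (rule mono, blast, simp)
      then show ?case by (auto intro!: scoped_seqs simp del: upt_Suc)
    qed simp_all
  qed
  have num: "scoped (emit_nat (num_e TE K nd)) 2 ?X" if "set_node nd = {}" for nd
  proof -
    have "avars (num_e TE K nd) \<subseteq> {1}" using avars_num_e[OF TE, of nd "{}" K] that by simp
    then have "scoped (emit_nat (num_e TE K nd)) 2 {1}" by (intro scoped_emit_nat) auto
    then show ?thesis by (rule mono) simp
  qed
  have list: "scoped (emit_list g xs) 2 ?X" if "\<And>z. z \<in> set xs \<Longrightarrow> scoped (g z) 2 ?X" for g :: "'b \<Rightarrow> prog" and xs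
    unfolding emit_list_def using that by (auto intro!: scoped_seq scoped_seqs)
  have left: "scoped (emit_nat (left_e TE K)) 2 ?X" using num[of SS] by simp
  have "scoped (program TE K ce (e0, e1, u0, u1)) 2 ?X"
    unfolding program_def prod.case
    by (intro scoped_seq scoped_Emit rows left list num) (use nds in \<open>auto\<close>)
  then show ?thesis by (simp add: scoped_def)
qed

section \<open>The tableau as input of the reduction\<close>

context tableau
begin

definition option_list :: "option_t list" where
  "option_list = (SOME os. set os = {o1. valid o1})"

text \<open>Values are numbered from 1, because 0 is the dummy at the start of each chain.\<close>

definition opt :: "nat \<Rightarrow> option_t" where "opt t = option_list ! (t - 1)"

lemma set_option_list: "set option_list = {o1. valid o1}"
  unfolding option_list_def by (rule someI_ex) (rule finite_list[OF finite_valid])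

lemma opt_valid: "1 \<le> t \<Longrightarrow> t \<le> length option_list \<Longrightarrow> valid (opt t)"
  using set_option_list nth_mem[of "t - 1" option_list] by (auto simp: opt_def)

lemma valid_opt: "valid o1 \<Longrightarrow> \<exists>t. 1 \<le> t \<and> t \<le> length option_list \<and> opt t = o1"
proof -
  assume "valid o1"
  then obtain i where "i < length option_list" "option_list ! i = o1"
    using set_option_list by (metis in_set_conv_nth mem_Collect_eq)
  then show ?thesis by (intro exI[of _ "Suc i"]) (simp add: opt_def)
qed

text \<open>A constraint on a single cell, at the start or for acceptance, is expressed as a
  conflict of the cell with itself.\<close>

definition tconf :: "bool list \<Rightarrow> nat \<Rightarrow> nat \<Rightarrow> nat \<times> nat \<Rightarrow> nat \<Rightarrow> nat \<times> nat \<Rightarrow> nat \<Rightarrow> bool" where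
  "tconf x P T c t c' t' \<longleftrightarrow>
     (fst c' = fst c \<and> snd c' = snd c + 1 \<and> (hbad (opt t) (opt t') \<or> (fst c = 0 \<and> T \<le> snd c \<and> ybad (opt t) (opt t')))) \<or>
     (fst c' = fst c + 1 \<and> snd c' = snd c \<and> (vbad (opt t) (opt t') \<or> mbad Stay (opt t) (opt t'))) \<or>
     (fst c' = fst c + 1 \<and> snd c' = snd c + 1 \<and> mbad Right (opt t) (opt t')) \<or>
     (fst c' = fst c + 1 \<and> snd c = snd c' + 1 \<and> mbad Left (opt t) (opt t')) \<or>
     (fst c' = fst c \<and> snd c' = snd c \<and> ((fst c = 0 \<and> \<not> start_at x P T (snd c) (opt t)) \<or> (fst c = T \<and> snd c = T \<and> \<not> accepting (opt t))))"

text \<open>The options are known when the program is written, so every condition on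
  \<open>o1\<close> enters as a constant. The position and the input are examined at run
  time.\<close>

definition start_e :: "aexp \<Rightarrow> aexp \<Rightarrow> aexp \<Rightarrow> option_t \<Rightarrow> bexp" where
  "start_e PE TE i o1 =
     (let inr = (\<lambda>n. And (Le TE i) (Not (Le (Add TE n) i))); flags = (\<lambda>s. bconst (\<forall>j<num_tapes M. oflag o1 j = s)) in
     And (bconst (oq o1 = 0 \<and> osym o1 1 \<le> 2 \<and> (\<forall>j<num_tapes M. 2 \<le> j \<longrightarrow> osym o1 j = 0)))
     (And (Or (inr PE) (bconst (osym o1 1 = 0)))
     (And (Or (And (Not (Le TE i)) (flags (-1))) (Or (And (Eq i TE) (flags 0)) (And (Not (Le i TE)) (flags 1))))
       (Or (And (Not (inr (V 1))) (bconst (osym o1 0 = 0)))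
        (Or (And (inr (V 1)) (And (Bit i TE) (bconst (osym o1 0 = 2))))
          (And (inr (V 1)) (And (Not (Bit i TE)) (bconst (osym o1 0 = 1)))))))))"

text \<open>The transition rules enter as truth values for each pair of options; only the relative
  position of the cells is left to arithmetic.\<close>

definition conf_e :: "aexp \<Rightarrow> aexp \<Rightarrow> conf_exp" where
  "conf_e PE TE c t c' t' =
     Or (And (Eq (fst c') (fst c)) (And (Eq (snd c') (Add (snd c) (C 1)))
       (Or (bconst (hbad (opt t) (opt t'))) (And (Eq (fst c) (C 0)) (And (Le TE (snd c)) (bconst (ybad (opt t) (opt t'))))))))
     (Or (And (Eq (fst c') (Add (fst c) (C 1))) (And (Eq (snd c') (snd c)) (bconst (vbad (opt t) (opt t') \<or> mbad Stay (opt t) (opt t')))))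
     (Or (And (Eq (fst c') (Add (fst c) (C 1))) (And (Eq (snd c') (Add (snd c) (C 1))) (bconst (mbad Right (opt t) (opt t')))))
     (Or (And (Eq (fst c') (Add (fst c) (C 1))) (And (Eq (snd c) (Add (snd c') (C 1))) (bconst (mbad Left (opt t) (opt t')))))
       (And (Eq (fst c') (fst c)) (And (Eq (snd c') (snd c))
         (Or (And (Eq (fst c) (C 0)) (Not (start_e PE TE (snd c) (opt t))))
           (And (Eq (fst c) TE) (And (Eq (snd c) TE) (bconst (\<not> accepting (opt t)))))))))))"

context
  fixes x :: "bool list" and P T :: nat
  assumes T: "length x \<le> T" "P \<le> T"
begin

lemma bval_start_e:
  assumes "aval PE s = P" "aval TE s = T" "s 1 = length x"
  shows "bval (start_e PE TE i o1) x s \<longleftrightarrow> start_at x P T (aval i s) o1"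
proof -
  have tapes': "\<exists>j. j < num_tapes M" using tapes by (intro exI[of _ 0]) simp
  have sgn: "sgn (int (aval i s) - int T) = (if aval i s < T then -1 else if aval i s = T then 0 else 1)"
    by (simp add: sgn_if)
  show ?thesis
    unfolding start_at_def[OF T] start_def start_e_def Let_def sgn
    using assms by (auto simp: input_bit_def)
qed

lemma bval_conf_e:
  assumes "aval PE s = P" "aval TE s = T" "s 1 = length x"
  shows "bval (conf_e PE TE c t c' t') x s \<longleftrightarrow> tconf x P T (cell_val s c) t (cell_val s c') t'"
  using assms bval_start_e[OF assms] by (simp add: conf_e_def tconf_def cell_val_def)

lemma solution_iff_consistent:
  "(\<exists>sel. (\<forall>c\<in>set (cells T). 1 \<le> sel c \<and> sel c \<le> length option_list) \<and>
    (\<forall>c\<in>set (cells T). \<forall>c'\<in>set (cells T). \<not> tconf x P T c (sel c) c' (sel c'))) \<longleftrightarrow> (\<exists>f. consistent x P T f)"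
proof
  assume "\<exists>sel. (\<forall>c\<in>set (cells T). 1 \<le> sel c \<and> sel c \<le> length option_list) \<and>
    (\<forall>c\<in>set (cells T). \<forall>c'\<in>set (cells T). \<not> tconf x P T c (sel c) c' (sel c'))"
  then obtain sel where sel: "\<And>c. c \<in> set (cells T) \<Longrightarrow> 1 \<le> sel c \<and> sel c \<le> length option_list"
    "\<And>c c'. c \<in> set (cells T) \<Longrightarrow> c' \<in> set (cells T) \<Longrightarrow> \<not> tconf x P T c (sel c) c' (sel c')" by blast
  define f where "f t i = opt (sel (t, i))" for t i
  have in_cells: "(t, i) \<in> set (cells T)" if "t \<le> T" "i \<le> 2 * T" for t i
    using that by (simp add: cells_def del: upt_Suc)
  have no: "\<not> tconf x P T (t, i) (sel (t, i)) (t', i') (sel (t', i'))"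
    if "t \<le> T" "i \<le> 2 * T" "t' \<le> T" "i' \<le> 2 * T" for t i t' i'
    using sel(2) in_cells that by blast
  have "consistent x P T f"
    unfolding consistent_def[OF T]
  proof (intro conjI allI impI)
    show "valid (f t i)" if "t \<le> T" "i \<le> 2 * T" for t i
      unfolding f_def using sel(1)[OF in_cells[OF that]] by (intro opt_valid) auto
    show "\<not> hbad (f t i) (f t (Suc i))" if "t \<le> T" "i < 2 * T" for t i
      using no[of t i t "Suc i"] that by (simp add: tconf_def f_def)
    show "\<not> vbad (f t i) (f (Suc t) i)" "\<not> mbad Stay (f t i) (f (Suc t) i)" if "t < T" "i \<le> 2 * T" for t i
      using no[of t i "Suc t" i] that by (simp_all add: tconf_def f_def)
    show "\<not> mbad Right (f t i) (f (Suc t) (Suc i))" if "t < T" "i < 2 * T" for t i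
      using no[of t i "Suc t" "Suc i"] that by (simp add: tconf_def f_def)
    show "\<not> mbad Left (f t (Suc i)) (f (Suc t) i)" if "t < T" "i < 2 * T" for t i
      using no[of t "Suc i" "Suc t" i] that by (simp add: tconf_def f_def)
    show "start_at x P T i (f 0 i)" if "i \<le> 2 * T" for i
      using no[of 0 i 0 i] that by (simp add: tconf_def f_def)
    show "\<not> ybad (f 0 i) (f 0 (Suc i))" if "T \<le> i" "i < 2 * T" for i
      using no[of 0 i 0 "Suc i"] that by (simp add: tconf_def f_def)
    show "accepting (f T T)" using no[of T T T T] by (simp add: tconf_def f_def)
  qed
  then show "\<exists>f. consistent x P T f" by blast
next
  assume "\<exists>f. consistent x P T f"
  then obtain f where f: "consistent x P T f" by blast
  define sel where "sel c = (SOME t. 1 \<le> t \<and> t \<le> length option_list \<and> opt t = f (fst c) (snd c))" for c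
  have sel: "1 \<le> sel c \<and> sel c \<le> length option_list \<and> opt (sel c) = f (fst c) (snd c)" if c: "c \<in> set (cells T)" for c
  proof -
    have "fst c \<le> T" "snd c \<le> 2 * T" using c by (auto simp: cells_def simp del: upt_Suc)
    then have "valid (f (fst c) (snd c))" using f by (simp add: consistent_def[OF T])
    from someI_ex[OF valid_opt[OF this]] show ?thesis unfolding sel_def .
  qed
  have "\<not> tconf x P T c (sel c) c' (sel c')" if c: "c \<in> set (cells T)" and c': "c' \<in> set (cells T)" for c c'
  proof -
    obtain t i t' i' where ti: "c = (t, i)" "c' = (t', i')" by (cases c, cases c')
    have le: "t \<le> T" "i \<le> 2 * T" "t' \<le> T" "i' \<le> 2 * T" using c c' by (auto simp: cells_def ti simp del: upt_Suc)
    have o: "opt (sel c) = f t i" "opt (sel c') = f t' i'" using sel[OF c] sel[OF c'] by (simp_all add: ti)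
    have cons: "t \<le> T \<Longrightarrow> i < 2 * T \<Longrightarrow> \<not> hbad (f t i) (f t (Suc i))"
      "t < T \<Longrightarrow> i \<le> 2 * T \<Longrightarrow> \<not> vbad (f t i) (f (Suc t) i) \<and> \<not> mbad Stay (f t i) (f (Suc t) i)"
      "t < T \<Longrightarrow> i < 2 * T \<Longrightarrow> \<not> mbad Right (f t i) (f (Suc t) (Suc i))"
      "t < T \<Longrightarrow> i' < 2 * T \<Longrightarrow> \<not> mbad Left (f t (Suc i')) (f (Suc t) i')"
      "i \<le> 2 * T \<Longrightarrow> start_at x P T i (f 0 i)"
      "T \<le> i \<Longrightarrow> i < 2 * T \<Longrightarrow> \<not> ybad (f 0 i) (f 0 (Suc i))" "accepting (f T T)"
      using f by (simp_all add: consistent_def[OF T])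
    show ?thesis
    proof
      assume "tconf x P T c (sel c) c' (sel c')"
      then consider "t' = t" "i' = Suc i" "hbad (f t i) (f t' i')"
        | "t' = t" "i' = Suc i" "t = 0" "T \<le> i" "ybad (f t i) (f t' i')"
        | "t' = Suc t" "i' = i" "vbad (f t i) (f t' i') \<or> mbad Stay (f t i) (f t' i')"
        | "t' = Suc t" "i' = Suc i" "mbad Right (f t i) (f t' i')"
        | "t' = Suc t" "i = Suc i'" "mbad Left (f t i) (f t' i')"
        | "t = 0" "\<not> start_at x P T i (f t i)" | "t = T" "i = T" "\<not> accepting (f t i)"
        unfolding tconf_def o by (auto simp: ti)
      then show False by cases (use cons le in simp_all)
    qed
  qed
  then show "\<exists>sel. (\<forall>c\<in>set (cells T). 1 \<le> sel c \<and> sel c \<le> length option_list) \<and>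
    (\<forall>c\<in>set (cells T). \<forall>c'\<in>set (cells T). \<not> tconf x P T c (sel c) c' (sel c'))"
    using sel by blast
qed

end

end

section \<open>NP-hardness\<close>

text \<open>Only special nodes occur, and these carry no cell. The equation relates two type
  instances of \<open>restrictions\<close>: cells as expressions and cells as pairs of
  numbers.\<close>

lemma restrictions_map:
  assumes "k < 6" "restrictions ! k = (e0, e1, u0, u1)"
  shows "restrictions ! k = (map (map_prod (map_node g) (map_node g)) e0, map (map_prod (map_node g) (map_node g)) e1,
    map (map_node g) u0, map (map_node g) u1)"
proof -
  from assms(1) have "k = 0 \<or> k = 1 \<or> k = 2 \<or> k = 3 \<or> k = 4 \<or> k = 5" by auto
  then show ?thesis using assms(2) by (auto simp: restrictions_def)
qed

lemma restrictions_nth: "k < 6 \<Longrightarrow> restrictions ! k \<in> set restrictions"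
  by (rule nth_mem) (simp add: restrictions_def)

lemma halted_steps: "step M (num_states M, ts) = (num_states M, ts)"
  by (simp add: step_def)

lemma (in cell_csp) inst_sets:
  "E0 (inst e0 e1 u0 u1) = (\<lambda>e. {node_num T K (fst e), node_num T K (snd e)}) ` set e0"
  "E1 (inst e0 e1 u0 u1) = (\<lambda>e. {node_num T K (fst e), node_num T K (snd e)}) ` set e1"
  "U0 (inst e0 e1 u0 u1) = node_num T K ` set u0"
  "U1 (inst e0 e1 u0 u1) = node_num T K ` set u1"
  by (simp_all add: E0_def E1_def U0_def U1_def inst_def image_image case_prod_beta)

lemma NP_hard_for_restriction:
  fixes C :: "popm \<Rightarrow> bool"
  assumes k: "k < 6"
    and C: "\<And>T K conf e0 e1 u0 u1. restrictions ! k = (e0, e1, u0, u1) \<Longrightarrow>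
      C (csp_numbering.inst (cells T) K conf (node_num T K) e0 e1 u0 u1)"
  shows "NP_hard_for C"
  unfolding NP_hard_for_def NP_hard_def
proof
  fix L assume "L \<in> NP"
  then obtain R p where R: "poly_time_rel R"
    and L: "\<And>x. x \<in> L \<longleftrightarrow> (\<exists>y. length y \<le> poly p (length x) \<and> R x y)"
    by (auto simp: NP_def)
  from R obtain M and q :: "nat poly" where M: "turing_machine M"
    and q: "\<And>x y. computes_within M [x, y] [R x y] (poly q (length x + length y))"
    by (auto simp: poly_time_rel_def)
  \<comment> \<open>With two inputs \<open>computes_within\<close> implies at least three tapes,
    whatever the two strings are.\<close>
  interpret tableau M
    using M q[of "[]" "[]"] by unfold_locales (simp_all add: computes_within_def)
  \<comment> \<open>\<open>T\<close> has to bound the running time on every certificate of the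
    permitted length, and also this length and that of the input.\<close>
  define tp where "tp = pcompose q ([:0, 1:] + p) + p + [:0, 1:]"
  have tp: "poly tp n = poly q (n + poly p n) + poly p n + n" for n
    by (simp add: tp_def poly_pcompose)
  obtain PE where PE: "avars PE \<subseteq> {1}" "\<And>s. aval PE s = poly p (s 1)" using poly_aexp_exists[of p] by blast
  obtain TE where TE: "avars TE \<subseteq> {1}" "\<And>s. aval TE s = poly tp (s 1)" using poly_aexp_exists[of tp] by blast
  define K where "K = length option_list"
  obtain e0 e1 u0 and u1 :: "(aexp \<times> aexp) node list" where r: "restrictions ! k = (e0, e1, u0, u1)"
    by (cases "restrictions ! k :: _ \<times> _ \<times> _ \<times> (aexp \<times> aexp) node list" rule: prod_cases4)
  define f where "f x = eval (program TE K (conf_e PE TE) (e0, e1, u0, u1)) 2 x ((\<lambda>_. 0)(1 := length x))" for x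
  have in_set: "(e0, e1, u0, u1) \<in> set restrictions"
    unfolding r[symmetric] by (rule restrictions_nth[OF k])
  have poly_f: "poly_time f"
    unfolding f_def
  proof (rule poly_time_eval, rule well_scoped_program[OF TE(1)])
    show "bvars (conf_e PE TE c t c' t') \<subseteq> insert 1 (cell_vars c \<union> cell_vars c')" for c t c' t'
      using PE(1) TE(1) by (auto simp: conf_e_def start_e_def Let_def cell_vars_def)
  qed (use in_set in \<open>auto simp: restrictions_def\<close>)
  have "\<exists>I. f x = enc I \<and> wf_popm I \<and> C I \<and> (x \<in> L \<longleftrightarrow> solvable I)" for x
  proof -
    define P where "P = poly p (length x)"
    define T where "T = poly tp (length x)"
    have T: "length x \<le> T" "P \<le> T" by (simp_all add: T_def P_def tp)
    interpret cell_csp T K "tconf x P T" .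
    define s :: "nat \<Rightarrow> nat" where "s = (\<lambda>_. 0)(1 := length x)"
    define m where "m = map (map_prod (map_node (cell_val s)) (map_node (cell_val s)))"
    define m' where "m' = map (map_node (cell_val s))"
    define I where "I = inst (m e0) (m e1) (m' u0) (m' u1)"
    have r': "restrictions ! k = (m e0, m e1, m' u0, m' u1)"
      using restrictions_map[OF k r] by (simp add: m_def m'_def)
    then have in_set': "(m e0, m e1, m' u0, m' u1) \<in> set restrictions"
      using restrictions_nth[OF k] by metis
    have "f x = enc I"
      unfolding f_def s_def[symmetric] I_def m_def m'_def
    proof (rule eval_program[OF TE(1)])
      show "aval TE s' = T" if "s' 1 = length x" for s' using that TE(2) by (simp add: T_def)
      show "bval (conf_e PE TE c t c' t') x s' \<longleftrightarrow> tconf x P T (cell_val s' c) t (cell_val s' c') t'"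
        if "s' 1 = length x" for s' c t c' t'
        using that TE(2) PE(2) by (intro bval_conf_e[OF T]) (simp_all add: T_def P_def)
    qed (simp add: s_def)
    moreover have "x \<in> L \<longleftrightarrow> solution_exists"
    proof -
      have "accepts x T y \<longleftrightarrow> R x y" if y: "length y \<le> P" for y
      proof -
        define t where "t = poly q (length x + length y)"
        have "t \<le> T" using y poly_mono[of "length x + length y" "length x + P" q] by (simp add: t_def T_def tp P_def)
        then obtain d where d: "T = d + t" using le_Suc_ex by (metis add.commute)
        obtain ts where ts: "(step M ^^ t) (init M [x, y]) = (num_states M, ts)" "fst (last ts) = written [R x y]"
          using q[of x y] by (auto simp: computes_within_def t_def)
        \<comment> \<open>The verifier halts by time \<open>t\<close>, and the steps up to time
          \<open>T\<close> preserve its output.\<close>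
        have "(step M ^^ d) (num_states M, ts) = (num_states M, ts)"
          by (induction d) (simp_all add: halted_steps)
        then have "run x y T = (num_states M, ts)" by (simp add: run_def d funpow_add ts(1))
        then show ?thesis by (simp add: accepts_def[OF T] ts(2) written_def)
      qed
      then have "x \<in> L \<longleftrightarrow> (\<exists>y. length y \<le> P \<and> accepts x T y)" unfolding L P_def[symmetric] by blast
      also have "\<dots> \<longleftrightarrow> (\<exists>f. consistent x P T f)"
        using consistent_if_accepts[OF T] accepts_if_consistent[OF T] by blast
      also have "\<dots> \<longleftrightarrow> solution_exists"
        unfolding solution_exists_def unfolding K_def by (rule solution_iff_consistent[OF T, symmetric])
      finally show ?thesis .
    qed
    moreover have "C I" unfolding I_def by (rule C[OF r'])
    ultimately show ?thesis using restrictions[OF in_set'] unfolding I_def by blast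
  qed
  then obtain I where I: "\<And>x. f x = enc (I x) \<and> wf_popm (I x) \<and> C (I x) \<and> (x \<in> L \<longleftrightarrow> solvable (I x))" by metis
  have mem: "enc J \<in> enc ` S \<longleftrightarrow> J \<in> S" for J S by (auto simp: enc_inject)
  show "\<exists>f. poly_time f \<and> (\<forall>x. f x \<in> enc ` {I. wf_popm I \<and> C I} \<and> (x \<in> L \<longleftrightarrow> f x \<in> enc ` {I. wf_popm I \<and> C I \<and> solvable I}))"
    using I poly_f by (intro exI[of _ f]) (simp add: mem)
qed

theorem theorem13:
  shows
    "NP_hard_for (\<lambda>I. card (E0 I) = 2) \<and>
     NP_hard_for (\<lambda>I. card (E1 I) = 2) \<and>
     NP_hard_for (\<lambda>I. card (E0 I) = 1 \<and> card (E1 I) = 1) \<and>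
     NP_hard_for (\<lambda>I. card (U0 I) = 1 \<and> card (U1 I) = 1) \<and>
     NP_hard_for (\<lambda>I. card (U0 I) = 1 \<and> card (E0 I \<union> E1 I) = 1) \<and>
     NP_hard_for (\<lambda>I. card (U1 I) = 1 \<and> card (E0 I \<union> E1 I) = 1) \<and>
     NP_hard_for (\<lambda>I. card (E0 I) = 2 \<and> E1 I = {} \<and> U0 I = {} \<and> U1 I = {}) \<and>
     NP_hard_for (\<lambda>I. card (E1 I) = 2 \<and> E0 I = {} \<and> U0 I = {} \<and> U1 I = {}) \<and>
     NP_hard_for (\<lambda>I. card (E0 I) = 1 \<and> card (E1 I) = 1 \<and> U0 I = {} \<and> U1 I = {}) \<and>
     NP_hard_for (\<lambda>I. card (U0 I) = 1 \<and> card (U1 I) = 1 \<and> E0 I = {} \<and> E1 I = {}) \<and>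
     NP_hard_for (\<lambda>I. card (U0 I) = 1 \<and> card (E0 I \<union> E1 I) = 1 \<and> U1 I = {}) \<and>
     NP_hard_for (\<lambda>I. card (U1 I) = 1 \<and> card (E0 I \<union> E1 I) = 1 \<and> U0 I = {})"
proof -
  \<comment> \<open>The sharper forms, in which the other sets are empty, come directly from the
    construction; the first six follow by \<open>NP_hard_for_mono\<close>.\<close>
  have 1: "NP_hard_for (\<lambda>I. card (E0 I) = 2 \<and> E1 I = {} \<and> U0 I = {} \<and> U1 I = {})"
    by (rule NP_hard_for_restriction[of 0]) (auto simp: restrictions_def cell_csp.inst_sets left_num_def card_insert_if doubleton_eq_iff)
  have 2: "NP_hard_for (\<lambda>I. card (E1 I) = 2 \<and> E0 I = {} \<and> U0 I = {} \<and> U1 I = {})"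
    by (rule NP_hard_for_restriction[of 1]) (auto simp: restrictions_def cell_csp.inst_sets left_num_def card_insert_if doubleton_eq_iff)
  have 3: "NP_hard_for (\<lambda>I. card (E0 I) = 1 \<and> card (E1 I) = 1 \<and> U0 I = {} \<and> U1 I = {})"
    by (rule NP_hard_for_restriction[of 2]) (auto simp: restrictions_def cell_csp.inst_sets)
  have 4: "NP_hard_for (\<lambda>I. card (U0 I) = 1 \<and> card (U1 I) = 1 \<and> E0 I = {} \<and> E1 I = {})"
    by (rule NP_hard_for_restriction[of 3]) (auto simp: restrictions_def cell_csp.inst_sets)
  have 5: "NP_hard_for (\<lambda>I. card (U0 I) = 1 \<and> card (E0 I \<union> E1 I) = 1 \<and> U1 I = {})"
    by (rule NP_hard_for_restriction[of 4]) (auto simp: restrictions_def cell_csp.inst_sets)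
  have 6: "NP_hard_for (\<lambda>I. card (U1 I) = 1 \<and> card (E0 I \<union> E1 I) = 1 \<and> U0 I = {})"
    by (rule NP_hard_for_restriction[of 5]) (auto simp: restrictions_def cell_csp.inst_sets)
  show ?thesis
    using NP_hard_for_mono[OF 1] NP_hard_for_mono[OF 2] NP_hard_for_mono[OF 3] NP_hard_for_mono[OF 4]
      NP_hard_for_mono[OF 5] NP_hard_for_mono[OF 6] 1 2 3 4 5 6 by (intro conjI) simp_all
qed

end
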